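(* Let $(M,[\lambda,\mu])$ be a structure of an oriented congruence on a 3-manifold $M$ with nonvanishing twist, $a\neq 0$, and vanishing shear, $s\equiv 0$. Then it uniquely defines a 5-dimensional manifold $P$, fibred over $M$ and locally of the form $M\times\mathbb{C}^*$ with fibre coordinate $h=\rho e^{i\phi}$, 1-forms $\omega$ (real), $\omega_1,\bar\omega_1,\Omega,\bar\Omega$ and functions $K_1,K_2,\overline{K}_2$ on $P$ such that: - $\omega=f\lambda$, $\omega_1=h\mu$, $\bar\omega_1=\bar h\bar\mu$, with $f$ a nonvanishing real function on $P$; - $\omega\wedge\omega_1\wedge\bar\omega_1\wedge\Omega\wedge\bar\Omega\neq 0$ at each point of $P$; - the forms and the functions $K_1$ (real), $K_2$ (complex) are uniquely determined by the requirement that on $P$ $$d\omega=i\omega_1\wedge\bar\omega_1+(\Omega+\bar\Omega)\wedge\omega,\qquad d\omega_1=\Omega\wedge\omega_1,\qquad d\bar\omega_1=\bar\Omega\wedge\bar\omega_1,$$ $$d\Omega=K_1\,\omega_1\wedge\bar\omega_1+K_2\,\omega_1\wedge\omega,\qquad d\bar\Omega=-K_1\,\omega_1\wedge\bar\omega_1+\overline{K}_2\,\bar\omega_1\wedge\omega .$$ In particular, writing $K_1=\rho^{-2}k_1$ and $K_2=\rho^{-3}e^{-i\phi}k_2$ with $k_1$ (real) and $k_2$ (complex) functions on $M$, the identical vanishing, or not, of either $k_1$ or $k_2$ are invariant conditions (depending only on the structure, not on the representative $(\lambda,\mu)$). Also the sign of $k_1$ is an invariant, if $k_1\neq 0$.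
   Context: All objects are smooth. A structure of an oriented congruence $(M,[\lambda,\mu])$ on a 3-manifold $M$ is an equivalence class of pairs of 1-forms $(\lambda,\mu)$, $\lambda$ real, $\mu$ complex, with $\lambda\wedge\mu\wedge\bar\mu\neq 0$ everywhere, where $(\lambda,\mu)\sim(\lambda',\mu')$ iff $\lambda'=f\lambda$, $\mu'=h\mu$ for nonvanishing functions $f$ (real), $h$ (complex) on $M$. Two structures $(M,[\lambda,\mu])$, $(M',[\lambda',\mu'])$ are (locally) equivalent iff there is a (local) diffeomorphism $\varphi:M\to M'$ with $\varphi^*\lambda'=f\lambda$, $\varphi^*\mu'=h\mu$ for such $f,h$. For a representative write $$d\lambda=ia\,\mu\wedge\bar\mu+b\,\mu\wedge\lambda+\bar b\,\bar\mu\wedge\lambda,\qquad d\mu=p\,\mu\wedge\bar\mu+q\,\mu\wedge\lambda+s\,\bar\mu\wedge\lambda,$$ with $a$ real and $b,p,q,s$ complex functions. The vanishing or not of the twist $a$ and of the shear $s$ does not depend on the representative. ``Nonvanishing'' ($a\ne0$) means nonzero at every point. For a function $u$ write $du=u_\lambda\lambda+u_\mu\mu+u_{\bar\mu}\bar\mu$, with iterated subscripts applied from left to right ($u_{\mu\bar\mu}=(u_\mu)_{\bar\mu}$). Explicitly $$k_1=\mathrm{Re}\big((\log a)_{\mu\bar\mu}-(\log a)_\mu p-iqa-b_{\bar\mu}+bp-2\bar p_{\bar\mu}+2|p|^2\big),$$ $$k_2=a_{\mu\lambda}-ab_\lambda+i(\log a)_\mu(b_{\bar\mu}-\bar b_\mu-bp+\bar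 b\bar p)-2a_\mu q-aq_\mu-(a\bar q)_\mu-ab\bar q,$$ where derivatives of $\log a$ mean those of $\log|a|$. *)

theory Defs
  imports "HOL-Analysis.Analysis"
begin

section \<open>Smooth functions on open subsets of Euclidean spaces\<close>

fun Ck_on :: "nat \<Rightarrow> 'a::euclidean_space set \<Rightarrow> ('a \<Rightarrow> 'b::real_normed_vector) \<Rightarrow> bool" where
  "Ck_on 0 S f \<longleftrightarrow> continuous_on S f"
| "Ck_on (Suc k) S f \<longleftrightarrow>
     (\<forall>x\<in>S. f differentiable (at x)) \<and> (\<forall>v. Ck_on k S (\<lambda>x. frechet_derivative f (at x) v))"

definition smooth_on :: "'a::euclidean_space set \<Rightarrow> ('a \<Rightarrow> 'b::real_normed_vector) \<Rightarrow> bool" where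
  "smooth_on S f \<longleftrightarrow> (\<forall>k. Ck_on k S f)"

section \<open>Smooth manifolds\<close>

text \<open>
  A chart is a domain together with a coordinate map. The underlying set of a manifold is the
  union of the chart domains, an open subset of a second countable Hausdorff type; the dimension
  is that of the Euclidean space in which the charts take their values.
\<close>

type_synonym ('m, 'e) chart = "'m set \<times> ('m \<Rightarrow> 'e)"
type_synonym ('m, 'e) atlas = "('m, 'e) chart set"

abbreviation cdom :: "('m, 'e) chart \<Rightarrow> 'm set" where
  "cdom c \<equiv> fst c"

abbreviation cmap :: "('m, 'e) chart \<Rightarrow> 'm \<Rightarrow> 'e" where
  "cmap c \<equiv> snd c"

definition cinv :: "('m, 'e) chart \<Rightarrow> 'e \<Rightarrow> 'm" where
  "cinv c = inv_into (cdom c) (cmap c)"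

definition points :: "('m, 'e) atlas \<Rightarrow> 'm set" where
  "points A = (\<Union>c\<in>A. cdom c)"

definition smooth_manifold ::
  "('m::{t2_space, second_countable_topology}, 'e::euclidean_space) atlas \<Rightarrow> bool" where
  "smooth_manifold A \<longleftrightarrow>
     (\<forall>c\<in>A. open (cdom c) \<and> open (cmap c ` cdom c) \<and>
            homeomorphism (cdom c) (cmap c ` cdom c) (cmap c) (cinv c)) \<and>
     (\<forall>c\<in>A. \<forall>d\<in>A. smooth_on (cmap c ` (cdom c \<inter> cdom d)) (cmap d \<circ> cinv c))"

definition smooth_fun ::
  "('m, 'e::euclidean_space) atlas \<Rightarrow> ('m \<Rightarrow> 'b::real_normed_vector) \<Rightarrow> bool" where
  "smooth_fun A u \<longleftrightarrow> (\<forall>c\<in>A. smooth_on (cmap c ` cdom c) (u \<circ> cinv c))"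

definition smooth_map ::
  "('m::topological_space, 'e::euclidean_space) atlas \<Rightarrow>
   ('n::topological_space, 'f::euclidean_space) atlas \<Rightarrow> ('m \<Rightarrow> 'n) \<Rightarrow> bool" where
  "smooth_map A B \<phi> \<longleftrightarrow>
     \<phi> ` points A \<subseteq> points B \<and> continuous_on (points A) \<phi> \<and>
     (\<forall>c\<in>A. \<forall>d\<in>B. smooth_on (cmap c ` (cdom c \<inter> \<phi> -` cdom d)) (cmap d \<circ> \<phi> \<circ> cinv c))"

definition diffeo ::
  "('m::topological_space, 'e::euclidean_space) atlas \<Rightarrow>
   ('n::topological_space, 'f::euclidean_space) atlas \<Rightarrow> ('m \<Rightarrow> 'n) \<Rightarrow> bool" where
  "diffeo A B \<phi> \<longleftrightarrow>
     bij_betw \<phi> (points A) (points B) \<and> smooth_map A B \<phi> \<and>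
     smooth_map B A (inv_into (points A) \<phi>)"

definition restr :: "('m, 'e) atlas \<Rightarrow> 'm set \<Rightarrow> ('m, 'e) atlas" where
  "restr A U = (\<lambda>c. (cdom c \<inter> U, cmap c)) ` A"

definition prod_manifold :: "('m, 'e) atlas \<Rightarrow> ('n, 'f) atlas \<Rightarrow> ('m \<times> 'n, 'e \<times> 'f) atlas" where
  "prod_manifold A B =
     (\<lambda>(c, d). (cdom c \<times> cdom d, map_prod (cmap c) (cmap d))) ` (A \<times> B)"

definition cstar :: "(complex, complex) atlas" where
  "cstar = {(- {0}, id)}"

section \<open>Complex-valued differential forms\<close>

text \<open>
  A tangent vector at a point \<open>p\<close> is given by its component vector \<open>v\<close> in a chart \<open>c\<close> around \<open>p\<close>;
  the components in two charts are related by \<open>tmap id\<close>. Accordingly a 1-form \<open>\<alpha>\<close> is a family of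
  local expressions, where \<open>\<alpha> c p v\<close> is the value of \<open>\<alpha>\<close> at \<open>p\<close> on the vector with components \<open>v\<close> in
  the chart \<open>c\<close>, and these expressions have to transform correctly; likewise for 2-forms.
  Only the values for charts \<open>c\<close> of the atlas and points \<open>p\<close> of the domain of \<open>c\<close> are meaningful.
\<close>

type_synonym ('m, 'e) form1 = "('m, 'e) chart \<Rightarrow> 'm \<Rightarrow> 'e \<Rightarrow> complex"
type_synonym ('m, 'e) form2 = "('m, 'e) chart \<Rightarrow> 'm \<Rightarrow> 'e \<Rightarrow> 'e \<Rightarrow> complex"

text \<open>The tangent map of \<open>\<phi>\<close> at \<open>p\<close>, in a chart \<open>c\<close> around \<open>p\<close> and a chart \<open>d\<close> around \<open>\<phi> p\<close>.\<close>

definition tmap ::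
  "('m \<Rightarrow> 'n) \<Rightarrow> ('m, 'e::euclidean_space) chart \<Rightarrow> ('n, 'f::euclidean_space) chart \<Rightarrow>
   'm \<Rightarrow> 'e \<Rightarrow> 'f" where
  "tmap \<phi> c d p v = frechet_derivative (cmap d \<circ> \<phi> \<circ> cinv c) (at (cmap c p)) v"

definition smooth_form :: "('m, 'e::euclidean_space) atlas \<Rightarrow> ('m, 'e) form1 \<Rightarrow> bool" where
  "smooth_form A \<alpha> \<longleftrightarrow>
     (\<forall>c\<in>A. \<forall>p\<in>cdom c. linear (\<alpha> c p)) \<and>
     (\<forall>c\<in>A. \<forall>d\<in>A. \<forall>p\<in>cdom c \<inter> cdom d. \<forall>v. \<alpha> c p v = \<alpha> d p (tmap id c d p v)) \<and>
     (\<forall>c\<in>A. \<forall>v. smooth_on (cmap c ` cdom c) (\<lambda>y. \<alpha> c (cinv c y) v))"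

definition real_form :: "('m, 'e) atlas \<Rightarrow> ('m, 'e) form1 \<Rightarrow> bool" where
  "real_form A \<alpha> \<longleftrightarrow> (\<forall>c\<in>A. \<forall>p\<in>cdom c. \<forall>v. \<alpha> c p v \<in> \<real>)"

definition form_eq :: "('m, 'e) atlas \<Rightarrow> ('m, 'e) form1 \<Rightarrow> ('m, 'e) form1 \<Rightarrow> bool" where
  "form_eq A \<alpha> \<beta> \<longleftrightarrow> (\<forall>c\<in>A. \<forall>p\<in>cdom c. \<forall>v. \<alpha> c p v = \<beta> c p v)"

definition scale_form :: "('m \<Rightarrow> complex) \<Rightarrow> ('m, 'e) form1 \<Rightarrow> ('m, 'e) form1" where
  "scale_form u \<alpha> = (\<lambda>c p v. u p * \<alpha> c p v)"

definition add_form :: "('m, 'e) form1 \<Rightarrow> ('m, 'e) form1 \<Rightarrow> ('m, 'e) form1" where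
  "add_form \<alpha> \<beta> = (\<lambda>c p v. \<alpha> c p v + \<beta> c p v)"

definition cnj_form :: "('m, 'e) form1 \<Rightarrow> ('m, 'e) form1" where
  "cnj_form \<alpha> = (\<lambda>c p v. cnj (\<alpha> c p v))"

definition wedge :: "('m, 'e) form1 \<Rightarrow> ('m, 'e) form1 \<Rightarrow> ('m, 'e) form2" where
  "wedge \<alpha> \<beta> = (\<lambda>c p u v. \<alpha> c p u * \<beta> c p v - \<alpha> c p v * \<beta> c p u)"

text \<open>
  The value of \<open>\<alpha>\<^sub>1 \<and> \<dots> \<and> \<alpha>\<^sub>k\<close> on \<open>k\<close> vectors, by expansion along the first factor;
  for \<open>k = 2\<close> this is the formula in \<open>wedge\<close>.
\<close>

fun wedge_list :: "('e \<Rightarrow> complex) list \<Rightarrow> 'e list \<Rightarrow> complex" where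
  "wedge_list [] vs = 1"
| "wedge_list (\<alpha> # \<alpha>s) vs =
     (\<Sum>i<length vs. (- 1) ^ i * \<alpha> (vs ! i) * wedge_list \<alpha>s (take i vs @ drop (Suc i) vs))"

definition wedge_nonzero :: "('m, 'e) atlas \<Rightarrow> ('m, 'e) form1 list \<Rightarrow> bool" where
  "wedge_nonzero A \<alpha>s \<longleftrightarrow>
     (\<forall>c\<in>A. \<forall>p\<in>cdom c. \<exists>vs. length vs = length \<alpha>s \<and> wedge_list (map (\<lambda>\<alpha>. \<alpha> c p) \<alpha>s) vs \<noteq> 0)"

definition d_fun :: "('m \<Rightarrow> complex) \<Rightarrow> ('m, 'e::euclidean_space) form1" where
  "d_fun u = (\<lambda>c p v. frechet_derivative (u \<circ> cinv c) (at (cmap c p)) v)"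

definition d_form :: "('m, 'e::euclidean_space) form1 \<Rightarrow> ('m, 'e) form2" where
  "d_form \<alpha> = (\<lambda>c p u v.
     frechet_derivative (\<lambda>y. \<alpha> c (cinv c y) v) (at (cmap c p)) u -
     frechet_derivative (\<lambda>y. \<alpha> c (cinv c y) u) (at (cmap c p)) v)"

text \<open>
  The pullback \<open>\<phi>\<^sup>*\<alpha>\<close> of a form on \<open>B\<close>. The chart around \<open>\<phi> p\<close> is irrelevant, because the local
  expressions of \<open>\<alpha>\<close> transform correctly.
\<close>

definition pullback ::
  "('n, 'f::euclidean_space) atlas \<Rightarrow> ('m \<Rightarrow> 'n) \<Rightarrow> ('n, 'f) form1 \<Rightarrow>
   ('m, 'e::euclidean_space) form1" where
  "pullback B \<phi> \<alpha> = (\<lambda>c p v.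
     let d = (SOME d. d \<in> B \<and> \<phi> p \<in> cdom d) in \<alpha> d (\<phi> p) (tmap \<phi> c d p v))"

section \<open>Oriented congruences\<close>

definition oriented_congruence ::
  "('m, real^3) atlas \<Rightarrow> ('m, real^3) form1 \<Rightarrow> ('m, real^3) form1 \<Rightarrow> bool" where
  "oriented_congruence M lam mu \<longleftrightarrow>
     smooth_form M lam \<and> real_form M lam \<and> smooth_form M mu \<and>
     wedge_nonzero M [lam, mu, cnj_form mu]"

definition same_congruence ::
  "('m, real^3) atlas \<Rightarrow> ('m, real^3) form1 \<Rightarrow> ('m, real^3) form1 \<Rightarrow>
   ('m, real^3) form1 \<Rightarrow> ('m, real^3) form1 \<Rightarrow> bool" where
  "same_congruence M lam mu lam' mu' \<longleftrightarrow>
     (\<exists>(f :: 'm \<Rightarrow> real) (h :: 'm \<Rightarrow> complex).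
        smooth_fun M f \<and> smooth_fun M h \<and> (\<forall>x\<in>points M. f x \<noteq> 0 \<and> h x \<noteq> 0) \<and>
        form_eq M lam' (scale_form (\<lambda>x. complex_of_real (f x)) lam) \<and>
        form_eq M mu' (scale_form h mu))"

text \<open>
  The coefficients \<open>(a, b)\<close> and \<open>(p, q, s)\<close> of the structure equations
  \<open>d\<lambda> = i a \<mu> \<and> \<mu>' + b \<mu> \<and> \<lambda> + b' \<mu>' \<and> \<lambda>\<close> and \<open>d\<mu> = p \<mu> \<and> \<mu>' + q \<mu> \<and> \<lambda> + s \<mu>' \<and> \<lambda>\<close> at a point,
  where a prime denotes complex conjugation. They exist and are unique because
  \<open>\<lambda>\<close>, \<open>\<mu>\<close>, \<open>\<mu>'\<close> is a coframe and \<open>\<lambda>\<close> is real.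
\<close>

definition dlam_coeffs ::
  "('m, real^3) atlas \<Rightarrow> ('m, real^3) form1 \<Rightarrow> ('m, real^3) form1 \<Rightarrow> 'm \<Rightarrow> real \<times> complex" where
  "dlam_coeffs M lam mu x = (THE (a, b). \<forall>c\<in>M. x \<in> cdom c \<longrightarrow> (\<forall>u v.
     d_form lam c x u v =
       \<i> * complex_of_real a * wedge mu (cnj_form mu) c x u v
       + b * wedge mu lam c x u v + cnj b * wedge (cnj_form mu) lam c x u v))"

definition dmu_coeffs ::
  "('m, real^3) atlas \<Rightarrow> ('m, real^3) form1 \<Rightarrow> ('m, real^3) form1 \<Rightarrow> 'm \<Rightarrow>
   complex \<times> complex \<times> complex" where
  "dmu_coeffs M lam mu x = (THE (p, q, s). \<forall>c\<in>M. x \<in> cdom c \<longrightarrow> (\<forall>u v.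
     d_form mu c x u v =
       p * wedge mu (cnj_form mu) c x u v
       + q * wedge mu lam c x u v + s * wedge (cnj_form mu) lam c x u v))"

definition twist where "twist M lam mu x = fst (dlam_coeffs M lam mu x)"
definition coeff_b where "coeff_b M lam mu x = snd (dlam_coeffs M lam mu x)"
definition coeff_p where "coeff_p M lam mu x = fst (dmu_coeffs M lam mu x)"
definition coeff_q where "coeff_q M lam mu x = fst (snd (dmu_coeffs M lam mu x))"
definition shear where "shear M lam mu x = snd (snd (dmu_coeffs M lam mu x))"

text \<open>The triple \<open>(u\<^sub>\<lambda>, u\<^sub>\<mu>, u\<^sub>\<mu>\<^sub>')\<close> of coefficients of \<open>du\<close> in the coframe \<open>\<lambda>\<close>, \<open>\<mu>\<close>, \<open>\<mu>'\<close>.\<close>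

definition frame_derivs ::
  "('m, real^3) atlas \<Rightarrow> ('m, real^3) form1 \<Rightarrow> ('m, real^3) form1 \<Rightarrow> ('m \<Rightarrow> complex) \<Rightarrow> 'm \<Rightarrow>
   complex \<times> complex \<times> complex" where
  "frame_derivs M lam mu u x = (THE (l, m, n). \<forall>c\<in>M. x \<in> cdom c \<longrightarrow> (\<forall>v.
     d_fun u c x v = l * lam c x v + m * mu c x v + n * cnj_form mu c x v))"

definition D_lam where "D_lam M lam mu u x = fst (frame_derivs M lam mu u x)"
definition D_mu where "D_mu M lam mu u x = fst (snd (frame_derivs M lam mu u x))"
definition D_mubar where "D_mubar M lam mu u x = snd (snd (frame_derivs M lam mu u x))"

text \<open>
  Iterated derivatives act from left to right: \<open>u\<^sub>\<mu>\<^sub>\<mu>\<^sub>'\<close> is \<open>D_mubar\<close> applied to \<open>D_mu u\<close>.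
  Derivatives of \<open>log a\<close> are those of \<open>log |a|\<close>, as \<open>a\<close> may be negative.
\<close>

definition k1 ::
  "('m, real^3) atlas \<Rightarrow> ('m, real^3) form1 \<Rightarrow> ('m, real^3) form1 \<Rightarrow> 'm \<Rightarrow> real" where
  "k1 M lam mu x =
    (let a = (\<lambda>x. complex_of_real (twist M lam mu x));
         loga = (\<lambda>x. complex_of_real (ln \<bar>twist M lam mu x\<bar>));
         b = coeff_b M lam mu; p = coeff_p M lam mu; q = coeff_q M lam mu;
         Dm = D_mu M lam mu; Dmb = D_mubar M lam mu
     in Re (Dmb (Dm loga) x - Dm loga x * p x - \<i> * q x * a x - Dmb b x + b x * p x
            - 2 * Dmb (\<lambda>y. cnj (p y)) x + 2 * complex_of_real ((cmod (p x))\<^sup>2)))"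

definition k2 ::
  "('m, real^3) atlas \<Rightarrow> ('m, real^3) form1 \<Rightarrow> ('m, real^3) form1 \<Rightarrow> 'm \<Rightarrow> complex" where
  "k2 M lam mu x =
    (let a = (\<lambda>x. complex_of_real (twist M lam mu x));
         loga = (\<lambda>x. complex_of_real (ln \<bar>twist M lam mu x\<bar>));
         b = coeff_b M lam mu; p = coeff_p M lam mu; q = coeff_q M lam mu;
         Dl = D_lam M lam mu; Dm = D_mu M lam mu; Dmb = D_mubar M lam mu
     in Dl (Dm a) x - a x * Dl b x
        + \<i> * Dm loga x * (Dmb b x - Dm (\<lambda>y. cnj (b y)) x - b x * p x + cnj (b x) * cnj (p x))
        - 2 * Dm a x * q x - a x * Dm q x - Dm (\<lambda>y. a y * cnj (q y)) x
        - a x * b x * cnj (q x))"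

section \<open>The 5-dimensional bundle with its invariant forms\<close>

text \<open>
  A 5-manifold fibred over \<open>M\<close> by \<open>pr\<close>, which is locally \<open>M \<times> \<complex>\<^sup>*\<close> with fibre coordinate \<open>h\<close>.
  The coordinate is a globally defined function, since \<open>\<omega>\<^sub>1 = h \<mu>\<close> below determines it.
\<close>

definition cstar_bundle ::
  "('m::{t2_space, second_countable_topology}, real^3) atlas \<Rightarrow>
   ('p::{t2_space, second_countable_topology}, 'f::euclidean_space) atlas \<Rightarrow>
   ('p \<Rightarrow> 'm) \<Rightarrow> ('p \<Rightarrow> complex) \<Rightarrow> bool" where
  "cstar_bundle M P pr h \<longleftrightarrow>
     smooth_manifold P \<and> DIM('f) = 5 \<and>
     smooth_map P M pr \<and> smooth_map P cstar h \<and>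
     (\<forall>x\<in>points M. \<exists>U. open U \<and> x \<in> U \<and> U \<subseteq> points M \<and>
        diffeo (restr P (pr -` U)) (prod_manifold (restr M U) cstar) (\<lambda>y. (pr y, h y)))"

definition invariant_system ::
  "('m::{t2_space, second_countable_topology}, real^3) atlas \<Rightarrow>
   ('m, real^3) form1 \<Rightarrow> ('m, real^3) form1 \<Rightarrow>
   ('p::{t2_space, second_countable_topology}, 'f::euclidean_space) atlas \<Rightarrow>
   ('p \<Rightarrow> 'm) \<Rightarrow> ('p \<Rightarrow> complex) \<Rightarrow> ('p \<Rightarrow> real) \<Rightarrow>
   ('p, 'f) form1 \<Rightarrow> ('p, 'f) form1 \<Rightarrow> ('p, 'f) form1 \<Rightarrow>
   ('p \<Rightarrow> real) \<Rightarrow> ('p \<Rightarrow> complex) \<Rightarrow> bool" where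
  "invariant_system M lam mu P pr h f \<omega> \<omega>\<^sub>1 \<Omega> K\<^sub>1 K\<^sub>2 \<longleftrightarrow>
     smooth_fun P f \<and> (\<forall>y\<in>points P. f y \<noteq> 0) \<and>
     smooth_form P \<omega> \<and> real_form P \<omega> \<and> smooth_form P \<omega>\<^sub>1 \<and> smooth_form P \<Omega> \<and>
     smooth_fun P K\<^sub>1 \<and> smooth_fun P K\<^sub>2 \<and>
     form_eq P \<omega> (scale_form (\<lambda>y. complex_of_real (f y)) (pullback M pr lam)) \<and>
     form_eq P \<omega>\<^sub>1 (scale_form h (pullback M pr mu)) \<and>
     wedge_nonzero P [\<omega>, \<omega>\<^sub>1, cnj_form \<omega>\<^sub>1, \<Omega>, cnj_form \<Omega>] \<and>
     (\<forall>c\<in>P. \<forall>y\<in>cdom c. \<forall>u v.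
        d_form \<omega> c y u v =
          \<i> * wedge \<omega>\<^sub>1 (cnj_form \<omega>\<^sub>1) c y u v + wedge (add_form \<Omega> (cnj_form \<Omega>)) \<omega> c y u v \<and>
        d_form \<omega>\<^sub>1 c y u v = wedge \<Omega> \<omega>\<^sub>1 c y u v \<and>
        d_form (cnj_form \<omega>\<^sub>1) c y u v = wedge (cnj_form \<Omega>) (cnj_form \<omega>\<^sub>1) c y u v \<and>
        d_form \<Omega> c y u v =
          complex_of_real (K\<^sub>1 y) * wedge \<omega>\<^sub>1 (cnj_form \<omega>\<^sub>1) c y u v
          + K\<^sub>2 y * wedge \<omega>\<^sub>1 \<omega> c y u v \<and>
        d_form (cnj_form \<Omega>) c y u v =
          - complex_of_real (K\<^sub>1 y) * wedge \<omega>\<^sub>1 (cnj_form \<omega>\<^sub>1) c y u v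
          + cnj (K\<^sub>2 y) * wedge (cnj_form \<omega>\<^sub>1) \<omega> c y u v)"

definition invariant_bundle where
  "invariant_bundle M lam mu P pr h f \<omega> \<omega>\<^sub>1 \<Omega> K\<^sub>1 K\<^sub>2 \<longleftrightarrow>
     cstar_bundle M P pr h \<and> invariant_system M lam mu P pr h f \<omega> \<omega>\<^sub>1 \<Omega> K\<^sub>1 K\<^sub>2"

definition bundle_iso ::
  "('p::topological_space, 'f::euclidean_space) atlas \<Rightarrow> ('p \<Rightarrow> 'm) \<Rightarrow>
   ('p, 'f) form1 \<Rightarrow> ('p, 'f) form1 \<Rightarrow> ('p, 'f) form1 \<Rightarrow> ('p \<Rightarrow> real) \<Rightarrow> ('p \<Rightarrow> complex) \<Rightarrow>
   ('q::topological_space, 'g::euclidean_space) atlas \<Rightarrow> ('q \<Rightarrow> 'm) \<Rightarrow>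
   ('q, 'g) form1 \<Rightarrow> ('q, 'g) form1 \<Rightarrow> ('q, 'g) form1 \<Rightarrow> ('q \<Rightarrow> real) \<Rightarrow> ('q \<Rightarrow> complex) \<Rightarrow>
   ('p \<Rightarrow> 'q) \<Rightarrow> bool" where
  "bundle_iso P pr \<omega> \<omega>\<^sub>1 \<Omega> K\<^sub>1 K\<^sub>2 P' pr' \<omega>' \<omega>\<^sub>1' \<Omega>' K\<^sub>1' K\<^sub>2' \<Phi> \<longleftrightarrow>
     diffeo P P' \<Phi> \<and>
     (\<forall>y\<in>points P. pr' (\<Phi> y) = pr y \<and> K\<^sub>1' (\<Phi> y) = K\<^sub>1 y \<and> K\<^sub>2' (\<Phi> y) = K\<^sub>2 y) \<and>
     form_eq P (pullback P' \<Phi> \<omega>') \<omega> \<and>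
     form_eq P (pullback P' \<Phi> \<omega>\<^sub>1') \<omega>\<^sub>1 \<and>
     form_eq P (pullback P' \<Phi> \<Omega>') \<Omega>"

end

theory Submission
  imports Defs
begin

text \<open>
  Comparing \<open>d\<omega>\<^sub>1 = \<Omega> \<and> \<omega>\<^sub>1\<close> with \<open>d\<mu>\<close> gives \<open>\<Omega> = dh/h - p \<mu>' - q \<lambda> + A \<mu>\<close> for some function \<open>A\<close>, where a
  prime denotes complex conjugation, and the equation for \<open>d\<omega>\<close> then forces \<open>f = |h|\<^sup>2 / a\<close> and
  \<open>A = b + p' - (log a)\<^sub>\<mu>\<close>. So \<open>\<Omega> = dh/h + \<theta>\<close> with a form \<open>\<theta>\<close> on \<open>M\<close>, hence \<open>d\<Omega> = d\<theta>\<close>, and the identities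
  \<open>d\<^sup>2\<lambda> = d\<^sup>2\<mu> = d\<^sup>2 log |a| = 0\<close> turn \<open>d\<theta>\<close> into \<open>k\<^sub>1 \<mu> \<and> \<mu>' + (k\<^sub>2 / a) \<mu> \<and> \<lambda>\<close> with \<open>k\<^sub>1\<close> real.
  A solution for another representative is a solution for \<open>(\<lambda>, \<mu>)\<close> whose fibre coordinate is
  multiplied by a function on \<open>M\<close>; this gives the isomorphisms and the invariance of \<open>k\<^sub>1\<close> and \<open>k\<^sub>2\<close>.
\<close>

section \<open>Calculus of smooth functions\<close>

text \<open>Vanishing shear is a compatibility condition:
  \<open>\<Omega> \<and> \<omega>\<^sub>1\<close> is a multiple of \<mu> and so has no \<mu>' \<and>
  \<lambda> component. The divisor a under k_2 and the weight 1 / (h |h|^2) of K_2 both come from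
  substituting f into \<open>K\<^sub>2 \<omega>\<^sub>1 \<and> \<omega>\<close>, which is K_2 h f
  \<mu> \<and> \<lambda>. All local trivialisations use the same pair (\<open>pr\<close>,
  \<open>h\<close>), so they glue to a single diffeomorphism from P onto the product of M with the
  punctured plane. Its inverse lifts any base vector together with any prescribed value of dh to a
  vector on P, and uniqueness becomes linear algebra at one point: two solutions \<Omega> differ by
  X with X \<and> \<mu> = 0, hence X = x \<mu>, and (X + X') \<and> \<lambda> = 0 then forces x = 0.
  Forms are families of chart expressions, so both d d = 0 and the naturality of d have to be
  derived in coordinates; each rests on the symmetry of second derivatives. The formulas for k_1 and
  k_2 are never transformed directly: one solution, read in two gauges, has the same K_1 and
  K_2.\<close>

lemma has_frechet_derivative:
  "f differentiable at x \<Longrightarrow> (f has_derivative frechet_derivative f (at x)) (at x)"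
  by (simp add: frechet_derivative_works)

lemma frechet_derivative_eqI:
  "(f has_derivative f') (at x) \<Longrightarrow> frechet_derivative f (at x) = f'"
  using frechet_derivative_at by metis

lemma differentiable_transform_open:
  assumes "open S" "x \<in> S" "\<And>y. y \<in> S \<Longrightarrow> f y = g y" "f differentiable at x"
  shows "g differentiable at x"
  using assms has_derivative_transform_within_open unfolding differentiable_def by blast

lemma frechet_derivative_cong_open:
  assumes "open S" "x \<in> S" "\<And>y. y \<in> S \<Longrightarrow> f y = g y"
  shows "frechet_derivative f (at x) = frechet_derivative g (at x)"
proof -
  have "(f has_derivative D) (at x) = (g has_derivative D) (at x)" for D
    using assms has_derivative_transform_within_open[of f D x UNIV S g]
      has_derivative_transform_within_open[of g D x UNIV S f] by auto
  then show ?thesis unfolding frechet_derivative_def by simp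
qed

lemma Ck_on_cong:
  assumes "open S" "\<And>x. x \<in> S \<Longrightarrow> f x = g x" "Ck_on k S f"
  shows "Ck_on k S g"
  using assms(2,3)
proof (induction k arbitrary: f g)
  case 0
  then show ?case using continuous_on_cong by force
next
  case (Suc k)
  show ?case unfolding Ck_on.simps
  proof (intro conjI ballI allI)
    fix x assume "x \<in> S"
    then show "g differentiable at x"
      using Suc.prems(2) by (intro differentiable_transform_open[OF assms(1) _ Suc.prems(1)]) auto
  next
    fix v
    have "frechet_derivative f (at x) v = frechet_derivative g (at x) v" if "x \<in> S" for x
      using frechet_derivative_cong_open[OF assms(1) that] Suc.prems(1) by metis
    then show "Ck_on k S (\<lambda>x. frechet_derivative g (at x) v)"
      using Suc.IH[of "\<lambda>x. frechet_derivative f (at x) v"] Suc.prems(2) by auto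
  qed
qed

lemma Ck_on_subset: "Ck_on k S f \<Longrightarrow> T \<subseteq> S \<Longrightarrow> Ck_on k T f"
  by (induction k arbitrary: f) (auto intro: continuous_on_subset)

lemma Ck_on_SucD: "Ck_on (Suc k) S f \<Longrightarrow> Ck_on k S f"
proof (induction k arbitrary: f)
  case 0
  then show ?case
    by (simp add: differentiable_at_imp_differentiable_on differentiable_imp_continuous_on)
qed auto

text \<open>\<open>S\<close> itself need not be open. At level 0 the filter within \<open>S\<close>
  is replaced by the filter within \<open>S \<inter> T\<close>, which has the same germs at x; the
  clauses at higher levels concern derivatives at single points or reduce to lower levels.\<close>

lemma Ck_on_local:
  assumes "\<And>x. x \<in> S \<Longrightarrow> \<exists>T. open T \<and> x \<in> T \<and> Ck_on k (S \<inter> T) f"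
  shows "Ck_on k S f"
  using assms
proof (induction k arbitrary: f)
  case 0
  show ?case unfolding Ck_on.simps continuous_on_eq_continuous_within
  proof
    fix x assume "x \<in> S"
    then obtain T where "open T" "x \<in> T" "continuous_on (S \<inter> T) f" using 0 by auto
    moreover from this have "at x within S = at x within (S \<inter> T)"
      by (intro at_within_nhd[of x T]) auto
    ultimately show "continuous (at x within S) f"
      using \<open>x \<in> S\<close> by (simp add: continuous_on_eq_continuous_within)
  qed
next
  case (Suc k)
  show ?case unfolding Ck_on.simps
  proof (intro conjI ballI allI)
    fix x assume "x \<in> S"
    then show "f differentiable at x" using Suc.prems by fastforce
  next
    fix v
    show "Ck_on k S (\<lambda>x. frechet_derivative f (at x) v)"
      by (rule Suc.IH) (use Suc.prems in fastforce)
  qed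
qed

text \<open>Lets an explicit formula \<open>D\<close> stand in for
  \<open>frechet_derivative\<close>. Openness of \<open>S\<close> matters because the two agree only
  on \<open>S\<close>, while differentiating again looks at a full neighbourhood.\<close>

lemma Ck_on_SucI:
  assumes "open S" "\<And>x. x \<in> S \<Longrightarrow> (f has_derivative D x) (at x)" "\<And>v. Ck_on k S (\<lambda>x. D x v)"
  shows "Ck_on (Suc k) S f"
  unfolding Ck_on.simps
proof (intro conjI ballI allI)
  fix x assume "x \<in> S"
  then show "f differentiable at x" using assms(2) unfolding differentiable_def by blast
next
  fix v
  show "Ck_on k S (\<lambda>x. frechet_derivative f (at x) v)"
    by (rule Ck_on_cong[OF assms(1) _ assms(3)]) (simp add: frechet_derivative_eqI[OF assms(2)])
qed

lemma Ck_on_const: "Ck_on k S (\<lambda>x. c)"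
  by (induction k arbitrary: c) auto

lemma Ck_on_add:
  assumes "open S" "Ck_on k S f" "Ck_on k S g"
  shows "Ck_on k S (\<lambda>x. f x + g x)"
  using assms(2,3)
proof (induction k arbitrary: f g)
  case 0
  then show ?case by (auto intro: continuous_on_add)
next
  case (Suc k)
  show ?case
  proof (rule Ck_on_SucI[OF assms(1)])
    fix x assume "x \<in> S"
    then show "((\<lambda>x. f x + g x) has_derivative
        (\<lambda>v. frechet_derivative f (at x) v + frechet_derivative g (at x) v)) (at x)"
      using Suc.prems by (intro has_derivative_add has_frechet_derivative) auto
  qed (use Suc in auto)
qed

lemma Ck_on_linear:
  assumes "open S" "bounded_linear T" "Ck_on k S f"
  shows "Ck_on k S (\<lambda>x. T (f x))"
  using assms(3)
proof (induction k arbitrary: f)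
  case 0
  then show ?case using assms(2) linear_continuous_on_compose by (auto intro: bounded_linear.continuous_on)
next
  case (Suc k)
  show ?case
  proof (rule Ck_on_SucI[OF assms(1)])
    fix x assume "x \<in> S"
    then show "((\<lambda>x. T (f x)) has_derivative (\<lambda>v. T (frechet_derivative f (at x) v))) (at x)"
      using Suc.prems by (intro bounded_linear.has_derivative[OF assms(2)] has_frechet_derivative) auto
  qed (use Suc in auto)
qed

lemma Ck_on_bilinear:
  assumes "open S" "bounded_bilinear T" "Ck_on k S f" "Ck_on k S g"
  shows "Ck_on k S (\<lambda>x. T (f x) (g x))"
  using assms(3,4)
proof (induction k arbitrary: f g)
  case 0
  then show ?case using assms(2) by (auto intro: bounded_bilinear.continuous_on)
next
  case (Suc k)
  let ?D = "\<lambda>x v. T (f x) (frechet_derivative g (at x) v) + T (frechet_derivative f (at x) v) (g x)"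
  have der: "((\<lambda>x. T (f x) (g x)) has_derivative ?D x) (at x)" if "x \<in> S" for x
    using Suc.prems that by (intro bounded_bilinear.FDERIV[OF assms(2)] has_frechet_derivative) auto
  have k: "Ck_on k S f" "Ck_on k S g" using Suc.prems Ck_on_SucD by blast+
  show ?case
    using Suc k by (intro Ck_on_SucI[OF assms(1) der] Ck_on_add[OF assms(1)]) auto
qed

lemma Ck_on_sum:
  assumes "open S" "\<And>i. i \<in> I \<Longrightarrow> Ck_on k S (f i)"
  shows "Ck_on k S (\<lambda>x. \<Sum>i\<in>I. f i x)"
  using assms(2)
  by (induction I rule: infinite_finite_induct) (auto intro: Ck_on_const Ck_on_add[OF assms(1)])

lemma linear_expand_Basis:
  assumes "linear F"
  shows "F v = (\<Sum>b\<in>Basis. (v \<bullet> b) *\<^sub>R F b)"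
proof -
  have "F (\<Sum>b\<in>Basis. (v \<bullet> b) *\<^sub>R b) = (\<Sum>b\<in>Basis. (v \<bullet> b) *\<^sub>R F b)"
    using assms by (simp add: linear_sum linear_scale)
  then show ?thesis by (simp add: euclidean_representation)
qed

text \<open>The chain rule differentiates \<open>g\<close> in the direction of the derivative of
  \<open>f\<close>, which moves with x, whereas \<open>Ck_on\<close> controls fixed directions only.
  Expanding the moving direction in the basis yields a sum of products, each covered by the
  induction hypothesis for a directional derivative of \<open>g\<close>.\<close>

lemma Ck_on_compose:
  fixes f :: "'a::euclidean_space \<Rightarrow> 'b::euclidean_space" and g :: "'b \<Rightarrow> 'c::real_normed_vector"
  assumes "open S" "Ck_on k S f" "Ck_on k T g" "f ` S \<subseteq> T"
  shows "Ck_on k S (\<lambda>x. g (f x))"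
  using assms(2,3)
proof (induction k arbitrary: g)
  case 0
  then show ?case using assms(4) continuous_on_compose2 by auto
next
  case (Suc k)
  have k: "Ck_on k S f" using Suc.prems Ck_on_SucD by blast
  let ?D = "\<lambda>x v. frechet_derivative g (at (f x)) (frechet_derivative f (at x) v)"
  have der: "((\<lambda>x. g (f x)) has_derivative ?D x) (at x)" if "x \<in> S" for x
    using Suc.prems that assms(4)
    by (intro has_derivative_compose[where g=g and f=f and s=UNIV] has_frechet_derivative) auto
  have D: "(\<Sum>b\<in>Basis. (frechet_derivative f (at x) v \<bullet> b) *\<^sub>R frechet_derivative g (at (f x)) b) = ?D x v"
    if "x \<in> S" for x v
  proof -
    have "g differentiable at (f x)" using Suc.prems(2) assms(4) that by auto
    then show ?thesis using linear_expand_Basis[OF linear_frechet_derivative] by metis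
  qed
  show ?case
  proof (rule Ck_on_SucI[OF assms(1) der])
    fix v
    have "Ck_on k S (\<lambda>x. \<Sum>b\<in>Basis. (frechet_derivative f (at x) v \<bullet> b) *\<^sub>R frechet_derivative g (at (f x)) b)"
    proof (intro Ck_on_sum[OF assms(1)] Ck_on_bilinear[OF assms(1) bounded_bilinear_scaleR])
      fix b :: 'b
      show "Ck_on k S (\<lambda>x. frechet_derivative f (at x) v \<bullet> b)"
        using Suc.prems by (intro Ck_on_linear[OF assms(1) bounded_linear_inner_left]) auto
      show "Ck_on k S (\<lambda>x. frechet_derivative g (at (f x)) b)"
        using Suc.IH[OF k, of "\<lambda>y. frechet_derivative g (at y) b"] Suc.prems(2) by simp
    qed
    then show "Ck_on k S (\<lambda>x. ?D x v)"
      by (rule Ck_on_cong[OF assms(1), rotated]) (rule D)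
  qed
qed

lemma Ck_on_inverse:
  fixes f :: "'a::euclidean_space \<Rightarrow> 'b::real_normed_field"
  assumes "open S" "Ck_on k S f" "\<And>x. x \<in> S \<Longrightarrow> f x \<noteq> 0"
  shows "Ck_on k S (\<lambda>x. inverse (f x))"
  using assms(2)
proof (induction k)
  case 0
  then show ?case using assms(3) by (auto intro: continuous_on_inverse)
next
  case (Suc k)
  \<comment> \<open>The derivative is arranged as nested products so that the bilinear rule applies;
    the factors \<open>inverse (f x)\<close> are covered by the induction hypothesis itself.\<close>
  let ?D = "\<lambda>x v. (- 1) * (inverse (f x) * (frechet_derivative f (at x) v * inverse (f x)))"
  have der: "((\<lambda>x. inverse (f x)) has_derivative ?D x) (at x)" if "x \<in> S" for x
    using Suc.prems that assms(3)[OF that]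
    by (auto intro!: derivative_eq_intros has_frechet_derivative simp: mult.assoc)
  have k: "Ck_on k S f" using Suc.prems Ck_on_SucD by blast
  show ?case
    using k Suc by (intro Ck_on_SucI[OF assms(1) der] Ck_on_const
        Ck_on_bilinear[OF assms(1) bounded_bilinear_mult]) auto
qed

lemma has_derivative_ln_abs:
  fixes f :: "'a::real_normed_vector \<Rightarrow> real"
  assumes "(f has_derivative f') (at x)" "f x \<noteq> 0"
  shows "((\<lambda>x. ln \<bar>f x\<bar>) has_derivative (\<lambda>v. inverse (f x) * f' v)) (at x)"
proof -
  have "((\<lambda>t. ln \<bar>t\<bar>) has_real_derivative inverse y) (at y)" if "y \<noteq> 0" for y :: real
  proof (cases "y > 0")
    case True
    have "(ln has_real_derivative inverse y) (at y)" using True by (auto intro!: derivative_eq_intros simp: field_simps)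
    then show ?thesis using True
      by (rule_tac has_field_derivative_transform_within_open[where S="{0<..}"]) auto
  next
    case False
    then have "((\<lambda>t. ln (- t)) has_real_derivative inverse y) (at y)" using that
      by (auto intro!: derivative_eq_intros simp: field_simps)
    then show ?thesis using that False
      by (rule_tac has_field_derivative_transform_within_open[where S="{..<0}"]) auto
  qed
  from has_derivative_compose[OF assms(1) this[OF assms(2), unfolded has_field_derivative_def]]
  show ?thesis by simp
qed

lemma Ck_on_ln_abs:
  fixes f :: "'a::euclidean_space \<Rightarrow> real"
  assumes "open S" "Ck_on k S f" "\<And>x. x \<in> S \<Longrightarrow> f x \<noteq> 0"
  shows "Ck_on k S (\<lambda>x. ln \<bar>f x\<bar>)"
proof (cases k)
  case 0
  then show ?thesis using assms by (auto intro!: continuous_intros)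
next
  case (Suc j)
  let ?D = "\<lambda>x v. inverse (f x) * frechet_derivative f (at x) v"
  have der: "((\<lambda>x. ln \<bar>f x\<bar>) has_derivative ?D x) (at x)" if "x \<in> S" for x
    using Suc assms that by (intro has_derivative_ln_abs has_frechet_derivative) auto
  have k: "Ck_on j S f" using assms Suc Ck_on_SucD by blast
  show ?thesis
    using k assms Suc unfolding Suc by (intro Ck_on_SucI[OF assms(1) der]
        Ck_on_bilinear[OF assms(1) bounded_bilinear_mult] Ck_on_inverse) auto
qed

section \<open>Closure properties of smooth functions on open sets\<close>

named_theorems smooth_intros

lemma smooth_on_cong: "open S \<Longrightarrow> (\<And>x. x \<in> S \<Longrightarrow> f x = g x) \<Longrightarrow> smooth_on S f \<Longrightarrow> smooth_on S g"
  unfolding smooth_on_def using Ck_on_cong by blast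

lemma smooth_on_subset: "smooth_on S f \<Longrightarrow> T \<subseteq> S \<Longrightarrow> smooth_on T f"
  unfolding smooth_on_def using Ck_on_subset by blast

lemma smooth_on_localI:
  assumes "\<And>x. x \<in> S \<Longrightarrow> \<exists>T. open T \<and> x \<in> T \<and> smooth_on T f"
  shows "smooth_on S f"
  unfolding smooth_on_def
proof (intro allI Ck_on_local)
  fix k x assume "x \<in> S"
  then obtain T where "open T" "x \<in> T" "smooth_on T f" using assms by blast
  then show "\<exists>T. open T \<and> x \<in> T \<and> Ck_on k (S \<inter> T) f"
    unfolding smooth_on_def using Ck_on_subset[OF _ Int_lower2] by blast
qed

lemma smooth_on_const [smooth_intros]: "smooth_on S (\<lambda>x. c)"
  unfolding smooth_on_def by (simp add: Ck_on_const)

lemma smooth_on_add [smooth_intros]: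
  "open S \<Longrightarrow> smooth_on S f \<Longrightarrow> smooth_on S g \<Longrightarrow> smooth_on S (\<lambda>x. f x + g x)"
  unfolding smooth_on_def by (simp add: Ck_on_add)

lemma smooth_on_linear:
  "open S \<Longrightarrow> bounded_linear T \<Longrightarrow> smooth_on S f \<Longrightarrow> smooth_on S (\<lambda>x. T (f x))"
  unfolding smooth_on_def by (simp add: Ck_on_linear)

lemmas smooth_on_cnj [smooth_intros] = smooth_on_linear[OF _ bounded_linear_cnj]
  and smooth_on_Re [smooth_intros] = smooth_on_linear[OF _ bounded_linear_Re]
  and smooth_on_of_real [smooth_intros] = smooth_on_linear[OF _ bounded_linear_of_real]
  and smooth_on_minus [smooth_intros] = smooth_on_linear[OF _ bounded_linear_minus[OF bounded_linear_ident]]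
  and smooth_on_fst [smooth_intros] = smooth_on_linear[OF _ bounded_linear_fst]
  and smooth_on_snd [smooth_intros] = smooth_on_linear[OF _ bounded_linear_snd]

lemma smooth_on_diff [smooth_intros]:
  "open S \<Longrightarrow> smooth_on S f \<Longrightarrow> smooth_on S g \<Longrightarrow> smooth_on S (\<lambda>x. f x - g x)"
  using smooth_on_add[of S f "\<lambda>x. - g x"] smooth_on_minus[of S g] by simp

lemma smooth_on_mult [smooth_intros]:
  fixes f g :: "'a::euclidean_space \<Rightarrow> 'b::real_normed_algebra"
  shows "open S \<Longrightarrow> smooth_on S f \<Longrightarrow> smooth_on S g \<Longrightarrow> smooth_on S (\<lambda>x. f x * g x)"
  unfolding smooth_on_def by (simp add: Ck_on_bilinear[OF _ bounded_bilinear_mult])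

lemma smooth_on_scaleR [smooth_intros]:
  "open S \<Longrightarrow> smooth_on S f \<Longrightarrow> smooth_on S g \<Longrightarrow> smooth_on S (\<lambda>x. f x *\<^sub>R g x)"
  unfolding smooth_on_def by (simp add: Ck_on_bilinear[OF _ bounded_bilinear_scaleR])

lemma smooth_on_sum [smooth_intros]:
  "open S \<Longrightarrow> (\<And>i. i \<in> I \<Longrightarrow> smooth_on S (f i)) \<Longrightarrow> smooth_on S (\<lambda>x. \<Sum>i\<in>I. f i x)"
  unfolding smooth_on_def by (simp add: Ck_on_sum)

lemma smooth_on_inverse [smooth_intros]:
  fixes f :: "'a::euclidean_space \<Rightarrow> 'b::real_normed_field"
  shows "open S \<Longrightarrow> smooth_on S f \<Longrightarrow> (\<And>x. x \<in> S \<Longrightarrow> f x \<noteq> 0) \<Longrightarrow> smooth_on S (\<lambda>x. inverse (f x))"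
  unfolding smooth_on_def by (simp add: Ck_on_inverse)

lemma smooth_on_divide [smooth_intros]:
  fixes f :: "'a::euclidean_space \<Rightarrow> 'b::real_normed_field"
  shows "open S \<Longrightarrow> smooth_on S f \<Longrightarrow> smooth_on S g \<Longrightarrow> (\<And>x. x \<in> S \<Longrightarrow> g x \<noteq> 0) \<Longrightarrow>
    smooth_on S (\<lambda>x. f x / g x)"
  using smooth_on_mult[of S f "\<lambda>x. inverse (g x)"] smooth_on_inverse[of S g] by (simp add: divide_inverse)

lemma smooth_on_ln_abs [smooth_intros]:
  fixes f :: "'a::euclidean_space \<Rightarrow> real"
  shows "open S \<Longrightarrow> smooth_on S f \<Longrightarrow> (\<And>x. x \<in> S \<Longrightarrow> f x \<noteq> 0) \<Longrightarrow> smooth_on S (\<lambda>x. ln \<bar>f x\<bar>)"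
  unfolding smooth_on_def by (simp add: Ck_on_ln_abs)

lemma smooth_on_compose:
  fixes f :: "'a::euclidean_space \<Rightarrow> 'b::euclidean_space"
  shows "open S \<Longrightarrow> smooth_on S f \<Longrightarrow> smooth_on T g \<Longrightarrow> f ` S \<subseteq> T \<Longrightarrow> smooth_on S (\<lambda>x. g (f x))"
  unfolding smooth_on_def using Ck_on_compose by blast

lemma smooth_on_ident [smooth_intros]: "smooth_on S (\<lambda>x. x)"
  unfolding smooth_on_def
proof
  fix k show "Ck_on k S (\<lambda>x. x)" by (cases k) (auto simp: Ck_on_const)
qed

lemma smooth_on_differentiable: "smooth_on S f \<Longrightarrow> x \<in> S \<Longrightarrow> f differentiable at x"
  unfolding smooth_on_def using Ck_on.simps(2) by blast

lemma smooth_on_has_derivative: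
  "smooth_on S f \<Longrightarrow> x \<in> S \<Longrightarrow> (f has_derivative frechet_derivative f (at x)) (at x)"
  by (simp add: smooth_on_differentiable has_frechet_derivative)

lemma smooth_on_frechet_derivative:
  "smooth_on S f \<Longrightarrow> smooth_on S (\<lambda>x. frechet_derivative f (at x) v)"
  unfolding smooth_on_def using Ck_on.simps(2) by blast

lemma smooth_on_imp_continuous_on: "smooth_on S f \<Longrightarrow> continuous_on S f"
  unfolding smooth_on_def using Ck_on.simps(1) by blast

lemma smooth_on_Pair [smooth_intros]:
  fixes f :: "'a::euclidean_space \<Rightarrow> 'b::euclidean_space" and g :: "'a \<Rightarrow> 'c::euclidean_space"
  assumes "open S" "smooth_on S f" "smooth_on S g"
  shows "smooth_on S (\<lambda>x. (f x, g x))"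
proof -
  have "smooth_on S (\<lambda>x. (f x, 0) + (0, g x))"
    using assms by (intro smooth_on_add smooth_on_linear[of S "\<lambda>x. (x, 0)"] smooth_on_linear[of S "\<lambda>x. (0, x)"])
      (auto intro!: bounded_linear_Pair bounded_linear_ident bounded_linear_zero)
  then show ?thesis by simp
qed

text \<open>\<open>smooth_form\<close> demands smoothness only on constant vectors. Expanding in the
  basis extends this to a vector that varies with the point, as it does in a pullback.\<close>

lemma smooth_on_apply:
  fixes F :: "'a::euclidean_space \<Rightarrow> 'b::euclidean_space \<Rightarrow> 'c::real_normed_vector"
  assumes "open S" "\<And>v. smooth_on S (\<lambda>x. F x v)" "\<And>x. x \<in> S \<Longrightarrow> linear (F x)" "smooth_on S w"
  shows "smooth_on S (\<lambda>x. F x (w x))"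
proof -
  have "smooth_on S (\<lambda>x. \<Sum>b\<in>Basis. (w x \<bullet> b) *\<^sub>R F x b)"
    using assms by (intro smooth_intros smooth_on_linear[OF _ bounded_linear_inner_left]) auto
  then show ?thesis
    using assms linear_expand_Basis[OF assms(3)] by (elim smooth_on_cong[rotated 2]) auto
qed

section \<open>Symmetry of second derivatives\<close>

lemma mixed_difference_real:
  fixes f :: "'a::euclidean_space \<Rightarrow> real"
  assumes "smooth_on (ball x r) f" "h > 0" "h * (norm u + norm v) < r"
  shows "\<exists>y. norm (y - x) \<le> h * (norm u + norm v) \<and>
    f (x + h *\<^sub>R u + h *\<^sub>R v) - f (x + h *\<^sub>R u) - f (x + h *\<^sub>R v) + f x =
      h * h * frechet_derivative (\<lambda>z. frechet_derivative f (at z) u) (at y) v"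
proof -
  let ?Du = "\<lambda>z. frechet_derivative f (at z) u"
  have near: "norm (s *\<^sub>R u + t *\<^sub>R v) \<le> h * (norm u + norm v)" if "0 \<le> s" "s \<le> h" "0 \<le> t" "t \<le> h" for s t
  proof -
    have "norm (s *\<^sub>R u + t *\<^sub>R v) \<le> s * norm u + t * norm v"
      using that norm_triangle_ineq[of "s *\<^sub>R u" "t *\<^sub>R v"] by simp
    also have "\<dots> \<le> h * norm u + h * norm v"
      using that by (intro add_mono mult_right_mono) auto
    finally show ?thesis by (simp add: algebra_simps)
  qed
  have inb: "x + s *\<^sub>R u + t *\<^sub>R v \<in> ball x r" if "0 \<le> s" "s \<le> h" "0 \<le> t" "t \<le> h" for s t
  proof -
    have "dist x (x + s *\<^sub>R u + t *\<^sub>R v) = norm (s *\<^sub>R u + t *\<^sub>R v)"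
      by (metis add.assoc dist_norm dist_commute add_diff_cancel_left')
    then show ?thesis using near[OF that] assms(3) by simp
  qed
  have der: "(g has_derivative frechet_derivative g (at z)) (at z)" if "smooth_on (ball x r) g" "z \<in> ball x r"
    for g :: "'a \<Rightarrow> real" and z using smooth_on_has_derivative[OF that] .
  have lin: "frechet_derivative g (at z) (c *\<^sub>R w) = c * frechet_derivative g (at z) w"
    if "smooth_on (ball x r) g" "z \<in> ball x r" for g :: "'a \<Rightarrow> real" and z c w
    using linear_frechet_derivative[OF smooth_on_differentiable[OF that]] linear_scale by fastforce
  have along: "((\<lambda>s. g (z + s *\<^sub>R w)) has_real_derivative frechet_derivative g (at (z + s *\<^sub>R w)) w) (at s)"
    if "smooth_on (ball x r) g" "z + s *\<^sub>R w \<in> ball x r" for g :: "'a \<Rightarrow> real" and z s w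
  proof -
    have "((\<lambda>s. z + s *\<^sub>R w) has_derivative (\<lambda>t. t *\<^sub>R w)) (at s)" by (auto intro!: derivative_eq_intros)
    from has_derivative_compose[OF this der[OF that]]
    show ?thesis using lin[OF that] by (simp add: has_field_derivative_def mult.commute[of _ "_ w"])
  qed
  \<comment> \<open>Mean value theorem along \<open>u\<close>, applied to the increment of
    \<open>f\<close> in the direction \<open>h *\<^sub>R v\<close>; this turns the second difference
    into a difference of first derivatives.\<close>
  have "\<exists>z>0. z < h \<and> (\<lambda>s. f (x + s *\<^sub>R u + h *\<^sub>R v) - f (x + s *\<^sub>R u)) h
      - (\<lambda>s. f (x + s *\<^sub>R u + h *\<^sub>R v) - f (x + s *\<^sub>R u)) 0
    = (h - 0) * (?Du (x + z *\<^sub>R u + h *\<^sub>R v) - ?Du (x + z *\<^sub>R u))"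
  proof (rule MVT2[OF assms(2)])
    fix s assume s: "0 \<le> s" "s \<le> h"
    have "x + h *\<^sub>R v + s *\<^sub>R u \<in> ball x r" "x + s *\<^sub>R u \<in> ball x r"
      using inb[of s h] inb[of s 0] s assms(2) by (auto simp: algebra_simps)
    from along[OF assms(1) this(1)] along[OF assms(1) this(2)]
    show "((\<lambda>s. f (x + s *\<^sub>R u + h *\<^sub>R v) - f (x + s *\<^sub>R u)) has_real_derivative
      ?Du (x + s *\<^sub>R u + h *\<^sub>R v) - ?Du (x + s *\<^sub>R u)) (at s)"
      by (auto intro!: DERIV_diff simp: algebra_simps)
  qed
  then obtain s where s: "0 < s" "s < h" "f (x + h *\<^sub>R u + h *\<^sub>R v) - f (x + h *\<^sub>R u) - f (x + h *\<^sub>R v) + f x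
    = h * (?Du (x + s *\<^sub>R u + h *\<^sub>R v) - ?Du (x + s *\<^sub>R u))" by force
  have sm: "smooth_on (ball x r) ?Du" by (rule smooth_on_frechet_derivative[OF assms(1)])
  \<comment> \<open>A second mean value theorem, now along \<open>v\<close>, applied to the
    derivative in the direction \<open>u\<close>.\<close>
  have "\<exists>z>0. z < h \<and> (\<lambda>t. ?Du (x + s *\<^sub>R u + t *\<^sub>R v)) h - (\<lambda>t. ?Du (x + s *\<^sub>R u + t *\<^sub>R v)) 0
    = (h - 0) * frechet_derivative ?Du (at (x + s *\<^sub>R u + z *\<^sub>R v)) v"
    by (rule MVT2[OF assms(2)]) (use along[OF sm] inb s in auto)
  then obtain t where t: "0 < t" "t < h" "?Du (x + s *\<^sub>R u + h *\<^sub>R v) - ?Du (x + s *\<^sub>R u)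
    = h * frechet_derivative ?Du (at (x + s *\<^sub>R u + t *\<^sub>R v)) v" by force
  show ?thesis
  proof (intro exI conjI)
    show "norm (x + s *\<^sub>R u + t *\<^sub>R v - x) \<le> h * (norm u + norm v)"
      using near[of s t] s t by (simp add: algebra_simps)
    show "f (x + h *\<^sub>R u + h *\<^sub>R v) - f (x + h *\<^sub>R u) - f (x + h *\<^sub>R v) + f x =
      h * h * frechet_derivative ?Du (at (x + s *\<^sub>R u + t *\<^sub>R v)) v"
      using s(3) t(3) by simp
  qed
qed

text \<open>The second difference is symmetric in \<open>u\<close> and \<open>v\<close>, and divided
  by the squared step it equals either mixed derivative at some nearby point. As the step shrinks,
  these points tend to x, and continuity of the second derivatives identifies the two
  limits.\<close>

lemma mixed_derivatives_commute_real:
  fixes f :: "'a::euclidean_space \<Rightarrow> real"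
  assumes "open S" "x \<in> S" "smooth_on S f"
  shows "frechet_derivative (\<lambda>z. frechet_derivative f (at z) u) (at x) v =
    frechet_derivative (\<lambda>z. frechet_derivative f (at z) v) (at x) u"
proof -
  obtain r where r: "r > 0" "ball x r \<subseteq> S" using assms openE by blast
  have sm: "smooth_on (ball x r) f" using smooth_on_subset[OF assms(3) r(2)] .
  define N where "N = norm u + norm v + 1"
  have N: "N > 0" unfolding N_def by (simp add: add_nonneg_pos)
  \<comment> \<open>The \<open>+ 1\<close> in \<open>N\<close> avoids a division by zero when both
    vectors vanish; the offset 2 makes \<open>r / real (n + 2)\<close> strictly smaller than
    \<open>r\<close> already for n = 0.\<close>
  define h where "h n = r / N / real (n + 2)" for n
  have h: "h n > 0" "h n * (norm u + norm v) < r" for n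
  proof -
    show "h n > 0" unfolding h_def using r N by simp
    have "h n * (norm u + norm v) \<le> h n * N" using \<open>h n > 0\<close> unfolding N_def by simp
    also have "\<dots> = r / real (n + 2)" unfolding h_def using N by simp
    also have "\<dots> < r / 1" using r(1) by (intro divide_strict_left_mono) auto
    finally show "h n * (norm u + norm v) < r" by simp
  qed
  have h0: "(\<lambda>n. h n * (norm u + norm v)) \<longlonglongrightarrow> 0"
  proof -
    have "(\<lambda>n. 1 / real (n + 2)) \<longlonglongrightarrow> 0"
      using LIMSEQ_ignore_initial_segment[OF lim_1_over_n, of 2] by simp
    from tendsto_mult_right_zero[OF this, of "r / N * (norm u + norm v)"]
    show ?thesis unfolding h_def by (simp add: field_simps)
  qed
  let ?F = "\<lambda>u v y. frechet_derivative (\<lambda>z. frechet_derivative f (at z) u) (at y) v"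
  have lim: "(\<lambda>n. ?F u' v' (y n)) \<longlonglongrightarrow> ?F u' v' x"
    if "\<And>n. norm (y n - x) \<le> h n * (norm u + norm v)" for u' v' y
  proof -
    have "continuous_on (ball x r) (?F u' v')"
      by (intro smooth_on_imp_continuous_on smooth_on_frechet_derivative sm)
    then have "isCont (?F u' v') x" using r(1) by (simp add: continuous_on_eq_continuous_at)
    moreover have "y \<longlonglongrightarrow> x"
      using Lim_null_comparison[OF _ h0, of "\<lambda>n. y n - x"] that LIM_zero_iff by auto
    ultimately show ?thesis by (rule isCont_tendsto_compose)
  qed
  have "\<forall>n. \<exists>y. norm (y - x) \<le> h n * (norm u + norm v) \<and>
    f (x + h n *\<^sub>R u + h n *\<^sub>R v) - f (x + h n *\<^sub>R u) - f (x + h n *\<^sub>R v) + f x = h n * h n * ?F u v y"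
    using mixed_difference_real[OF sm h] by blast
  then obtain y where y: "\<And>n. norm (y n - x) \<le> h n * (norm u + norm v)"
    "\<And>n. f (x + h n *\<^sub>R u + h n *\<^sub>R v) - f (x + h n *\<^sub>R u) - f (x + h n *\<^sub>R v) + f x = h n * h n * ?F u v (y n)"
    by metis
  have h': "h n * (norm v + norm u) < r" for n using h by (simp add: add.commute)
  have "\<forall>n. \<exists>y. norm (y - x) \<le> h n * (norm v + norm u) \<and>
    f (x + h n *\<^sub>R v + h n *\<^sub>R u) - f (x + h n *\<^sub>R v) - f (x + h n *\<^sub>R u) + f x = h n * h n * ?F v u y"
    using mixed_difference_real[OF sm h(1) h'] by blast
  then obtain z where z: "\<And>n. norm (z n - x) \<le> h n * (norm v + norm u)"
    "\<And>n. f (x + h n *\<^sub>R v + h n *\<^sub>R u) - f (x + h n *\<^sub>R v) - f (x + h n *\<^sub>R u) + f x = h n * h n * ?F v u (z n)"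
    by metis
  have "h n * h n * ?F u v (y n) = h n * h n * ?F v u (z n)" for n
    using y(2)[of n] z(2)[of n] by (simp add: algebra_simps)
  then have "?F u v (y n) = ?F v u (z n)" for n using h(1)[of n] by (metis less_irrefl mult_eq_0_iff mult_left_cancel)
  then have "(\<lambda>n. ?F u v (y n)) = (\<lambda>n. ?F v u (z n))" by simp
  moreover have "(\<lambda>n. ?F u v (y n)) \<longlonglongrightarrow> ?F u v x" using lim y(1) by blast
  moreover have "(\<lambda>n. ?F v u (z n)) \<longlonglongrightarrow> ?F v u x" using lim z(1) by (metis add.commute)
  ultimately show ?thesis using LIMSEQ_unique by metis
qed

lemma mixed_derivatives_commute:
  fixes f :: "'a::euclidean_space \<Rightarrow> 'b::euclidean_space"
  assumes "open S" "x \<in> S" "smooth_on S f"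
  shows "frechet_derivative (\<lambda>z. frechet_derivative f (at z) u) (at x) v =
    frechet_derivative (\<lambda>z. frechet_derivative f (at z) v) (at x) u"
proof (rule euclidean_eqI)
  fix b :: 'b assume "b \<in> Basis"
  have 1: "frechet_derivative (\<lambda>z. g z \<bullet> b) (at z) w = frechet_derivative g (at z) w \<bullet> b"
    if "smooth_on S g" "z \<in> S" for g :: "'a \<Rightarrow> 'b" and z w
    using frechet_derivative_eqI[OF bounded_linear.has_derivative[OF bounded_linear_inner_left
          smooth_on_has_derivative[OF that]]] by metis
  have 2: "frechet_derivative (\<lambda>z. frechet_derivative (\<lambda>z. f z \<bullet> b) (at z) u) (at x) v =
    frechet_derivative (\<lambda>z. frechet_derivative f (at z) u) (at x) v \<bullet> b" for u v
  proof -
    have "frechet_derivative (\<lambda>z. frechet_derivative (\<lambda>z. f z \<bullet> b) (at z) u) (at x) =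
      frechet_derivative (\<lambda>z. frechet_derivative f (at z) u \<bullet> b) (at x)"
      by (rule frechet_derivative_cong_open[OF assms(1,2)]) (use 1 assms in auto)
    then show ?thesis using 1[OF smooth_on_frechet_derivative[OF assms(3)] assms(2)] by simp
  qed
  have "smooth_on S (\<lambda>z. f z \<bullet> b)"
    using smooth_on_linear[OF assms(1) bounded_linear_inner_left assms(3)] .
  from mixed_derivatives_commute_real[OF assms(1,2) this] 2
  show "frechet_derivative (\<lambda>z. frechet_derivative f (at z) u) (at x) v \<bullet> b =
    frechet_derivative (\<lambda>z. frechet_derivative f (at z) v) (at x) u \<bullet> b" by metis
qed

section \<open>Manifolds and smooth maps\<close>

context
  fixes A :: "('m::{t2_space, second_countable_topology}, 'e::euclidean_space) atlas"
  assumes A: "smooth_manifold A"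
begin

lemma open_cdom: "c \<in> A \<Longrightarrow> open (cdom c)"
  and open_cimage: "c \<in> A \<Longrightarrow> open (cmap c ` cdom c)"
  and continuous_on_cmap: "c \<in> A \<Longrightarrow> continuous_on (cdom c) (cmap c)"
  and continuous_on_cinv: "c \<in> A \<Longrightarrow> continuous_on (cmap c ` cdom c) (cinv c)"
  and cinv_cmap: "c \<in> A \<Longrightarrow> p \<in> cdom c \<Longrightarrow> cinv c (cmap c p) = p"
  and smooth_transition: "c \<in> A \<Longrightarrow> d \<in> A \<Longrightarrow>
    smooth_on (cmap c ` (cdom c \<inter> cdom d)) (cmap d \<circ> cinv c)"
  using A unfolding smooth_manifold_def homeomorphism_def by auto

lemma inj_on_cmap: "c \<in> A \<Longrightarrow> inj_on (cmap c) (cdom c)"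
  using cinv_cmap by (rule inj_on_inverseI)

lemma open_points: "open (points A)"
  unfolding points_def using open_cdom by auto

lemma open_cmap_image:
  assumes "c \<in> A" "open U"
  shows "open (cmap c ` (cdom c \<inter> U))"
proof -
  have "cmap c ` (cdom c \<inter> U) = cmap c ` cdom c \<inter> cinv c -` U"
    using cinv_cmap[OF assms(1)] by force
  then show ?thesis
    using continuous_on_open_vimage[OF open_cimage[OF assms(1)], of "cinv c"] continuous_on_cinv assms
    by (metis inf_commute)
qed

lemma open_vimage_points:
  fixes \<phi> :: "'m \<Rightarrow> 'n::topological_space"
  assumes "continuous_on (points A) \<phi>" "open V"
  shows "open (points A \<inter> \<phi> -` V)"
  using continuous_on_open_vimage[OF open_points, of \<phi>] assms by (metis inf_commute)

lemma open_cmap_image_vimage: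
  fixes \<phi> :: "'m \<Rightarrow> 'n::topological_space"
  assumes "c \<in> A" "continuous_on (points A) \<phi>" "open V"
  shows "open (cmap c ` (cdom c \<inter> \<phi> -` V))"
proof -
  have "cdom c \<inter> \<phi> -` V = cdom c \<inter> (points A \<inter> \<phi> -` V)"
    using assms(1) unfolding points_def by auto
  then show ?thesis using open_cmap_image[OF assms(1) open_vimage_points[OF assms(2,3)]] by simp
qed

end

lemma cmap_cinv: "y \<in> cmap c ` cdom c \<Longrightarrow> cmap c (cinv c y) = y"
  and cinv_in_cdom: "y \<in> cmap c ` cdom c \<Longrightarrow> cinv c y \<in> cdom c"
  unfolding cinv_def by (auto simp: f_inv_into_f inv_into_into)

lemma in_pointsI: "p \<in> cdom c \<Longrightarrow> c \<in> A \<Longrightarrow> p \<in> points A"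
  unfolding points_def by auto

lemma in_pointsE:
  assumes "p \<in> points A" obtains c where "c \<in> A" "p \<in> cdom c"
  using assms unfolding points_def by auto

lemma cdom_subset_points: "c \<in> A \<Longrightarrow> cdom c \<subseteq> points A"
  unfolding points_def by auto

lemma smooth_mapD:
  assumes "smooth_map A B \<phi>"
  shows smooth_map_in_points: "p \<in> points A \<Longrightarrow> \<phi> p \<in> points B"
    and smooth_map_continuous_on: "continuous_on (points A) \<phi>"
    and smooth_map_smooth_on: "c \<in> A \<Longrightarrow> d \<in> B \<Longrightarrow>
      smooth_on (cmap c ` (cdom c \<inter> \<phi> -` cdom d)) (cmap d \<circ> \<phi> \<circ> cinv c)"
  using assms unfolding smooth_map_def by auto

text \<open>One pair of charts at each point suffices: any other pair differs by transition maps on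
  both sides. Continuity is obtained as well, since locally \<phi> is \<open>cinv d\<close> after
  the smooth coordinate expression after \<open>cmap c\<close>.\<close>

lemma smooth_mapI:
  assumes A: "smooth_manifold A" and B: "smooth_manifold B"
    and loc: "\<And>p. p \<in> points A \<Longrightarrow> \<exists>c d U. c \<in> A \<and> d \<in> B \<and> open U \<and> p \<in> U \<and> U \<subseteq> cdom c \<and> \<phi> ` U \<subseteq> cdom d \<and>
      smooth_on (cmap c ` U) (cmap d \<circ> \<phi> \<circ> cinv c)"
  shows "smooth_map A B \<phi>"
  unfolding smooth_map_def
proof (intro conjI ballI)
  show "\<phi> ` points A \<subseteq> points B" using loc cdom_subset_points by blast
  show cont: "continuous_on (points A) \<phi>"
    unfolding continuous_on_eq_continuous_at[OF open_points[OF A]]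
  proof
    fix p assume "p \<in> points A"
    from loc[OF this] obtain c d U where U: "c \<in> A" "d \<in> B" "open U" "p \<in> U" "U \<subseteq> cdom c" "\<phi> ` U \<subseteq> cdom d"
      "smooth_on (cmap c ` U) (cmap d \<circ> \<phi> \<circ> cinv c)" by blast
    have U': "q \<in> cdom c" "\<phi> q \<in> cdom d" if "q \<in> U" for q using U that by auto
    have "continuous_on U (\<lambda>q. cinv d ((cmap d \<circ> \<phi> \<circ> cinv c) (cmap c q)))"
    proof (rule continuous_on_compose2[OF continuous_on_cinv[OF B U(2)]])
      show "continuous_on U (\<lambda>q. (cmap d \<circ> \<phi> \<circ> cinv c) (cmap c q))"
        by (rule continuous_on_compose2[OF smooth_on_imp_continuous_on[OF U(7)]])
          (use U continuous_on_cmap[OF A U(1)] continuous_on_subset in auto)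
      show "(\<lambda>q. (cmap d \<circ> \<phi> \<circ> cinv c) (cmap c q)) ` U \<subseteq> cmap d ` cdom d"
        using U' cinv_cmap[OF A U(1)] by auto
    qed
    moreover have "cinv d ((cmap d \<circ> \<phi> \<circ> cinv c) (cmap c q)) = \<phi> q" if "q \<in> U" for q
      using U' that cinv_cmap[OF A U(1)] cinv_cmap[OF B U(2)] by simp
    ultimately have "continuous_on U \<phi>" by (simp cong: continuous_on_cong)
    then show "isCont \<phi> p" using U by (simp add: continuous_on_eq_continuous_at)
  qed
  fix c' d' assume c'd': "c' \<in> A" "d' \<in> B"
  let ?S = "cmap c' ` (cdom c' \<inter> \<phi> -` cdom d')"
  have S: "open ?S" by (rule open_cmap_image_vimage[OF A c'd'(1) cont open_cdom[OF B c'd'(2)]])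
  show "smooth_on ?S (cmap d' \<circ> \<phi> \<circ> cinv c')"
  proof (rule smooth_on_localI)
    fix y assume "y \<in> ?S"
    then obtain p where p: "p \<in> cdom c'" "\<phi> p \<in> cdom d'" "y = cmap c' p" by auto
    then have "p \<in> points A" using in_pointsI c'd'(1) by metis
    from loc[OF this] obtain c d U where U: "c \<in> A" "d \<in> B" "open U" "p \<in> U" "U \<subseteq> cdom c" "\<phi> ` U \<subseteq> cdom d"
      "smooth_on (cmap c ` U) (cmap d \<circ> \<phi> \<circ> cinv c)" by blast
    \<comment> \<open>On \<open>V\<close> all four charts apply, so the coordinate expression for
      \<open>c'\<close>, \<open>d'\<close> is the given one composed with transition maps on both
      sides.\<close>
    define V where "V = U \<inter> (cdom c' \<inter> (points A \<inter> \<phi> -` cdom d'))"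
    let ?T = "cmap c' ` (cdom c' \<inter> V)"
    have V: "open V" unfolding V_def
      by (intro open_Int U(3) open_cdom[OF A c'd'(1)] open_vimage_points[OF A cont] open_cdom[OF B c'd'(2)])
    then have T: "open ?T" by (rule open_cmap_image[OF A c'd'(1)])
    have Vin: "q \<in> V \<Longrightarrow> q \<in> cdom c \<and> q \<in> cdom c' \<and> q \<in> U \<and> \<phi> q \<in> cdom d \<and> \<phi> q \<in> cdom d'" for q
      unfolding V_def using U by auto
    have 1: "smooth_on ?T (\<lambda>y. (cmap c \<circ> cinv c') y)"
      using smooth_transition[OF A c'd'(1) U(1)] Vin by (elim smooth_on_subset) auto
    have 2: "smooth_on ?T (\<lambda>y. (cmap d \<circ> \<phi> \<circ> cinv c) ((cmap c \<circ> cinv c') y))"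
      by (rule smooth_on_compose[OF T 1 U(7)]) (use Vin cinv_cmap[OF A c'd'(1)] in auto)
    have 3: "smooth_on ?T (\<lambda>y. (cmap d' \<circ> cinv d) ((cmap d \<circ> \<phi> \<circ> cinv c) ((cmap c \<circ> cinv c') y)))"
      by (rule smooth_on_compose[OF T 2 smooth_transition[OF B U(2) c'd'(2)]])
        (use Vin cinv_cmap[OF A c'd'(1)] cinv_cmap[OF A U(1)] in auto)
    have "smooth_on ?T (cmap d' \<circ> \<phi> \<circ> cinv c')"
      by (rule smooth_on_cong[OF T _ 3])
        (use Vin cinv_cmap[OF A c'd'(1)] cinv_cmap[OF A U(1)] cinv_cmap[OF B U(2)] in auto)
    moreover have "y \<in> ?T"
      unfolding p(3) V_def using p(1,2) U(4) \<open>p \<in> points A\<close> by (intro imageI) simp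
    ultimately show "\<exists>T. open T \<and> y \<in> T \<and> smooth_on T (cmap d' \<circ> \<phi> \<circ> cinv c')"
      using T by (intro exI[of _ ?T]) simp
  qed
qed

lemma smooth_map_at:
  assumes A: "smooth_manifold A" and B: "smooth_manifold B" and \<phi>: "smooth_map A B \<phi>"
    and cd: "c \<in> A" "d \<in> B" "p \<in> cdom c" "\<phi> p \<in> cdom d"
  obtains U where "open U" "p \<in> U" "U \<subseteq> cdom c" "\<phi> ` U \<subseteq> cdom d" "open (cmap c ` U)"
    "smooth_on (cmap c ` U) (cmap d \<circ> \<phi> \<circ> cinv c)"
proof
  \<comment> \<open>Nothing is known about \<phi> outside \<open>points A\<close>, so its preimages
    are open only after intersecting with that set; inside \<open>cdom c\<close> the intersection
    removes no point.\<close>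
  let ?U = "cdom c \<inter> (points A \<inter> \<phi> -` cdom d)"
  show "open ?U"
    using open_cdom[OF A cd(1)] open_vimage_points[OF A smooth_map_continuous_on[OF \<phi>] open_cdom[OF B cd(2)]]
    by blast
  then show "open (cmap c ` ?U)" using open_cmap_image[OF A cd(1), of ?U] by (simp add: Int_assoc Int_absorb)
  show "p \<in> ?U" using cd in_pointsI[OF cd(3,1)] by simp
  show "smooth_on (cmap c ` ?U) (cmap d \<circ> \<phi> \<circ> cinv c)"
    using smooth_map_smooth_on[OF \<phi> cd(1,2)] by (elim smooth_on_subset) auto
qed auto

lemma smooth_map_compose:
  assumes A: "smooth_manifold A" and B: "smooth_manifold B" and C: "smooth_manifold C"
    and \<phi>: "smooth_map A B \<phi>" and \<psi>: "smooth_map B C \<psi>"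
  shows "smooth_map A C (\<lambda>p. \<psi> (\<phi> p))"
proof (rule smooth_mapI[OF A C])
  fix p assume p: "p \<in> points A"
  then obtain c where c: "c \<in> A" "p \<in> cdom c" by (rule in_pointsE)
  have \<phi>p: "\<phi> p \<in> points B" using smooth_map_in_points[OF \<phi> p] .
  then obtain d where d: "d \<in> B" "\<phi> p \<in> cdom d" by (rule in_pointsE)
  have "\<psi> (\<phi> p) \<in> points C" using smooth_map_in_points[OF \<psi> \<phi>p] .
  then obtain e where e: "e \<in> C" "\<psi> (\<phi> p) \<in> cdom e" by (rule in_pointsE)
  obtain U where U: "open U" "p \<in> U" "U \<subseteq> cdom c" "\<phi> ` U \<subseteq> cdom d" "open (cmap c ` U)"
    "smooth_on (cmap c ` U) (cmap d \<circ> \<phi> \<circ> cinv c)" by (rule smooth_map_at[OF A B \<phi> c(1) d(1) c(2) d(2)])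
  obtain V where V: "open V" "\<phi> p \<in> V" "V \<subseteq> cdom d" "\<psi> ` V \<subseteq> cdom e" "open (cmap d ` V)"
    "smooth_on (cmap d ` V) (cmap e \<circ> \<psi> \<circ> cinv d)" by (rule smooth_map_at[OF B C \<psi> d(1) e(1) d(2) e(2)])
  let ?W = "U \<inter> (points A \<inter> \<phi> -` V)"
  have W: "open ?W" using U(1) open_vimage_points[OF A smooth_map_continuous_on[OF \<phi>] V(1)] by blast
  have "cdom c \<inter> ?W = ?W" using U(3) by blast
  then have oW: "open (cmap c ` ?W)" using open_cmap_image[OF A c(1) W] by simp
  have inW: "q \<in> cdom c \<and> q \<in> U \<and> \<phi> q \<in> cdom d \<and> \<phi> q \<in> V \<and> \<psi> (\<phi> q) \<in> cdom e" if "q \<in> ?W" for q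
    using that U(3,4) V(4) by blast
  have 1: "smooth_on (cmap c ` ?W) (\<lambda>y. (cmap e \<circ> \<psi> \<circ> cinv d) ((cmap d \<circ> \<phi> \<circ> cinv c) y))"
  proof (rule smooth_on_compose[OF oW _ V(6)])
    show "smooth_on (cmap c ` ?W) (\<lambda>y. (cmap d \<circ> \<phi> \<circ> cinv c) y)"
      by (rule smooth_on_subset[OF U(6)]) blast
    show "(cmap d \<circ> \<phi> \<circ> cinv c) ` cmap c ` ?W \<subseteq> cmap d ` V"
    proof (rule image_subsetI)
      fix y assume "y \<in> cmap c ` ?W"
      then obtain q where q: "y = cmap c q" "q \<in> ?W" by blast
      then show "(cmap d \<circ> \<phi> \<circ> cinv c) y \<in> cmap d ` V"
        using inW[OF q(2)] cinv_cmap[OF A c(1)] by simp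
    qed
  qed
  have "smooth_on (cmap c ` ?W) (cmap e \<circ> (\<lambda>p. \<psi> (\<phi> p)) \<circ> cinv c)"
  proof (rule smooth_on_cong[OF oW _ 1], elim imageE)
    fix y q assume "y = cmap c q" and q: "q \<in> ?W"
    then show "(cmap e \<circ> \<psi> \<circ> cinv d) ((cmap d \<circ> \<phi> \<circ> cinv c) y) = (cmap e \<circ> (\<lambda>p. \<psi> (\<phi> p)) \<circ> cinv c) y"
      using inW[OF q] cinv_cmap[OF A c(1)] cinv_cmap[OF B d(1)] by simp
  qed
  moreover have "p \<in> ?W" using U(2) V(2) p by simp
  moreover have "?W \<subseteq> cdom c" "(\<lambda>p. \<psi> (\<phi> p)) ` ?W \<subseteq> cdom e" using inW by blast+
  ultimately show "\<exists>c d U. c \<in> A \<and> d \<in> C \<and> open U \<and> p \<in> U \<and> U \<subseteq> cdom c \<and> (\<lambda>p. \<psi> (\<phi> p)) ` U \<subseteq> cdom d \<and>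
      smooth_on (cmap c ` U) (cmap d \<circ> (\<lambda>p. \<psi> (\<phi> p)) \<circ> cinv c)"
    using c(1) e(1) W by (intro exI[of _ c] exI[of _ e] exI[of _ ?W]) simp
qed

lemma smooth_map_cong:
  assumes A: "smooth_manifold A" and B: "smooth_manifold B"
    and eq: "\<And>p. p \<in> points A \<Longrightarrow> \<phi> p = \<psi> p" and \<phi>: "smooth_map A B \<phi>"
  shows "smooth_map A B \<psi>"
  unfolding smooth_map_def
proof (intro conjI ballI)
  show "\<psi> ` points A \<subseteq> points B" using smooth_map_in_points[OF \<phi>] eq by auto
  show cont: "continuous_on (points A) \<psi>"
    using smooth_map_continuous_on[OF \<phi>] eq continuous_on_cong by force
  fix c d assume cd: "c \<in> A" "d \<in> B"
  have eq': "q \<in> cdom c \<Longrightarrow> \<phi> q = \<psi> q" for q using eq cd(1) in_pointsI by metis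
  have "open (cmap c ` (cdom c \<inter> \<psi> -` cdom d))"
    by (rule open_cmap_image_vimage[OF A cd(1) cont open_cdom[OF B cd(2)]])
  moreover have "cdom c \<inter> \<psi> -` cdom d = cdom c \<inter> \<phi> -` cdom d" using eq' by auto
  ultimately show "smooth_on (cmap c ` (cdom c \<inter> \<psi> -` cdom d)) (cmap d \<circ> \<psi> \<circ> cinv c)"
    by (simp, intro smooth_on_cong[OF _ _ smooth_map_smooth_on[OF \<phi> cd]]) (auto simp: eq' cinv_cmap[OF A cd(1)])
qed

lemma smooth_map_id:
  assumes A: "smooth_manifold A"
  shows "smooth_map A A (\<lambda>p. p)"
  unfolding smooth_map_def using smooth_transition[OF A] by (auto simp: comp_def)

section \<open>Smooth functions on a manifold\<close>

lemma smooth_fun_smooth_on: "smooth_fun A u \<Longrightarrow> c \<in> A \<Longrightarrow> smooth_on (cmap c ` cdom c) (\<lambda>y. u (cinv c y))"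
  unfolding smooth_fun_def by (auto simp: comp_def)

lemma smooth_funI: "(\<And>c. c \<in> A \<Longrightarrow> smooth_on (cmap c ` cdom c) (\<lambda>y. u (cinv c y))) \<Longrightarrow> smooth_fun A u"
  unfolding smooth_fun_def by (auto simp: comp_def)

context
  fixes A :: "('m::{t2_space, second_countable_topology}, 'e::euclidean_space) atlas"
  assumes A: "smooth_manifold A"
begin

lemma smooth_fun_cong: 
  assumes "smooth_fun A u" "\<And>p. p \<in> points A \<Longrightarrow> u p = v p" shows "smooth_fun A v"
proof (rule smooth_funI)
  fix c assume c: "c \<in> A"
  show "smooth_on (cmap c ` cdom c) (\<lambda>y. v (cinv c y))"
    by (rule smooth_on_cong[OF open_cimage[OF A c] _ smooth_fun_smooth_on[OF assms(1) c]])
      (use assms(2) in_pointsI[OF cinv_in_cdom c] in auto)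
qed

lemma smooth_fun_intros [smooth_intros]:
  shows "smooth_fun A (\<lambda>p. k)"
    and "smooth_fun A u \<Longrightarrow> smooth_fun A v \<Longrightarrow> smooth_fun A (\<lambda>p. u p + v p)"
    and "smooth_fun A u \<Longrightarrow> smooth_fun A v \<Longrightarrow> smooth_fun A (\<lambda>p. u p - v p)"
    and "smooth_fun A u \<Longrightarrow> smooth_fun A (\<lambda>p. - u p)"
  by (rule smooth_funI; intro smooth_intros open_cimage[OF A] smooth_fun_smooth_on[of A]; assumption)+

lemma smooth_fun_mult [smooth_intros]:
  fixes u v :: "'m \<Rightarrow> 'b::real_normed_algebra"
  shows "smooth_fun A u \<Longrightarrow> smooth_fun A v \<Longrightarrow> smooth_fun A (\<lambda>p. u p * v p)"
  by (rule smooth_funI; intro smooth_intros open_cimage[OF A] smooth_fun_smooth_on[of A]; assumption)+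

lemma smooth_fun_divide [smooth_intros]:
  fixes u v :: "'m \<Rightarrow> 'b::real_normed_field"
  shows "smooth_fun A u \<Longrightarrow> smooth_fun A v \<Longrightarrow> (\<And>p. p \<in> points A \<Longrightarrow> v p \<noteq> 0) \<Longrightarrow>
    smooth_fun A (\<lambda>p. u p / v p)"
  by (rule smooth_funI; intro smooth_intros open_cimage[OF A] smooth_fun_smooth_on[of A];
      assumption?; use in_pointsI[OF cinv_in_cdom] in metis)

lemma smooth_fun_ln_abs [smooth_intros]:
  fixes u :: "'m \<Rightarrow> real"
  shows "smooth_fun A u \<Longrightarrow> (\<And>p. p \<in> points A \<Longrightarrow> u p \<noteq> 0) \<Longrightarrow> smooth_fun A (\<lambda>p. ln \<bar>u p\<bar>)"
  by (rule smooth_funI; intro smooth_intros open_cimage[OF A] smooth_fun_smooth_on[of A];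
      assumption?; use in_pointsI[OF cinv_in_cdom] in metis)

lemma smooth_fun_linear [smooth_intros]:
  shows "smooth_fun A (u :: 'm \<Rightarrow> complex) \<Longrightarrow> smooth_fun A (\<lambda>p. cnj (u p))"
    and "smooth_fun A (u :: 'm \<Rightarrow> complex) \<Longrightarrow> smooth_fun A (\<lambda>p. Re (u p))"
    and "smooth_fun A (r :: 'm \<Rightarrow> real) \<Longrightarrow> smooth_fun A (\<lambda>p. complex_of_real (r p))"
  by (rule smooth_funI; intro smooth_intros open_cimage[OF A] smooth_fun_smooth_on[of A]; assumption)+

lemma smooth_fun_compose:
  fixes B :: "('n::{t2_space, second_countable_topology}, 'f::euclidean_space) atlas"
  assumes B: "smooth_manifold B" and \<phi>: "smooth_map A B \<phi>" and u: "smooth_fun B u"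
  shows "smooth_fun A (\<lambda>p. u (\<phi> p))"
proof (rule smooth_funI, rule smooth_on_localI)
  fix c y assume c: "c \<in> A" and "y \<in> cmap c ` cdom c"
  then obtain p where p: "p \<in> cdom c" "y = cmap c p" by auto
  then have "\<phi> p \<in> points B" using smooth_map_in_points[OF \<phi> in_pointsI[OF p(1) c]] by simp
  then obtain d where d: "d \<in> B" "\<phi> p \<in> cdom d" by (rule in_pointsE)
  obtain U where U: "open U" "p \<in> U" "U \<subseteq> cdom c" "\<phi> ` U \<subseteq> cdom d" "open (cmap c ` U)"
    "smooth_on (cmap c ` U) (cmap d \<circ> \<phi> \<circ> cinv c)" by (rule smooth_map_at[OF A B \<phi> c d(1) p(1) d(2)])
  have U': "q \<in> cdom c \<and> \<phi> q \<in> cdom d" if "q \<in> U" for q using U(3,4) that by blast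
  have "smooth_on (cmap c ` U) (\<lambda>y. u (cinv d ((cmap d \<circ> \<phi> \<circ> cinv c) y)))"
    by (rule smooth_on_compose[OF U(5,6) smooth_fun_smooth_on[OF u d(1)]])
      (use U' cinv_cmap[OF A c] in \<open>simp add: image_subset_iff\<close>)
  then have "smooth_on (cmap c ` U) (\<lambda>y. u (\<phi> (cinv c y)))"
  proof (rule smooth_on_cong[OF U(5), rotated], elim imageE)
    fix y q assume "y = cmap c q" and q: "q \<in> U"
    then show "u (cinv d ((cmap d \<circ> \<phi> \<circ> cinv c) y)) = u (\<phi> (cinv c y))"
      using U'[OF q] cinv_cmap[OF A c] cinv_cmap[OF B d(1)] by simp
  qed
  then show "\<exists>T. open T \<and> y \<in> T \<and> smooth_on T (\<lambda>y. u (\<phi> (cinv c y)))"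
    using U(2,5) p(2) by (intro exI[of _ "cmap c ` U"]) simp
qed

end

section \<open>The punctured plane and diffeomorphisms\<close>

lemma smooth_manifold_cstar: "smooth_manifold cstar"
proof -
  have *: "cinv (- {0::complex}, id) y = y" if "y \<noteq> 0" for y
    unfolding cinv_def using that by (metis ComplI f_inv_into_f fst_conv id_apply image_id singletonD snd_conv)
  have "homeomorphism (- {0::complex}) (- {0}) id (cinv (- {0}, id))"
    unfolding homeomorphism_def using * continuous_on_cong[OF refl, of "- {0}" "cinv (- {0}, id)" "\<lambda>y. y"]
    by (auto simp: image_iff)
  moreover have "smooth_on (- {0::complex}) (id \<circ> cinv (- {0}, id))"
    by (rule smooth_on_cong[OF _ _ smooth_on_ident]) (auto simp: *)
  ultimately show ?thesis unfolding smooth_manifold_def cstar_def by auto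
qed

lemma cinv_cstar: "y \<noteq> 0 \<Longrightarrow> cinv (- {0::complex}, id) y = y"
  using cinv_cmap[OF smooth_manifold_cstar, of "(- {0}, id)" y] by (simp add: cstar_def)

lemma points_cstar: "points cstar = - {0}"
  by (simp add: points_def cstar_def)

lemma smooth_map_cstar:
  assumes A: "smooth_manifold A"
  shows "smooth_map A cstar h \<longleftrightarrow> smooth_fun A h \<and> (\<forall>p\<in>points A. h p \<noteq> 0)"
proof
  assume h: "smooth_map A cstar h"
  have nz: "h p \<noteq> 0" if "p \<in> points A" for p
    using smooth_map_in_points[OF h that] by (simp add: points_cstar)
  moreover have "smooth_fun A h" unfolding smooth_fun_def
  proof
    fix c assume c: "c \<in> A"
    then have "cdom c \<inter> h -` (- {0}) = cdom c"
      using nz cdom_subset_points[OF c] by blast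
    then show "smooth_on (cmap c ` cdom c) (h \<circ> cinv c)"
      using smooth_map_smooth_on[OF h c, of "(- {0}, id)"] by (simp add: cstar_def)
  qed
  ultimately show "smooth_fun A h \<and> (\<forall>p\<in>points A. h p \<noteq> 0)" by blast
next
  assume h: "smooth_fun A h \<and> (\<forall>p\<in>points A. h p \<noteq> 0)"
  show "smooth_map A cstar h"
  proof (rule smooth_mapI[OF A smooth_manifold_cstar])
    fix p assume "p \<in> points A"
    then obtain c where c: "c \<in> A" "p \<in> cdom c" by (rule in_pointsE)
    have "h q \<noteq> 0" if "q \<in> cdom c" for q using h in_pointsI[OF that c(1)] by simp
    then have 1: "h ` cdom c \<subseteq> - {0}" by (metis ComplI image_subsetI singletonD)
    have 2: "smooth_on (cmap c ` cdom c) (id \<circ> h \<circ> cinv c)"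
      using smooth_fun_smooth_on[OF conjunct1[OF h] c(1)] by (simp add: comp_def)
    show "\<exists>c d U. c \<in> A \<and> d \<in> cstar \<and> open U \<and> p \<in> U \<and> U \<subseteq> cdom c \<and> h ` U \<subseteq> cdom d \<and>
      smooth_on (cmap c ` U) (cmap d \<circ> h \<circ> cinv c)"
      by (intro exI[of _ c] exI[of _ "(- {0}, id)"] exI[of _ "cdom c"] conjI c order_refl open_cdom[OF A])
        (use 1 2 in \<open>simp_all add: cstar_def\<close>)
  qed
qed

text \<open>\<open>diffeo\<close> refers to \<open>inv_into (points A) \<phi>\<close>. An explicit
  inverse agrees with it on \<open>points B\<close>, and smoothness of a map depends only on its
  values there.\<close>

lemma diffeoI:
  assumes "smooth_map A B \<phi>" "smooth_map B A \<psi>"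
    and "\<And>p. p \<in> points A \<Longrightarrow> \<psi> (\<phi> p) = p" "\<And>q. q \<in> points B \<Longrightarrow> \<phi> (\<psi> q) = q"
    and A: "smooth_manifold A" and B: "smooth_manifold B"
  shows "diffeo A B \<phi>"
proof -
  have bij: "bij_betw \<phi> (points A) (points B)"
    using assms(1-4) unfolding smooth_map_def by (intro bij_betw_byWitness[of _ \<psi>]) auto
  have "\<psi> q = inv_into (points A) \<phi> q" if "q \<in> points B" for q
    using bij_betw_inv_into_left[OF bij smooth_map_in_points[OF assms(2) that]] assms(4)[OF that] by simp
  then have "smooth_map B A (inv_into (points A) \<phi>)"
    using smooth_map_cong[OF B A _ assms(2)] by blast
  then show ?thesis unfolding diffeo_def using bij assms(1) by blast
qed

lemma diffeoE:
  assumes "diffeo A B \<phi>"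
  obtains \<psi> where "smooth_map A B \<phi>" "smooth_map B A \<psi>"
    "\<And>p. p \<in> points A \<Longrightarrow> \<psi> (\<phi> p) = p" "\<And>q. q \<in> points B \<Longrightarrow> \<phi> (\<psi> q) = q"
  using assms bij_betw_inv_into_left[of \<phi> "points A" "points B"] bij_betw_inv_into_right[of \<phi> "points A" "points B"]
  unfolding diffeo_def by blast

lemma diffeo_compose:
  assumes A: "smooth_manifold A" and B: "smooth_manifold B" and C: "smooth_manifold C"
    and \<phi>: "diffeo A B \<phi>" and \<psi>: "diffeo B C \<psi>"
  shows "diffeo A C (\<lambda>p. \<psi> (\<phi> p))"
proof -
  obtain \<phi>' where \<phi>': "smooth_map A B \<phi>" "smooth_map B A \<phi>'"
    "\<And>p. p \<in> points A \<Longrightarrow> \<phi>' (\<phi> p) = p" "\<And>q. q \<in> points B \<Longrightarrow> \<phi> (\<phi>' q) = q"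
    using diffeoE[OF \<phi>] by metis
  obtain \<psi>' where \<psi>': "smooth_map B C \<psi>" "smooth_map C B \<psi>'"
    "\<And>p. p \<in> points B \<Longrightarrow> \<psi>' (\<psi> p) = p" "\<And>q. q \<in> points C \<Longrightarrow> \<psi> (\<psi>' q) = q"
    using diffeoE[OF \<psi>] by metis
  show ?thesis
    by (rule diffeoI[OF smooth_map_compose[OF A B C \<phi>'(1) \<psi>'(1)]
          smooth_map_compose[OF C B A \<psi>'(2) \<phi>'(2)] _ _ A C])
      (simp_all add: \<phi>' \<psi>' smooth_map_in_points[OF \<phi>'(1)] smooth_map_in_points[OF \<psi>'(2)])
qed

lemma diffeo_inverse:
  assumes A: "smooth_manifold A" and B: "smooth_manifold B" and \<phi>: "diffeo A B \<phi>"
  obtains \<psi> where "diffeo B A \<psi>" "\<And>p. p \<in> points A \<Longrightarrow> \<psi> (\<phi> p) = p" "\<And>q. q \<in> points B \<Longrightarrow> \<phi> (\<psi> q) = q"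
proof -
  obtain \<phi>' where \<phi>': "smooth_map A B \<phi>" "smooth_map B A \<phi>'"
    "\<And>p. p \<in> points A \<Longrightarrow> \<phi>' (\<phi> p) = p" "\<And>q. q \<in> points B \<Longrightarrow> \<phi> (\<phi>' q) = q"
    using diffeoE[OF \<phi>] by metis
  show ?thesis using that diffeoI[OF \<phi>'(2,1,4,3) B A] \<phi>'(3,4) by blast
qed

section \<open>Product manifolds\<close>

lemma map_prod_image: "map_prod f g ` (S \<times> T) = f ` S \<times> g ` T"
  by force

lemma points_prod_manifold: "points (prod_manifold A B) = points A \<times> points B"
  unfolding points_def prod_manifold_def by force

abbreviation cprod :: "('m, 'e) chart \<Rightarrow> ('n, 'f) chart \<Rightarrow> ('m \<times> 'n, 'e \<times> 'f) chart" where
  "cprod c d \<equiv> (cdom c \<times> cdom d, map_prod (cmap c) (cmap d))"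

lemma in_prod_manifold: "c \<in> A \<Longrightarrow> d \<in> B \<Longrightarrow> cprod c d \<in> prod_manifold A B"
  unfolding prod_manifold_def by force

lemma prod_manifoldE:
  assumes "e \<in> prod_manifold A B" obtains c d where "c \<in> A" "d \<in> B" "e = cprod c d"
  using assms unfolding prod_manifold_def by force

context
  fixes A :: "('m::{t2_space, second_countable_topology}, 'e::euclidean_space) atlas"
    and B :: "('n::{t2_space, second_countable_topology}, 'f::euclidean_space) atlas"
  assumes A: "smooth_manifold A" and B: "smooth_manifold B"
begin

lemma cinv_cprod:
  assumes "c \<in> A" "d \<in> B" "y \<in> cmap c ` cdom c \<times> cmap d ` cdom d"
  shows "cinv (cprod c d) y = (cinv c (fst y), cinv d (snd y))"
proof -
  have "inj_on (map_prod (cmap c) (cmap d)) (cdom c \<times> cdom d)"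
    using inj_on_cmap[OF A assms(1)] inj_on_cmap[OF B assms(2)] by (auto simp: inj_on_def)
  then have "inv_into (cdom c \<times> cdom d) (map_prod (cmap c) (cmap d)) y = (cinv c (fst y), cinv d (snd y))"
    using assms(3) by (intro inv_into_f_eq) (auto simp: cinv_cmap[OF A assms(1)] cinv_cmap[OF B assms(2)])
  then show ?thesis by (simp add: cinv_def)
qed

lemma smooth_manifold_prod: "smooth_manifold (prod_manifold A B)"
  unfolding smooth_manifold_def
proof (intro conjI ballI)
  fix e assume "e \<in> prod_manifold A B"
  then obtain c d where cd: "c \<in> A" "d \<in> B" and e: "e = cprod c d" by (rule prod_manifoldE)
  show "open (cdom e)" unfolding e using open_cdom[OF A cd(1)] open_cdom[OF B cd(2)] by (simp add: open_Times)
  show "open (cmap e ` cdom e)"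
    unfolding e using open_cimage[OF A cd(1)] open_cimage[OF B cd(2)] by (simp add: map_prod_image open_Times)
  have 1: "continuous_on (cdom e) (cmap e)"
    unfolding e fst_conv snd_conv map_prod_def case_prod_unfold
    by (intro continuous_on_Pair continuous_on_compose2[OF continuous_on_cmap[OF A cd(1)]]
        continuous_on_compose2[OF continuous_on_cmap[OF B cd(2)]] continuous_on_fst continuous_on_snd continuous_on_id) auto
  have "continuous_on (cmap e ` cdom e) (\<lambda>y. (cinv c (fst y), cinv d (snd y)))"
    unfolding e fst_conv snd_conv map_prod_image
    by (intro continuous_on_Pair continuous_on_compose2[OF continuous_on_cinv[OF A cd(1)]]
        continuous_on_compose2[OF continuous_on_cinv[OF B cd(2)]] continuous_on_fst continuous_on_snd continuous_on_id) auto
  then have 2: "continuous_on (cmap e ` cdom e) (cinv e)"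
    by (rule continuous_on_eq) (simp add: e map_prod_image cinv_cprod[OF cd])
  have inv: "cinv e (cmap e p) = p" if "p \<in> cdom e" for p
    using that cinv_cprod[OF cd, of "cmap e p"] cinv_cmap[OF A cd(1)] cinv_cmap[OF B cd(2)]
    unfolding e by auto
  have inv': "cmap e (cinv e y) = y" if "y \<in> cmap e ` cdom e" for y using cmap_cinv[OF that] .
  show "homeomorphism (cdom e) (cmap e ` cdom e) (cmap e) (cinv e)"
    unfolding homeomorphism_def using 1 2 inv inv' by (auto simp: image_image)
next
  fix e e' assume "e \<in> prod_manifold A B" "e' \<in> prod_manifold A B"
  then obtain c d c' d' where cd: "c \<in> A" "d \<in> B" and e: "e = cprod c d"
    and cd': "c' \<in> A" "d' \<in> B" and e': "e' = cprod c' d'" by (metis prod_manifoldE)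
  let ?S = "cmap c ` (cdom c \<inter> cdom c')" and ?T = "cmap d ` (cdom d \<inter> cdom d')"
  have im: "cmap e ` (cdom e \<inter> cdom e') = ?S \<times> ?T"
    unfolding e e' by (simp add: Times_Int_Times map_prod_image)
  have op: "open (?S \<times> ?T)"
    using open_cmap_image[OF A cd(1) open_cdom[OF A cd'(1)]] open_cmap_image[OF B cd(2) open_cdom[OF B cd'(2)]]
    by (simp add: open_Times)
  have "smooth_on (?S \<times> ?T) (\<lambda>y. ((cmap c' \<circ> cinv c) (fst y), (cmap d' \<circ> cinv d) (snd y)))"
    by (intro smooth_on_Pair op smooth_on_compose[OF op _ smooth_transition[OF A cd(1) cd'(1)]]
        smooth_on_compose[OF op _ smooth_transition[OF B cd(2) cd'(2)]] smooth_intros) auto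
  then show "smooth_on (cmap e ` (cdom e \<inter> cdom e')) (cmap e' \<circ> cinv e)"
    unfolding im
  proof (rule smooth_on_cong[OF op, rotated])
    fix y assume "y \<in> ?S \<times> ?T"
    then have "y \<in> cmap c ` cdom c \<times> cmap d ` cdom d" by auto
    then show "((cmap c' \<circ> cinv c) (fst y), (cmap d' \<circ> cinv d) (snd y)) = (cmap e' \<circ> cinv e) y"
      using cinv_cprod[OF cd] by (simp add: e e')
  qed
qed

lemma smooth_map_fst: "smooth_map (prod_manifold A B) A fst"
  and smooth_map_snd: "smooth_map (prod_manifold A B) B snd"
proof -
  have "\<exists>c d. c \<in> A \<and> d \<in> B \<and> p \<in> cdom c \<times> cdom d \<and>
      open (cmap c ` cdom c \<times> cmap d ` cdom d) \<and> open (cdom c \<times> cdom d)"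
    if p: "p \<in> points (prod_manifold A B)" for p
  proof -
    have "fst p \<in> points A" "snd p \<in> points B" using p by (auto simp: points_prod_manifold)
    then obtain c d where cd: "c \<in> A" "d \<in> B" "fst p \<in> cdom c" "snd p \<in> cdom d"
      by (metis in_pointsE)
    then show ?thesis using open_cimage[OF A cd(1)] open_cimage[OF B cd(2)] open_cdom[OF A cd(1)] open_cdom[OF B cd(2)]
      by (intro exI[of _ c] exI[of _ d]) (simp add: open_Times mem_Times_iff)
  qed
  note charts = this
  show "smooth_map (prod_manifold A B) A fst"
  proof (rule smooth_mapI[OF smooth_manifold_prod A])
    fix p assume "p \<in> points (prod_manifold A B)"
    from charts[OF this] obtain c d where cd: "c \<in> A" "d \<in> B" "p \<in> cdom c \<times> cdom d"
      and op: "open (cmap c ` cdom c \<times> cmap d ` cdom d)" "open (cdom c \<times> cdom d)" by metis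
    have "smooth_on (cmap c ` cdom c \<times> cmap d ` cdom d) (cmap c \<circ> fst \<circ> cinv (cprod c d))"
      by (rule smooth_on_cong[OF op(1) _ smooth_on_fst[OF op(1) smooth_on_ident]])
        (simp add: cinv_cprod[OF cd(1,2)] mem_Times_iff cmap_cinv)
    then show "\<exists>e d U. e \<in> prod_manifold A B \<and> d \<in> A \<and> open U \<and> p \<in> U \<and> U \<subseteq> cdom e \<and> fst ` U \<subseteq> cdom d \<and>
      smooth_on (cmap e ` U) (cmap d \<circ> fst \<circ> cinv e)"
      using cd op by (intro exI[of _ "cprod c d"] exI[of _ c] exI[of _ "cdom c \<times> cdom d"])
        (simp add: map_prod_image in_prod_manifold image_subset_iff)
  qed
  show "smooth_map (prod_manifold A B) B snd"
  proof (rule smooth_mapI[OF smooth_manifold_prod B])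
    fix p assume "p \<in> points (prod_manifold A B)"
    from charts[OF this] obtain c d where cd: "c \<in> A" "d \<in> B" "p \<in> cdom c \<times> cdom d"
      and op: "open (cmap c ` cdom c \<times> cmap d ` cdom d)" "open (cdom c \<times> cdom d)" by metis
    have "smooth_on (cmap c ` cdom c \<times> cmap d ` cdom d) (cmap d \<circ> snd \<circ> cinv (cprod c d))"
      by (rule smooth_on_cong[OF op(1) _ smooth_on_snd[OF op(1) smooth_on_ident]])
        (simp add: cinv_cprod[OF cd(1,2)] mem_Times_iff cmap_cinv)
    then show "\<exists>e d U. e \<in> prod_manifold A B \<and> d \<in> B \<and> open U \<and> p \<in> U \<and> U \<subseteq> cdom e \<and> snd ` U \<subseteq> cdom d \<and>
      smooth_on (cmap e ` U) (cmap d \<circ> snd \<circ> cinv e)"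
      using cd op by (intro exI[of _ "cprod c d"] exI[of _ d] exI[of _ "cdom c \<times> cdom d"])
        (simp add: map_prod_image in_prod_manifold image_subset_iff)
  qed
qed

lemma smooth_map_Pair:
  fixes C :: "('k::{t2_space, second_countable_topology}, 'g::euclidean_space) atlas"
  assumes C: "smooth_manifold C" and \<phi>: "smooth_map C A \<phi>" and \<psi>: "smooth_map C B \<psi>"
  shows "smooth_map C (prod_manifold A B) (\<lambda>p. (\<phi> p, \<psi> p))"
proof (rule smooth_mapI[OF C smooth_manifold_prod])
  fix p assume p: "p \<in> points C"
  then obtain e where e: "e \<in> C" "p \<in> cdom e" by (rule in_pointsE)
  from smooth_map_in_points[OF \<phi> p] obtain c where c: "c \<in> A" "\<phi> p \<in> cdom c" by (rule in_pointsE)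
  from smooth_map_in_points[OF \<psi> p] obtain d where d: "d \<in> B" "\<psi> p \<in> cdom d" by (rule in_pointsE)
  obtain U where U: "open U" "p \<in> U" "U \<subseteq> cdom e" "\<phi> ` U \<subseteq> cdom c" "open (cmap e ` U)"
    "smooth_on (cmap e ` U) (cmap c \<circ> \<phi> \<circ> cinv e)" by (rule smooth_map_at[OF C A \<phi> e(1) c(1) e(2) c(2)])
  obtain V where V: "open V" "p \<in> V" "V \<subseteq> cdom e" "\<psi> ` V \<subseteq> cdom d" "open (cmap e ` V)"
    "smooth_on (cmap e ` V) (cmap d \<circ> \<psi> \<circ> cinv e)" by (rule smooth_map_at[OF C B \<psi> e(1) d(1) e(2) d(2)])
  let ?W = "U \<inter> V"
  have "cdom e \<inter> ?W = ?W" using U(3) by blast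
  then have W: "open (cmap e ` ?W)" using open_cmap_image[OF C e(1) open_Int[OF U(1) V(1)]] by simp
  have "smooth_on (cmap e ` ?W) (\<lambda>y. ((cmap c \<circ> \<phi> \<circ> cinv e) y, (cmap d \<circ> \<psi> \<circ> cinv e) y))"
    by (intro smooth_on_Pair[OF W] smooth_on_subset[OF U(6)] smooth_on_subset[OF V(6)]) auto
  then have "smooth_on (cmap e ` ?W) (cmap (cprod c d) \<circ> (\<lambda>p. (\<phi> p, \<psi> p)) \<circ> cinv e)"
    by (simp add: comp_def)
  moreover have "(\<lambda>p. (\<phi> p, \<psi> p)) ` ?W \<subseteq> cdom (cprod c d)" using U(4) V(4) by auto
  ultimately show "\<exists>c d U. c \<in> C \<and> d \<in> prod_manifold A B \<and> open U \<and> p \<in> U \<and> U \<subseteq> cdom c \<and>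
      (\<lambda>p. (\<phi> p, \<psi> p)) ` U \<subseteq> cdom d \<and> smooth_on (cmap c ` U) (cmap d \<circ> (\<lambda>p. (\<phi> p, \<psi> p)) \<circ> cinv c)"
    using e in_prod_manifold[OF c(1) d(1)] U(1,2,3) V(1,2)
    by (intro exI[of _ e] exI[of _ "cprod c d"] exI[of _ ?W] conjI) auto
qed

end

section \<open>Restriction to open sets and the global trivialisation\<close>

lemma points_restr: "points (restr A U) = points A \<inter> U"
  unfolding points_def restr_def by auto

lemma restr_superset: "points A \<subseteq> U \<Longrightarrow> restr A U = A"
proof -
  assume U: "points A \<subseteq> U"
  have "(cdom c \<inter> U, cmap c) = c" if "c \<in> A" for c
    using U cdom_subset_points[OF that] by (simp add: Int_absorb2 subset_trans)
  then show ?thesis unfolding restr_def by simp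
qed

lemma smooth_map_restr_codomain:
  assumes "smooth_map A (restr B N) \<phi>"
  shows "smooth_map A B \<phi>"
  unfolding smooth_map_def
proof (intro conjI ballI)
  show "\<phi> ` points A \<subseteq> points B" "continuous_on (points A) \<phi>"
    using assms unfolding smooth_map_def points_restr by auto
  fix c d assume cd: "c \<in> A" "d \<in> B"
  have "\<phi> p \<in> N" if "p \<in> cdom c" for p
    using smooth_map_in_points[OF assms in_pointsI[OF that cd(1)]] by (simp add: points_restr)
  then have "cdom c \<inter> \<phi> -` (cdom d \<inter> N) = cdom c \<inter> \<phi> -` cdom d" by blast
  moreover have "(cdom d \<inter> N, cmap d) \<in> restr B N" unfolding restr_def using cd(2) by blast
  ultimately show "smooth_on (cmap c ` (cdom c \<inter> \<phi> -` cdom d)) (cmap d \<circ> \<phi> \<circ> cinv c)"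
    using smooth_map_smooth_on[OF assms cd(1), of "(cdom d \<inter> N, cmap d)"] by simp
qed

text \<open>Allows a map to be glued from local ones: inverting a chart of the restricted atlas and
  inverting the original chart give the same coordinate expression on the smaller domain.\<close>

lemma smooth_map_local:
  assumes A: "smooth_manifold A" and B: "smooth_manifold B"
    and loc: "\<And>p. p \<in> points A \<Longrightarrow> \<exists>N \<psi>. open N \<and> p \<in> N \<and> smooth_map (restr A N) B \<psi> \<and> (\<forall>q\<in>points A \<inter> N. \<phi> q = \<psi> q)"
  shows "smooth_map A B \<phi>"
proof (rule smooth_mapI[OF A B])
  fix p assume p: "p \<in> points A"
  from loc[OF p] obtain N \<psi> where N: "open N" "p \<in> N" and \<psi>: "smooth_map (restr A N) B \<psi>"
    and eq: "\<And>q. q \<in> points A \<Longrightarrow> q \<in> N \<Longrightarrow> \<phi> q = \<psi> q" by blast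
  obtain c where c: "c \<in> A" "p \<in> cdom c" using p by (rule in_pointsE)
  have pN: "p \<in> points (restr A N)" using p N by (simp add: points_restr)
  from smooth_map_in_points[OF \<psi> this] obtain d where d: "d \<in> B" "\<psi> p \<in> cdom d" by (rule in_pointsE)
  have cN: "(cdom c \<inter> N, cmap c) \<in> restr A N" unfolding restr_def using c(1) by blast
  let ?U = "(cdom c \<inter> N) \<inter> ((points A \<inter> N) \<inter> \<psi> -` cdom d)"
  have "open (\<psi> -` cdom d \<inter> (points A \<inter> N))"
    using continuous_on_open_vimage[OF open_Int[OF open_points[OF A] N(1)], of \<psi>]
      smooth_map_continuous_on[OF \<psi>] open_cdom[OF B d(1)] unfolding points_restr by blast
  then have "open ((points A \<inter> N) \<inter> \<psi> -` cdom d)" by (metis inf_commute)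
  from open_Int[OF open_Int[OF open_cdom[OF A c(1)] N(1)] this] have U: "open ?U" .
  have cdU: "?U = (cdom c \<inter> N) \<inter> \<psi> -` cdom d" using cdom_subset_points[OF c(1)] by blast
  have "cdom c \<inter> ?U = ?U" by blast
  then have oU: "open (cmap c ` ?U)" using open_cmap_image[OF A c(1) U] by simp
  have "smooth_on (cmap c ` ?U) (cmap d \<circ> \<psi> \<circ> cinv (cdom c \<inter> N, cmap c))"
    using smooth_map_smooth_on[OF \<psi> cN d(1)] cdU by simp
  then have "smooth_on (cmap c ` ?U) (cmap d \<circ> \<phi> \<circ> cinv c)"
  proof (rule smooth_on_cong[OF oU, rotated], elim imageE)
    fix y q assume y: "y = cmap c q" and q: "q \<in> ?U"
    \<comment> \<open>A restricted chart has its own \<open>inv_into\<close>; injectivity of the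
      coordinate map makes it agree with \<open>cinv c\<close> on the smaller image.\<close>
    have "inj_on (cmap c) (cdom c \<inter> N)" using inj_on_cmap[OF A c(1)] inj_on_subset by blast
    then have "cinv (cdom c \<inter> N, cmap c) y = q"
      unfolding cinv_def y using q by (simp add: inv_into_f_f)
    moreover have "cinv c y = q" unfolding y using q cinv_cmap[OF A c(1)] by simp
    ultimately show "(cmap d \<circ> \<psi> \<circ> cinv (cdom c \<inter> N, cmap c)) y = (cmap d \<circ> \<phi> \<circ> cinv c) y"
      using eq q by simp
  qed
  moreover have "p \<in> ?U" using p N c d by simp
  moreover have "\<phi> ` ?U \<subseteq> cdom d" using eq by auto
  ultimately show "\<exists>c d U. c \<in> A \<and> d \<in> B \<and> open U \<and> p \<in> U \<and> U \<subseteq> cdom c \<and> \<phi> ` U \<subseteq> cdom d \<and>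
      smooth_on (cmap c ` U) (cmap d \<circ> \<phi> \<circ> cinv c)"
    using c(1) d(1) U by (intro exI[of _ c] exI[of _ d] exI[of _ ?U] conjI) auto
qed

text \<open>The local trivialisations are restrictions of one global map. Points with equal images
  have equal base points, so they lie over a common trivialising set and coincide; surjectivity is
  local on the base; and the global inverse agrees near each point with a local inverse, hence is
  smooth.\<close>

lemma cstar_bundle_diffeo:
  fixes M :: "('m::{t2_space, second_countable_topology}, real^3) atlas"
    and P :: "('p::{t2_space, second_countable_topology}, 'f::euclidean_space) atlas"
  assumes M: "smooth_manifold M" and bdl: "cstar_bundle M P pr h"
  shows "diffeo P (prod_manifold M cstar) (\<lambda>y. (pr y, h y))"
proof -
  let ?F = "\<lambda>y. (pr y, h y)"
  have P: "smooth_manifold P" and pr: "smooth_map P M pr" and h: "smooth_map P cstar h"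
    and loc: "\<And>x. x \<in> points M \<Longrightarrow> \<exists>U. open U \<and> x \<in> U \<and> U \<subseteq> points M \<and>
        diffeo (restr P (pr -` U)) (prod_manifold (restr M U) cstar) ?F"
    using bdl unfolding cstar_bundle_def by auto
  note MC = smooth_manifold_prod[OF M smooth_manifold_cstar]
  have F: "smooth_map P (prod_manifold M cstar) ?F"
    by (rule smooth_map_Pair[OF M smooth_manifold_cstar P pr h])
  have restr: "prod_manifold (restr M U) cstar = restr (prod_manifold M cstar) (U \<times> UNIV)" for U
  proof -
    have *: "prod_manifold X cstar = (\<lambda>c. (cdom c \<times> - {0}, map_prod (cmap c) id)) ` X" for X :: "('m, real^3) atlas"
      unfolding prod_manifold_def cstar_def by force
    show ?thesis unfolding * restr_def image_image by (intro image_cong) auto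
  qed
  have bij: "bij_betw ?F (points P \<inter> pr -` U) ((points M \<inter> U) \<times> - {0})"
    if "diffeo (restr P (pr -` U)) (prod_manifold (restr M U) cstar) ?F" for U
    using that unfolding diffeo_def points_prod_manifold points_restr points_cstar by blast
  have inj: "inj_on ?F (points P)"
  proof (rule inj_onI)
    fix y z assume y: "y \<in> points P" and z: "z \<in> points P" and eq: "?F y = ?F z"
    obtain U where U: "pr y \<in> U" "diffeo (restr P (pr -` U)) (prod_manifold (restr M U) cstar) ?F"
      using loc[OF smooth_map_in_points[OF pr y]] by blast
    show "y = z" using bij_betw_imp_inj_on[OF bij[OF U(2)]] y z eq U(1) by (auto dest: inj_onD)
  qed
  let ?G = "inv_into (points P) ?F"
  have im: "?F ` points P = points (prod_manifold M cstar)"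
  proof
    show "?F ` points P \<subseteq> points (prod_manifold M cstar)" using F unfolding smooth_map_def by blast
    show "points (prod_manifold M cstar) \<subseteq> ?F ` points P"
    proof
      fix w assume w: "w \<in> points (prod_manifold M cstar)"
      then obtain U where U: "fst w \<in> U" "diffeo (restr P (pr -` U)) (prod_manifold (restr M U) cstar) ?F"
        using loc[of "fst w"] by (auto simp: points_prod_manifold)
      have "w \<in> (points M \<inter> U) \<times> - {0}"
        using w U(1) by (auto simp: points_prod_manifold points_cstar)
      then show "w \<in> ?F ` points P" using bij_betw_imp_surj_on[OF bij[OF U(2)]] by blast
    qed
  qed
  have "smooth_map (prod_manifold M cstar) P ?G"
  proof (rule smooth_map_local[OF MC P])
    fix w assume w: "w \<in> points (prod_manifold M cstar)"
    then obtain U where U: "open U" "fst w \<in> U" "diffeo (restr P (pr -` U)) (prod_manifold (restr M U) cstar) ?F"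
      using loc[of "fst w"] by (auto simp: points_prod_manifold)
    let ?H = "inv_into (points P \<inter> pr -` U) ?F"
    have "smooth_map (restr (prod_manifold M cstar) (U \<times> UNIV)) (restr P (pr -` U)) ?H"
      using U(3) unfolding diffeo_def restr points_restr by blast
    moreover have "?G q = ?H q" if q: "q \<in> points (prod_manifold M cstar) \<inter> (U \<times> UNIV)" for q
    proof -
      have "q \<in> (points M \<inter> U) \<times> - {0}"
        using q by (auto simp: points_prod_manifold points_cstar)
      then have q': "q \<in> ?F ` (points P \<inter> pr -` U)" using bij_betw_imp_surj_on[OF bij[OF U(3)]] by simp
      have "?H q \<in> points P" "?F (?H q) = q" using inv_into_into[OF q'] f_inv_into_f[OF q'] by auto
      then show ?thesis using inv_into_f_eq[OF inj] by blast
    qed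
    ultimately show "\<exists>N \<psi>. open N \<and> w \<in> N \<and> smooth_map (restr (prod_manifold M cstar) N) P \<psi> \<and>
      (\<forall>q\<in>points (prod_manifold M cstar) \<inter> N. ?G q = \<psi> q)"
      using U(1,2) smooth_map_restr_codomain
      by (intro exI[of _ "U \<times> UNIV"] exI[of _ ?H] conjI) (auto simp: open_Times mem_Times_iff)
  qed
  then show ?thesis unfolding diffeo_def bij_betw_def using inj im F by blast
qed

section \<open>Differential forms\<close>

text \<open>Product rule for evaluating a family of linear maps on a moving vector. The family is
  differentiable only vector by vector, so \<open>w y\<close> is expanded in the basis first. In the
  exterior derivative of a pullback, \<open>w\<close> is a first derivative of the map.\<close>

lemma has_derivative_apply:
  fixes F :: "'a::euclidean_space \<Rightarrow> 'b::euclidean_space \<Rightarrow> 'c::real_normed_vector"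
  assumes S: "open S" "x \<in> S" and lin: "\<And>y. y \<in> S \<Longrightarrow> linear (F y)"
    and F: "\<And>v. (\<lambda>y. F y v) differentiable at x" and w: "(w has_derivative w') (at x)"
  shows "((\<lambda>y. F y (w y)) has_derivative
    (\<lambda>u. frechet_derivative (\<lambda>y. F y (w x)) (at x) u + F x (w' u))) (at x)"
proof -
  have Fb: "((\<lambda>y. F y b) has_derivative frechet_derivative (\<lambda>y. F y b) (at x)) (at x)" for b
    using has_frechet_derivative[OF F] .
  have expand: "F y v = (\<Sum>b\<in>Basis. (v \<bullet> b) *\<^sub>R F y b)" if "y \<in> S" for y v
    using linear_expand_Basis[OF lin[OF that]] .
  have 1: "((\<lambda>y. \<Sum>b\<in>Basis. (w x \<bullet> b) *\<^sub>R F y b) has_derivative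
    (\<lambda>u. \<Sum>b\<in>Basis. (w x \<bullet> b) *\<^sub>R frechet_derivative (\<lambda>y. F y b) (at x) u)) (at x)"
    by (intro has_derivative_sum bounded_linear.has_derivative[OF bounded_linear_scaleR_right] Fb)
  have "((\<lambda>y. F y (w x)) has_derivative
    (\<lambda>u. \<Sum>b\<in>Basis. (w x \<bullet> b) *\<^sub>R frechet_derivative (\<lambda>y. F y b) (at x) u)) (at x)"
    by (rule has_derivative_transform_within_open[OF 1 S]) (simp add: expand[symmetric])
  then have D: "frechet_derivative (\<lambda>y. F y (w x)) (at x) =
    (\<lambda>u. \<Sum>b\<in>Basis. (w x \<bullet> b) *\<^sub>R frechet_derivative (\<lambda>y. F y b) (at x) u)"
    by (rule frechet_derivative_eqI)
  have "((\<lambda>y. \<Sum>b\<in>Basis. (w y \<bullet> b) *\<^sub>R F y b) has_derivative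
    (\<lambda>u. \<Sum>b\<in>Basis. (w x \<bullet> b) *\<^sub>R frechet_derivative (\<lambda>y. F y b) (at x) u + (w' u \<bullet> b) *\<^sub>R F x b)) (at x)"
    by (intro has_derivative_sum has_derivative_scaleR has_derivative_inner_left w Fb)
  then have "((\<lambda>y. \<Sum>b\<in>Basis. (w y \<bullet> b) *\<^sub>R F y b) has_derivative
    (\<lambda>u. frechet_derivative (\<lambda>y. F y (w x)) (at x) u + F x (w' u))) (at x)"
    unfolding D by (simp add: sum.distrib expand[OF S(2), of "w' _"])
  then show ?thesis
    by (rule has_derivative_transform_within_open[OF _ S]) (simp add: expand[symmetric])
qed

lemma smooth_formD:
  assumes "smooth_form A \<alpha>" "c \<in> A"
  shows smooth_form_linear: "p \<in> cdom c \<Longrightarrow> linear (\<alpha> c p)"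
    and smooth_form_transform: "d \<in> A \<Longrightarrow> p \<in> cdom c \<Longrightarrow> p \<in> cdom d \<Longrightarrow> \<alpha> c p v = \<alpha> d p (tmap id c d p v)"
    and smooth_form_smooth_on: "smooth_on (cmap c ` cdom c) (\<lambda>y. \<alpha> c (cinv c y) v)"
  using assms unfolding smooth_form_def by blast+

lemma smooth_formI:
  assumes "\<And>c p. c \<in> A \<Longrightarrow> p \<in> cdom c \<Longrightarrow> linear (\<alpha> c p)"
    and "\<And>c d p v. c \<in> A \<Longrightarrow> d \<in> A \<Longrightarrow> p \<in> cdom c \<Longrightarrow> p \<in> cdom d \<Longrightarrow> \<alpha> c p v = \<alpha> d p (tmap id c d p v)"
    and "\<And>c v. c \<in> A \<Longrightarrow> smooth_on (cmap c ` cdom c) (\<lambda>y. \<alpha> c (cinv c y) v)"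
  shows "smooth_form A \<alpha>"
  unfolding smooth_form_def using assms by blast

lemma form_eqD: "form_eq A \<alpha> \<beta> \<Longrightarrow> c \<in> A \<Longrightarrow> p \<in> cdom c \<Longrightarrow> \<alpha> c p v = \<beta> c p v"
  unfolding form_eq_def by simp

section \<open>Tangent maps and differentials of functions\<close>

lemma tmap_has_derivative:
  assumes A: "smooth_manifold A" and B: "smooth_manifold B" and \<phi>: "smooth_map A B \<phi>"
    and cd: "c \<in> A" "d \<in> B" "p \<in> cdom c" "\<phi> p \<in> cdom d"
  shows "((cmap d \<circ> \<phi> \<circ> cinv c) has_derivative tmap \<phi> c d p) (at (cmap c p))"
proof -
  obtain U where U: "open U" "p \<in> U" "U \<subseteq> cdom c" "\<phi> ` U \<subseteq> cdom d" "open (cmap c ` U)"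
    "smooth_on (cmap c ` U) (cmap d \<circ> \<phi> \<circ> cinv c)" by (rule smooth_map_at[OF A B \<phi> cd])
  have "tmap \<phi> c d p = frechet_derivative (cmap d \<circ> \<phi> \<circ> cinv c) (at (cmap c p))"
    by (simp add: tmap_def fun_eq_iff)
  then show ?thesis using smooth_on_has_derivative[OF U(6)] U(2) by simp
qed

lemma tmap_linear:
  assumes "smooth_manifold A" "smooth_manifold B" "smooth_map A B \<phi>"
    and "c \<in> A" "d \<in> B" "p \<in> cdom c" "\<phi> p \<in> cdom d"
  shows "linear (tmap \<phi> c d p)"
  using tmap_has_derivative[OF assms] has_derivative_linear by blast

lemma tmap_compose:
  assumes A: "smooth_manifold A" and B: "smooth_manifold B" and C: "smooth_manifold C"
    and \<phi>: "smooth_map A B \<phi>" and \<psi>: "smooth_map B C \<psi>"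
    and cde: "c \<in> A" "d \<in> B" "e \<in> C" "p \<in> cdom c" "\<phi> p \<in> cdom d" "\<psi> (\<phi> p) \<in> cdom e"
  shows "tmap (\<lambda>p. \<psi> (\<phi> p)) c e p v = tmap \<psi> d e (\<phi> p) (tmap \<phi> c d p v)"
proof -
  obtain U where U: "open U" "p \<in> U" "U \<subseteq> cdom c" "\<phi> ` U \<subseteq> cdom d" "open (cmap c ` U)"
    "smooth_on (cmap c ` U) (cmap d \<circ> \<phi> \<circ> cinv c)" by (rule smooth_map_at[OF A B \<phi> cde(1,2,4,5)])
  have 1: "((cmap d \<circ> \<phi> \<circ> cinv c) has_derivative tmap \<phi> c d p) (at (cmap c p))"
    by (rule tmap_has_derivative[OF A B \<phi> cde(1,2,4,5)])
  have "((cmap e \<circ> \<psi> \<circ> cinv d) has_derivative tmap \<psi> d e (\<phi> p)) (at ((cmap d \<circ> \<phi> \<circ> cinv c) (cmap c p)))"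
    using tmap_has_derivative[OF B C \<psi> cde(2,3,5,6)] cinv_cmap[OF A cde(1,4)] by simp
  from has_derivative_compose[OF 1 this]
  have "((\<lambda>y. (cmap e \<circ> \<psi> \<circ> cinv d) ((cmap d \<circ> \<phi> \<circ> cinv c) y)) has_derivative
    (\<lambda>v. tmap \<psi> d e (\<phi> p) (tmap \<phi> c d p v))) (at (cmap c p))" .
  then have "((cmap e \<circ> (\<lambda>p. \<psi> (\<phi> p)) \<circ> cinv c) has_derivative
    (\<lambda>v. tmap \<psi> d e (\<phi> p) (tmap \<phi> c d p v))) (at (cmap c p))"
  proof (rule has_derivative_transform_within_open[OF _ U(5)])
    show "cmap c p \<in> cmap c ` U" using U(2) by simp
    fix y assume "y \<in> cmap c ` U"
    then obtain q where q: "y = cmap c q" "q \<in> U" by blast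
    then have "q \<in> cdom c" "\<phi> q \<in> cdom d" using U(3,4) by auto
    then show "(cmap e \<circ> \<psi> \<circ> cinv d) ((cmap d \<circ> \<phi> \<circ> cinv c) y) = (cmap e \<circ> (\<lambda>p. \<psi> (\<phi> p)) \<circ> cinv c) y"
      using q cinv_cmap[OF A cde(1)] cinv_cmap[OF B cde(2)] by simp
  qed
  then show ?thesis by (simp add: tmap_def frechet_derivative_eqI)
qed

lemma tmap_id:
  assumes A: "smooth_manifold A" and c: "c \<in> A" "p \<in> cdom c"
  shows "tmap id c c p v = v"
proof -
  have "((cmap c \<circ> id \<circ> cinv c) has_derivative (\<lambda>v. v)) (at (cmap c p))"
    by (rule has_derivative_transform_within_open[OF has_derivative_ident open_cimage[OF A c(1)]])
      (use c(2) in \<open>auto simp: cmap_cinv\<close>)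
  then show ?thesis by (simp add: tmap_def frechet_derivative_eqI)
qed

lemma tmap_transition:
  assumes A: "smooth_manifold A" and B: "smooth_manifold B" and \<phi>: "smooth_map A B \<phi>"
  shows tmap_transition_domain: "c \<in> A \<Longrightarrow> c' \<in> A \<Longrightarrow> d \<in> B \<Longrightarrow> p \<in> cdom c \<Longrightarrow> p \<in> cdom c' \<Longrightarrow> \<phi> p \<in> cdom d \<Longrightarrow>
      tmap \<phi> c' d p (tmap id c c' p v) = tmap \<phi> c d p v"
    and tmap_transition_codomain: "c \<in> A \<Longrightarrow> d \<in> B \<Longrightarrow> d' \<in> B \<Longrightarrow> p \<in> cdom c \<Longrightarrow> \<phi> p \<in> cdom d \<Longrightarrow> \<phi> p \<in> cdom d' \<Longrightarrow>
      tmap id d d' (\<phi> p) (tmap \<phi> c d p v) = tmap \<phi> c d' p v"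
  using tmap_compose[OF A A B smooth_map_id[OF A] \<phi>, of c c' d p v]
    tmap_compose[OF A B B \<phi> smooth_map_id[OF B], of c d d' p v] by (simp_all add: id_def)

lemma d_fun_has_derivative:
  assumes "smooth_fun A u" "c \<in> A" "p \<in> cdom c"
  shows "((\<lambda>y. u (cinv c y)) has_derivative d_fun u c p) (at (cmap c p))"
proof -
  have "d_fun u c p = frechet_derivative (\<lambda>y. u (cinv c y)) (at (cmap c p))"
    by (simp add: d_fun_def fun_eq_iff comp_def)
  then show ?thesis
    using smooth_on_has_derivative[OF smooth_fun_smooth_on[OF assms(1,2)]] assms(3) by simp
qed

lemma d_fun_eqI:
  "((\<lambda>y. u (cinv c y)) has_derivative D) (at (cmap c p)) \<Longrightarrow> d_fun u c p v = D v"
  by (simp add: d_fun_def comp_def frechet_derivative_eqI)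

lemma d_fun_cong:
  assumes A: "smooth_manifold A" and c: "c \<in> A" "p \<in> cdom c" and eq: "\<And>q. q \<in> points A \<Longrightarrow> u q = v q"
  shows "d_fun u c p w = d_fun v c p w"
proof -
  have "frechet_derivative (u \<circ> cinv c) (at (cmap c p)) = frechet_derivative (v \<circ> cinv c) (at (cmap c p))"
    by (rule frechet_derivative_cong_open[OF open_cimage[OF A c(1)]])
      (simp_all add: c(2) eq in_pointsI[OF cinv_in_cdom c(1)])
  then show ?thesis by (simp add: d_fun_def)
qed

lemma d_fun_compose:
  assumes A: "smooth_manifold A" and B: "smooth_manifold B" and \<phi>: "smooth_map A B \<phi>"
    and u: "smooth_fun B u" and cd: "c \<in> A" "d \<in> B" "p \<in> cdom c" "\<phi> p \<in> cdom d"
  shows "d_fun (\<lambda>p. u (\<phi> p)) c p v = d_fun u d (\<phi> p) (tmap \<phi> c d p v)"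
proof (rule d_fun_eqI)
  obtain U where U: "open U" "p \<in> U" "U \<subseteq> cdom c" "\<phi> ` U \<subseteq> cdom d" "open (cmap c ` U)"
    "smooth_on (cmap c ` U) (cmap d \<circ> \<phi> \<circ> cinv c)" by (rule smooth_map_at[OF A B \<phi> cd])
  have "((\<lambda>z. u (cinv d z)) has_derivative d_fun u d (\<phi> p)) (at ((cmap d \<circ> \<phi> \<circ> cinv c) (cmap c p)))"
    using d_fun_has_derivative[OF u cd(2,4)] cinv_cmap[OF A cd(1,3)] by simp
  from has_derivative_compose[OF tmap_has_derivative[OF A B \<phi> cd] this]
  show "((\<lambda>y. u (\<phi> (cinv c y))) has_derivative (\<lambda>v. d_fun u d (\<phi> p) (tmap \<phi> c d p v))) (at (cmap c p))"
  proof (rule has_derivative_transform_within_open[OF _ U(5)])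
    show "cmap c p \<in> cmap c ` U" using U(2) by simp
    fix y assume "y \<in> cmap c ` U"
    then obtain q where q: "y = cmap c q" "q \<in> U" by blast
    then have "q \<in> cdom c" "\<phi> q \<in> cdom d" using U(3,4) by auto
    then show "u (cinv d ((cmap d \<circ> \<phi> \<circ> cinv c) y)) = u (\<phi> (cinv c y))"
      using q cinv_cmap[OF A cd(1)] cinv_cmap[OF B cd(2)] by simp
  qed
qed

section \<open>Pullback of 1-forms and naturality of the exterior derivative\<close>

lemma pullback_eq:
  assumes A: "smooth_manifold A" and B: "smooth_manifold B" and \<phi>: "smooth_map A B \<phi>"
    and \<alpha>: "smooth_form B \<alpha>" and cd: "c \<in> A" "d \<in> B" "p \<in> cdom c" "\<phi> p \<in> cdom d"
  shows "pullback B \<phi> \<alpha> c p v = \<alpha> d (\<phi> p) (tmap \<phi> c d p v)"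
proof -
  define d' where "d' = (SOME d. d \<in> B \<and> \<phi> p \<in> cdom d)"
  have d': "d' \<in> B" "\<phi> p \<in> cdom d'"
    using someI[of "\<lambda>d. d \<in> B \<and> \<phi> p \<in> cdom d" d] cd unfolding d'_def by simp_all
  have "pullback B \<phi> \<alpha> c p v = \<alpha> d' (\<phi> p) (tmap \<phi> c d' p v)"
    by (simp add: pullback_def d'_def Let_def)
  also have "\<dots> = \<alpha> d (\<phi> p) (tmap id d' d (\<phi> p) (tmap \<phi> c d' p v))"
    by (rule smooth_form_transform[OF \<alpha> d'(1) cd(2) d'(2) cd(4)])
  also have "\<dots> = \<alpha> d (\<phi> p) (tmap \<phi> c d p v)"
    using tmap_transition_codomain[OF A B \<phi> cd(1) d'(1) cd(2) cd(3) d'(2) cd(4)] by simp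
  finally show ?thesis .
qed

text \<open>\<open>pullback\<close> chooses its target chart anew at every point, whereas
  differentiation sees a whole neighbourhood. On \<open>S\<close> the single chart \<open>d\<close>
  serves throughout, so the expression there can be differentiated.\<close>

lemma pullback_local:
  assumes A: "smooth_manifold A" and B: "smooth_manifold B" and \<phi>: "smooth_map A B \<phi>"
    and \<alpha>: "smooth_form B \<alpha>" and cd: "c \<in> A" "d \<in> B" "p \<in> cdom c" "\<phi> p \<in> cdom d"
  obtains S where "open S" "cmap c p \<in> S" "S \<subseteq> cmap c ` cdom c" "smooth_on S (cmap d \<circ> \<phi> \<circ> cinv c)"
    "(cmap d \<circ> \<phi> \<circ> cinv c) ` S \<subseteq> cmap d ` cdom d"
    "\<And>y v. y \<in> S \<Longrightarrow> pullback B \<phi> \<alpha> c (cinv c y) v =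
      \<alpha> d (cinv d ((cmap d \<circ> \<phi> \<circ> cinv c) y)) (frechet_derivative (cmap d \<circ> \<phi> \<circ> cinv c) (at y) v)"
proof -
  obtain U where U: "open U" "p \<in> U" "U \<subseteq> cdom c" "\<phi> ` U \<subseteq> cdom d" "open (cmap c ` U)"
    "smooth_on (cmap c ` U) (cmap d \<circ> \<phi> \<circ> cinv c)" by (rule smooth_map_at[OF A B \<phi> cd])
  have U': "q \<in> cdom c" "\<phi> q \<in> cdom d" if "q \<in> U" for q using U(3,4) that by auto
  show ?thesis
  proof (rule that[OF U(5) _ _ U(6)])
    show "cmap c p \<in> cmap c ` U" "cmap c ` U \<subseteq> cmap c ` cdom c" using U(2,3) by auto
    show "(cmap d \<circ> \<phi> \<circ> cinv c) ` cmap c ` U \<subseteq> cmap d ` cdom d"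
      using U' cinv_cmap[OF A cd(1)] by auto
    fix y v assume "y \<in> cmap c ` U"
    then obtain q where y: "y = cmap c q" and q: "q \<in> U" by blast
    show "pullback B \<phi> \<alpha> c (cinv c y) v =
      \<alpha> d (cinv d ((cmap d \<circ> \<phi> \<circ> cinv c) y)) (frechet_derivative (cmap d \<circ> \<phi> \<circ> cinv c) (at y) v)"
      using pullback_eq[OF A B \<phi> \<alpha> cd(1,2) U'[OF q]] cinv_cmap[OF A cd(1) U'(1)[OF q]]
        cinv_cmap[OF B cd(2) U'(2)[OF q]] y by (simp add: tmap_def)
  qed
qed

lemma smooth_form_pullback:
  assumes A: "smooth_manifold A" and B: "smooth_manifold B" and \<phi>: "smooth_map A B \<phi>"
    and \<alpha>: "smooth_form B \<alpha>"
  shows "smooth_form A (pullback B \<phi> \<alpha>)"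
proof (rule smooth_formI)
  fix c p assume c: "c \<in> A" "p \<in> cdom c"
  obtain d where d: "d \<in> B" "\<phi> p \<in> cdom d"
    using smooth_map_in_points[OF \<phi> in_pointsI[OF c(2,1)]] by (rule in_pointsE)
  have "pullback B \<phi> \<alpha> c p = (\<lambda>v. \<alpha> d (\<phi> p) (tmap \<phi> c d p v))"
    using pullback_eq[OF A B \<phi> \<alpha> c(1) d(1) c(2) d(2)] by (simp add: fun_eq_iff)
  then show "linear (pullback B \<phi> \<alpha> c p)"
    using linear_compose[OF tmap_linear[OF A B \<phi> c(1) d(1) c(2) d(2)] smooth_form_linear[OF \<alpha> d]]
    by (simp add: comp_def)
next
  fix c c' p v assume c: "c \<in> A" "c' \<in> A" "p \<in> cdom c" "p \<in> cdom c'"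
  obtain d where d: "d \<in> B" "\<phi> p \<in> cdom d"
    using smooth_map_in_points[OF \<phi> in_pointsI[OF c(3,1)]] by (rule in_pointsE)
  show "pullback B \<phi> \<alpha> c p v = pullback B \<phi> \<alpha> c' p (tmap id c c' p v)"
    using pullback_eq[OF A B \<phi> \<alpha> c(1) d(1) c(3) d(2)] pullback_eq[OF A B \<phi> \<alpha> c(2) d(1) c(4) d(2)]
      tmap_transition_domain[OF A B \<phi> c(1,2) d(1) c(3,4) d(2)] by simp
next
  fix c v assume c: "c \<in> A"
  show "smooth_on (cmap c ` cdom c) (\<lambda>y. pullback B \<phi> \<alpha> c (cinv c y) v)"
  proof (rule smooth_on_localI)
    fix y assume "y \<in> cmap c ` cdom c"
    then obtain p where p: "y = cmap c p" "p \<in> cdom c" by blast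
    obtain d where d: "d \<in> B" "\<phi> p \<in> cdom d"
      using smooth_map_in_points[OF \<phi> in_pointsI[OF p(2) c]] by (rule in_pointsE)
    let ?g = "cmap d \<circ> \<phi> \<circ> cinv c"
    obtain S where S: "open S" "cmap c p \<in> S" "S \<subseteq> cmap c ` cdom c" "smooth_on S ?g"
      "?g ` S \<subseteq> cmap d ` cdom d" and eq: "\<And>y v. y \<in> S \<Longrightarrow> pullback B \<phi> \<alpha> c (cinv c y) v =
      \<alpha> d (cinv d (?g y)) (frechet_derivative ?g (at y) v)"
      using pullback_local[OF A B \<phi> \<alpha> c d(1) p(2) d(2)] by metis
    have "smooth_on S (\<lambda>y. \<alpha> d (cinv d (?g y)) (frechet_derivative ?g (at y) v))"
    proof (rule smooth_on_apply[where F = "\<lambda>y. \<alpha> d (cinv d (?g y))" and w = "\<lambda>y. frechet_derivative ?g (at y) v", OF S(1)])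
      show "smooth_on S (\<lambda>y. \<alpha> d (cinv d (?g y)) w)" for w
        by (rule smooth_on_compose[OF S(1) S(4) smooth_form_smooth_on[OF \<alpha> d(1)] S(5)])
      show "smooth_on S (\<lambda>y. frechet_derivative ?g (at y) v)"
        by (rule smooth_on_frechet_derivative[OF S(4)])
      fix z assume "z \<in> S"
      then have "?g z \<in> cmap d ` cdom d" using S(5) by blast
      then show "linear (\<alpha> d (cinv d (?g z)))"
        using smooth_form_linear[OF \<alpha> d(1) cinv_in_cdom] by blast
    qed
    then have "smooth_on S (\<lambda>y. pullback B \<phi> \<alpha> c (cinv c y) v)"
      by (rule smooth_on_cong[OF S(1), rotated]) (simp add: eq)
    then show "\<exists>T. open T \<and> y \<in> T \<and> smooth_on T (\<lambda>y. pullback B \<phi> \<alpha> c (cinv c y) v)"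
      using S(1,2) p(1) by (intro exI[of _ S]) simp
  qed
qed

lemma smooth_form_differentiable:
  assumes "smooth_form A \<alpha>" "c \<in> A" "p \<in> cdom c"
  shows "(\<lambda>y. \<alpha> c (cinv c y) v) differentiable at (cmap c p)"
  using smooth_on_differentiable[OF smooth_form_smooth_on[OF assms(1,2)]] assms(3) by blast

text \<open>Differentiating the pulled back expression gives the pulled back derivative plus
  \<alpha> applied to the second derivative of the coordinate expression of \<phi>. The latter is
  symmetric in the two vectors and cancels under antisymmetrisation.\<close>

lemma d_form_pullback:
  assumes A: "smooth_manifold A" and B: "smooth_manifold B" and \<phi>: "smooth_map A B \<phi>"
    and \<alpha>: "smooth_form B \<alpha>" and cd: "c \<in> A" "d \<in> B" "p \<in> cdom c" "\<phi> p \<in> cdom d"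
  shows "d_form (pullback B \<phi> \<alpha>) c p u v = d_form \<alpha> d (\<phi> p) (tmap \<phi> c d p u) (tmap \<phi> c d p v)"
proof -
  let ?g = "cmap d \<circ> \<phi> \<circ> cinv c" and ?x = "cmap c p"
  obtain S where S: "open S" "?x \<in> S" "S \<subseteq> cmap c ` cdom c" "smooth_on S ?g"
    "?g ` S \<subseteq> cmap d ` cdom d" and eq: "\<And>y v. y \<in> S \<Longrightarrow> pullback B \<phi> \<alpha> c (cinv c y) v =
    \<alpha> d (cinv d (?g y)) (frechet_derivative ?g (at y) v)"
    using pullback_local[OF A B \<phi> \<alpha> cd] by metis
  have gx: "?g ?x = cmap d (\<phi> p)" "cinv d (?g ?x) = \<phi> p"
    using cinv_cmap[OF A cd(1,3)] cinv_cmap[OF B cd(2,4)] by simp_all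
  have D: "frechet_derivative (\<lambda>y. pullback B \<phi> \<alpha> c (cinv c y) v) (at ?x) u =
    frechet_derivative (\<lambda>z. \<alpha> d (cinv d z) (tmap \<phi> c d p v)) (at (cmap d (\<phi> p))) (tmap \<phi> c d p u)
    + \<alpha> d (\<phi> p) (frechet_derivative (\<lambda>y. frechet_derivative ?g (at y) v) (at ?x) u)" for u v
  proof -
    have 1: "((\<lambda>y. \<alpha> d (cinv d (?g y)) w) has_derivative
      (\<lambda>u. frechet_derivative (\<lambda>z. \<alpha> d (cinv d z) w) (at (cmap d (\<phi> p))) (tmap \<phi> c d p u))) (at ?x)" for w
      using has_derivative_compose[OF tmap_has_derivative[OF A B \<phi> cd], of "\<lambda>z. \<alpha> d (cinv d z) w"]
        has_frechet_derivative[OF smooth_form_differentiable[OF \<alpha> cd(2,4)]] gx(1) by metis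
    have "((\<lambda>y. \<alpha> d (cinv d (?g y)) (frechet_derivative ?g (at y) v)) has_derivative
      (\<lambda>u. frechet_derivative (\<lambda>y. \<alpha> d (cinv d (?g y)) (frechet_derivative ?g (at ?x) v)) (at ?x) u
        + \<alpha> d (cinv d (?g ?x)) (frechet_derivative (\<lambda>y. frechet_derivative ?g (at y) v) (at ?x) u))) (at ?x)"
    proof (rule has_derivative_apply[where F = "\<lambda>y. \<alpha> d (cinv d (?g y))" and
          w = "\<lambda>y. frechet_derivative ?g (at y) v", OF S(1,2)])
      fix z assume "z \<in> S"
      then have "?g z \<in> cmap d ` cdom d" using S(5) by blast
      then show "linear (\<alpha> d (cinv d (?g z)))"
        using smooth_form_linear[OF \<alpha> cd(2) cinv_in_cdom] by blast
    next
      show "(\<lambda>y. \<alpha> d (cinv d (?g y)) w) differentiable at ?x" for w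
        using 1 unfolding differentiable_def by blast
      show "((\<lambda>y. frechet_derivative ?g (at y) v) has_derivative
          frechet_derivative (\<lambda>y. frechet_derivative ?g (at y) v) (at ?x)) (at ?x)"
        by (rule smooth_on_has_derivative[OF smooth_on_frechet_derivative[OF S(4)] S(2)])
    qed
    then have "((\<lambda>y. pullback B \<phi> \<alpha> c (cinv c y) v) has_derivative
      (\<lambda>u. frechet_derivative (\<lambda>y. \<alpha> d (cinv d (?g y)) (frechet_derivative ?g (at ?x) v)) (at ?x) u
        + \<alpha> d (cinv d (?g ?x)) (frechet_derivative (\<lambda>y. frechet_derivative ?g (at y) v) (at ?x) u))) (at ?x)"
      by (rule has_derivative_transform_within_open[OF _ S(1,2)]) (simp add: eq)
    from frechet_derivative_eqI[OF this] frechet_derivative_eqI[OF 1] show ?thesis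
      unfolding gx(2) by (simp add: tmap_def)
  qed
  show ?thesis unfolding d_form_def D
    using mixed_derivatives_commute[OF S(1,2,4), of u v] by simp
qed

lemma form_eq_pullback_id:
  assumes A: "smooth_manifold A" and \<alpha>: "smooth_form A \<alpha>"
  shows "form_eq A (pullback A id \<alpha>) \<alpha>"
  unfolding form_eq_def
proof (intro ballI allI)
  fix c p v assume c: "c \<in> A" "p \<in> cdom c"
  show "pullback A id \<alpha> c p v = \<alpha> c p v"
    using pullback_eq[OF A A _ \<alpha> c(1,1,2), of id] smooth_map_id[OF A] tmap_id[OF A c] c(2)
    by (simp add: id_def)
qed

lemma d_form_cong:
  assumes A: "smooth_manifold A" and c: "c \<in> A" "p \<in> cdom c" and eq: "form_eq A \<alpha> \<beta>"
  shows "d_form \<alpha> c p u v = d_form \<beta> c p u v"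
proof -
  have "frechet_derivative (\<lambda>y. \<alpha> c (cinv c y) v) (at (cmap c p)) =
    frechet_derivative (\<lambda>y. \<beta> c (cinv c y) v) (at (cmap c p))" for v
    by (rule frechet_derivative_cong_open[OF open_cimage[OF A c(1)]])
      (use c form_eqD[OF eq c(1) cinv_in_cdom] in auto)
  then show ?thesis by (simp add: d_form_def)
qed

text \<open>A change of charts is the pullback along the identity map, so the independence of d from
  the chart is a special case of naturality.\<close>

lemma d_form_transform:
  assumes A: "smooth_manifold A" and \<alpha>: "smooth_form A \<alpha>"
    and cd: "c \<in> A" "d \<in> A" "p \<in> cdom c" "p \<in> cdom d"
  shows "d_form \<alpha> c p u v = d_form \<alpha> d p (tmap id c d p u) (tmap id c d p v)"
  using d_form_cong[OF A cd(1,3) form_eq_pullback_id[OF A \<alpha>]]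
    d_form_pullback[OF A A _ \<alpha> cd(1,2,3), of id u v] smooth_map_id[OF A] cd(4) by (simp add: id_def)

lemma d_fun_transform:
  assumes A: "smooth_manifold A" and u: "smooth_fun A u"
    and cd: "c \<in> A" "d \<in> A" "p \<in> cdom c" "p \<in> cdom d"
  shows "d_fun u c p v = d_fun u d p (tmap id c d p v)"
  using d_fun_compose[OF A A smooth_map_id[OF A] u cd] by (simp add: id_def)

section \<open>Operations on forms and their Leibniz rules\<close>

context
  fixes A :: "('m::{t2_space, second_countable_topology}, 'e::euclidean_space) atlas"
  assumes A: "smooth_manifold A"
begin

lemma smooth_form_scale:
  assumes u: "smooth_fun A u" and \<alpha>: "smooth_form A \<alpha>"
  shows "smooth_form A (scale_form u \<alpha>)"
proof (rule smooth_formI)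
  fix c v assume c: "c \<in> A"
  show "smooth_on (cmap c ` cdom c) (\<lambda>y. scale_form u \<alpha> c (cinv c y) v)"
    unfolding scale_form_def
    by (intro smooth_on_mult open_cimage[OF A c] smooth_fun_smooth_on[OF u c] smooth_form_smooth_on[OF \<alpha> c])
next
  fix c p assume c: "c \<in> A" "p \<in> cdom c"
  show "linear (scale_form u \<alpha> c p)"
    unfolding scale_form_def using linear_compose[OF smooth_form_linear[OF \<alpha> c] linear_times] by (simp add: comp_def)
next
  fix c d p v assume c: "c \<in> A" "d \<in> A" "p \<in> cdom c" "p \<in> cdom d"
  show "scale_form u \<alpha> c p v = scale_form u \<alpha> d p (tmap id c d p v)"
    by (simp add: scale_form_def smooth_form_transform[OF \<alpha> c])
qed

lemma smooth_form_add:
  assumes \<alpha>: "smooth_form A \<alpha>" and \<beta>: "smooth_form A \<beta>"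
  shows "smooth_form A (add_form \<alpha> \<beta>)"
proof (rule smooth_formI)
  fix c v assume c: "c \<in> A"
  show "smooth_on (cmap c ` cdom c) (\<lambda>y. add_form \<alpha> \<beta> c (cinv c y) v)"
    unfolding add_form_def
    by (intro smooth_on_add open_cimage[OF A c] smooth_form_smooth_on[OF \<alpha> c] smooth_form_smooth_on[OF \<beta> c])
next
  fix c p assume c: "c \<in> A" "p \<in> cdom c"
  show "linear (add_form \<alpha> \<beta> c p)"
    unfolding add_form_def by (rule linear_compose_add[OF smooth_form_linear[OF \<alpha> c] smooth_form_linear[OF \<beta> c]])
next
  fix c d p v assume c: "c \<in> A" "d \<in> A" "p \<in> cdom c" "p \<in> cdom d"
  show "add_form \<alpha> \<beta> c p v = add_form \<alpha> \<beta> d p (tmap id c d p v)"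
    by (simp add: add_form_def smooth_form_transform[OF \<alpha> c] smooth_form_transform[OF \<beta> c])
qed

lemma smooth_form_cnj:
  assumes \<alpha>: "smooth_form A \<alpha>"
  shows "smooth_form A (cnj_form \<alpha>)"
proof (rule smooth_formI)
  fix c v assume c: "c \<in> A"
  show "smooth_on (cmap c ` cdom c) (\<lambda>y. cnj_form \<alpha> c (cinv c y) v)"
    unfolding cnj_form_def by (intro smooth_on_cnj open_cimage[OF A c] smooth_form_smooth_on[OF \<alpha> c])
next
  fix c p assume c: "c \<in> A" "p \<in> cdom c"
  show "linear (cnj_form \<alpha> c p)"
    unfolding cnj_form_def using linear_compose[OF smooth_form_linear[OF \<alpha> c] bounded_linear.linear[OF bounded_linear_cnj]]
    by (simp add: comp_def)
next
  fix c d p v assume c: "c \<in> A" "d \<in> A" "p \<in> cdom c" "p \<in> cdom d"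
  show "cnj_form \<alpha> c p v = cnj_form \<alpha> d p (tmap id c d p v)"
    by (simp add: cnj_form_def smooth_form_transform[OF \<alpha> c])
qed

lemma smooth_form_d_fun:
  assumes u: "smooth_fun A u"
  shows "smooth_form A (d_fun u)"
proof (rule smooth_formI)
  fix c v assume c: "c \<in> A"
  have "smooth_on (cmap c ` cdom c) (\<lambda>y. frechet_derivative (\<lambda>y. u (cinv c y)) (at y) v)"
    by (rule smooth_on_frechet_derivative[OF smooth_fun_smooth_on[OF u c]])
  then show "smooth_on (cmap c ` cdom c) (\<lambda>y. d_fun u c (cinv c y) v)"
    by (rule smooth_on_cong[OF open_cimage[OF A c], rotated]) (simp add: d_fun_def cmap_cinv comp_def)
next
  fix c p assume c: "c \<in> A" "p \<in> cdom c"
  show "linear (d_fun u c p)" using has_derivative_linear[OF d_fun_has_derivative[OF u c]] .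
next
  fix c d p v assume c: "c \<in> A" "d \<in> A" "p \<in> cdom c" "p \<in> cdom d"
  show "d_fun u c p v = d_fun u d p (tmap id c d p v)"
    by (simp add: d_fun_transform[OF A u c])
qed

lemma d_form_d_fun:
  assumes u: "smooth_fun A u" and c: "c \<in> A" "p \<in> cdom c"
  shows "d_form (d_fun u) c p v w = 0"
proof -
  have "frechet_derivative (\<lambda>y. d_fun u c (cinv c y) v) (at (cmap c p)) =
    frechet_derivative (\<lambda>y. frechet_derivative (\<lambda>y. u (cinv c y)) (at y) v) (at (cmap c p))" for v
    by (rule frechet_derivative_cong_open[OF open_cimage[OF A c(1)]])
      (use c(2) in \<open>simp_all add: d_fun_def cmap_cinv comp_def\<close>)
  then show ?thesis
    using mixed_derivatives_commute[OF open_cimage[OF A c(1)] _ smooth_fun_smooth_on[OF u c(1)], of "cmap c p" v w] c(2)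
    by (simp add: d_form_def)
qed

lemma form_has_derivative:
  assumes "smooth_form A \<alpha>" "c \<in> A" "p \<in> cdom c"
  shows "((\<lambda>y. \<alpha> c (cinv c y) v) has_derivative
    frechet_derivative (\<lambda>y. \<alpha> c (cinv c y) v) (at (cmap c p))) (at (cmap c p))"
  using has_frechet_derivative[OF smooth_form_differentiable[OF assms]] .

lemma d_form_scale:
  assumes u: "smooth_fun A u" and \<alpha>: "smooth_form A \<alpha>" and c: "c \<in> A" "p \<in> cdom c"
  shows "d_form (scale_form u \<alpha>) c p v w = wedge (d_fun u) \<alpha> c p v w + u p * d_form \<alpha> c p v w"
proof -
  have "frechet_derivative (\<lambda>y. scale_form u \<alpha> c (cinv c y) w) (at (cmap c p)) v =
    u p * frechet_derivative (\<lambda>y. \<alpha> c (cinv c y) w) (at (cmap c p)) v + d_fun u c p v * \<alpha> c p w" for v w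
    using frechet_derivative_eqI[OF has_derivative_mult[OF d_fun_has_derivative[OF u c] form_has_derivative[OF \<alpha> c]]]
    by (simp add: scale_form_def cinv_cmap[OF A c])
  then show ?thesis by (simp add: d_form_def wedge_def algebra_simps)
qed

lemma d_form_add:
  assumes \<alpha>: "smooth_form A \<alpha>" and \<beta>: "smooth_form A \<beta>" and c: "c \<in> A" "p \<in> cdom c"
  shows "d_form (add_form \<alpha> \<beta>) c p v w = d_form \<alpha> c p v w + d_form \<beta> c p v w"
proof -
  have "frechet_derivative (\<lambda>y. add_form \<alpha> \<beta> c (cinv c y) w) (at (cmap c p)) v =
    frechet_derivative (\<lambda>y. \<alpha> c (cinv c y) w) (at (cmap c p)) v + frechet_derivative (\<lambda>y. \<beta> c (cinv c y) w) (at (cmap c p)) v" for v w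
    using frechet_derivative_eqI[OF has_derivative_add[OF form_has_derivative[OF \<alpha> c] form_has_derivative[OF \<beta> c]]]
    by (simp add: add_form_def)
  then show ?thesis by (simp add: d_form_def)
qed

lemma d_form_cnj:
  assumes \<alpha>: "smooth_form A \<alpha>" and c: "c \<in> A" "p \<in> cdom c"
  shows "d_form (cnj_form \<alpha>) c p v w = cnj (d_form \<alpha> c p v w)"
proof -
  have "frechet_derivative (\<lambda>y. cnj_form \<alpha> c (cinv c y) w) (at (cmap c p)) v =
    cnj (frechet_derivative (\<lambda>y. \<alpha> c (cinv c y) w) (at (cmap c p)) v)" for v w
    using frechet_derivative_eqI[OF bounded_linear.has_derivative[OF bounded_linear_cnj form_has_derivative[OF \<alpha> c]]]
    by (simp add: cnj_form_def)
  then show ?thesis by (simp add: d_form_def)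
qed

lemma d_fun_cnj:
  assumes u: "smooth_fun A u" and c: "c \<in> A" "p \<in> cdom c"
  shows "d_fun (\<lambda>p. cnj (u p)) c p v = cnj (d_fun u c p v)"
  by (rule d_fun_eqI, rule bounded_linear.has_derivative[OF bounded_linear_cnj d_fun_has_derivative[OF u c]])

lemma d_fun_mult:
  assumes u: "smooth_fun A u" and v: "smooth_fun A v" and c: "c \<in> A" "p \<in> cdom c"
  shows "d_fun (\<lambda>p. u p * v p) c p w = u p * d_fun v c p w + d_fun u c p w * v p"
  using d_fun_eqI[OF has_derivative_mult[OF d_fun_has_derivative[OF u c] d_fun_has_derivative[OF v c]]]
  by (simp add: cinv_cmap[OF A c])

lemma d_fun_add:
  assumes u: "smooth_fun A u" and v: "smooth_fun A v" and c: "c \<in> A" "p \<in> cdom c"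
  shows "d_fun (\<lambda>p. u p + v p) c p w = d_fun u c p w + d_fun v c p w"
  by (rule d_fun_eqI, rule has_derivative_add[OF d_fun_has_derivative[OF u c] d_fun_has_derivative[OF v c]])

lemma d_fun_ln_abs:
  assumes a: "smooth_fun A a" and nz: "a p \<noteq> (0::real)" and c: "c \<in> A" "p \<in> cdom c"
  shows "d_fun (\<lambda>p. complex_of_real (ln \<bar>a p\<bar>)) c p v = d_fun (\<lambda>p. complex_of_real (a p)) c p v / complex_of_real (a p)"
proof -
  let ?a = "\<lambda>y. a (cinv c y)"
  let ?D = "frechet_derivative ?a (at (cmap c p))"
  have D: "(?a has_derivative ?D) (at (cmap c p))"
    using smooth_on_has_derivative[OF smooth_fun_smooth_on[OF a c(1)]] c(2) by blast
  have nz': "?a (cmap c p) \<noteq> 0" using nz cinv_cmap[OF A c] by simp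
  have "d_fun (\<lambda>p. complex_of_real (ln \<bar>a p\<bar>)) c p v = complex_of_real (inverse (?a (cmap c p)) * ?D v)"
    by (rule d_fun_eqI, rule bounded_linear.has_derivative[OF bounded_linear_of_real has_derivative_ln_abs[OF D nz']])
  moreover have "d_fun (\<lambda>p. complex_of_real (a p)) c p v = complex_of_real (?D v)"
    by (rule d_fun_eqI, rule bounded_linear.has_derivative[OF bounded_linear_of_real D])
  ultimately show ?thesis using cinv_cmap[OF A c] by (simp add: field_simps)
qed

end

section \<open>Exterior products of three covectors\<close>

definition triple :: "('e \<Rightarrow> complex) \<Rightarrow> ('e \<Rightarrow> complex) \<Rightarrow> ('e \<Rightarrow> complex) \<Rightarrow> 'e \<Rightarrow> 'e \<Rightarrow> 'e \<Rightarrow> complex" where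
  "triple \<alpha> \<beta> \<gamma> u v w = \<alpha> u * (\<beta> v * \<gamma> w - \<beta> w * \<gamma> v) - \<alpha> v * (\<beta> u * \<gamma> w - \<beta> w * \<gamma> u)
     + \<alpha> w * (\<beta> u * \<gamma> v - \<beta> v * \<gamma> u)"

text \<open>The value on three vectors of the 3-form \<sigma> \<and> \<gamma>, for a 2-form \<sigma>
  and a covector \<gamma>. Together with \<open>triple\<close> it supplies Cramer's rule for
  2-forms.\<close>

definition mixed :: "('e \<Rightarrow> 'e \<Rightarrow> complex) \<Rightarrow> ('e \<Rightarrow> complex) \<Rightarrow> 'e \<Rightarrow> 'e \<Rightarrow> 'e \<Rightarrow> complex" where
  "mixed \<sigma> \<gamma> u v w = \<sigma> u v * \<gamma> w - \<sigma> u w * \<gamma> v + \<sigma> v w * \<gamma> u"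

definition cwedge :: "('e \<Rightarrow> complex) \<Rightarrow> ('e \<Rightarrow> complex) \<Rightarrow> 'e \<Rightarrow> 'e \<Rightarrow> complex" where
  "cwedge \<alpha> \<beta> u v = \<alpha> u * \<beta> v - \<alpha> v * \<beta> u"

lemma wedge_cwedge: "wedge \<alpha> \<beta> c p u v = cwedge (\<alpha> c p) (\<beta> c p) u v"
  by (simp add: wedge_def cwedge_def)

text \<open>Wedging with two members of the coframe annihilates all coefficients but one; the signs
  are those of the permutations that restore the order l, m, n.\<close>

lemma triple_frame:
  assumes "\<And>v. \<xi> v = A * l v + B * m v + C * n v"
  shows "triple \<xi> m n u v w = A * triple l m n u v w"
    and "triple \<xi> m l u v w = - C * triple l m n u v w"
    and "triple \<xi> n l u v w = B * triple l m n u v w"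
    and "triple l \<xi> n u v w = B * triple l m n u v w"
    and "triple l m \<xi> u v w = C * triple l m n u v w"
  unfolding triple_def assms by (simp_all add: algebra_simps)

lemma mixed_frame:
  assumes "\<And>u v. \<sigma> u v = X * cwedge m n u v + Y * cwedge m l u v + Z * cwedge n l u v"
  shows "mixed \<sigma> l u v w = X * triple l m n u v w"
    and "mixed \<sigma> m u v w = Z * triple l m n u v w"
    and "mixed \<sigma> n u v w = - Y * triple l m n u v w"
  unfolding triple_def mixed_def cwedge_def assms by (simp_all add: algebra_simps)

section \<open>Linear algebra of a coframe in dimension three\<close>

abbreviation E1 :: "real^3" where "E1 \<equiv> axis 1 1"
abbreviation E2 :: "real^3" where "E2 \<equiv> axis 2 1"
abbreviation E3 :: "real^3" where "E3 \<equiv> axis 3 1"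

lemma linear_eq_real3:
  fixes f g :: "real^3 \<Rightarrow> 'b::real_vector"
  assumes "linear f" "linear g" "f E1 = g E1" "f E2 = g E2" "f E3 = g E3"
  shows "f v = g v"
proof -
  have "f b = g b" if "b \<in> Basis" for b
  proof -
    from that obtain i :: 3 where "b = axis i 1" by (auto simp: Basis_vec_def)
    moreover have "i = 1 \<or> i = 2 \<or> i = 3" by (rule exhaust_3)
    ultimately show ?thesis using assms by auto
  qed
  then show ?thesis using linear_eq_stdbasis[OF assms(1,2)] by simp
qed

lemma linear_complex_mult:
  fixes f :: "'a::real_vector \<Rightarrow> complex"
  shows "linear f \<Longrightarrow> linear (\<lambda>v. k * f v)"
  using linear_compose[OF _ linear_times, of f k] by (simp add: comp_def)

lemma linear_triple:
  fixes l m n :: "'a::real_vector \<Rightarrow> complex"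
  assumes "linear l" "linear m" "linear n"
  shows "linear (\<lambda>u. triple l m n u v w)" "linear (\<lambda>v. triple l m n u v w)" "linear (\<lambda>w. triple l m n u v w)"
  by (rule linearI; simp add: triple_def linear_add[OF assms(1)] linear_add[OF assms(2)] linear_add[OF assms(3)]
    linear_scale[OF assms(1)] linear_scale[OF assms(2)] linear_scale[OF assms(3)] algebra_simps)+

text \<open>An alternating trilinear form that vanishes on the ordered basis vanishes on all basis
  triples, hence everywhere by linearity in one slot after another. Passing to fixed vectors makes
  the determinant a smooth function of the point in each chart.\<close>

lemma triple_nonzero_basis:
  fixes l m n :: "real^3 \<Rightarrow> complex"
  assumes lin: "linear l" "linear m" "linear n" and "triple l m n u v w \<noteq> 0"
  shows "triple l m n E1 E2 E3 \<noteq> 0"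
proof
  assume 0: "triple l m n E1 E2 E3 = 0"
  have swap: "triple l m n b a c = - triple l m n a b c" "triple l m n a c b = - triple l m n a b c"
    for a b c by (simp_all add: triple_def algebra_simps)
  have rep: "triple l m n a a b = 0" "triple l m n a b b = 0" "triple l m n a b a = 0" for a b
    by (simp_all add: triple_def algebra_simps)
  have perm: "triple l m n E1 E3 E2 = 0" "triple l m n E2 E1 E3 = 0" "triple l m n E2 E3 E1 = 0"
    "triple l m n E3 E1 E2 = 0" "triple l m n E3 E2 E1 = 0"
    using swap(2)[of E1 E3 E2] swap(1)[of E2 E1 E3] swap(2)[of E2 E3 E1] swap(1)[of E3 E1 E2] swap(2)[of E3 E2 E1] 0
    by simp_all
  have 1: "triple l m n a b w = 0" if "a \<in> {E1, E2, E3}" "b \<in> {E1, E2, E3}" for a b w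
    by (rule linear_eq_real3[OF linear_triple(3)[OF lin] linear_zero]) (use that in \<open>auto simp: rep 0 perm\<close>)
  have 2: "triple l m n a v w = 0" if "a \<in> {E1, E2, E3}" for a v w
    by (rule linear_eq_real3[OF linear_triple(2)[OF lin] linear_zero]) (rule 1[OF that]; simp)+
  have "triple l m n u v w = 0"
    by (rule linear_eq_real3[OF linear_triple(1)[OF lin] linear_zero]) (rule 2; simp)+
  then show False using assms(4) by simp
qed

context
  fixes l m n :: "real^3 \<Rightarrow> complex"
  assumes lin: "linear l" "linear m" "linear n" and nz: "triple l m n E1 E2 E3 \<noteq> 0"
begin

text \<open>Cramer's rule, verified on the three basis vectors. The explicit quotients are kept
  because they later give the smoothness of all coefficient functions.\<close>

lemma coframe_expand:
  assumes "linear \<xi>"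
  shows "\<xi> v = triple \<xi> m n E1 E2 E3 / triple l m n E1 E2 E3 * l v
    + triple l \<xi> n E1 E2 E3 / triple l m n E1 E2 E3 * m v
    + triple l m \<xi> E1 E2 E3 / triple l m n E1 E2 E3 * n v"
proof -
  let ?T = "triple l m n E1 E2 E3"
  have "?T * \<xi> v = triple \<xi> m n E1 E2 E3 * l v + triple l \<xi> n E1 E2 E3 * m v + triple l m \<xi> E1 E2 E3 * n v"
    by (rule linear_eq_real3[where f = "\<lambda>v. ?T * \<xi> v" and v = v])
      ((intro linear_compose_add linear_complex_mult lin assms)+, simp_all add: triple_def algebra_simps)
  then show ?thesis using nz by (simp add: field_simps)
qed

lemma coframe_unique:
  assumes "\<And>v. A * l v + B * m v + C * n v = A' * l v + B' * m v + C' * n v"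
  shows "A = A'" "B = B'" "C = C'"
proof -
  define \<xi> where "\<xi> v = A * l v + B * m v + C * n v" for v
  have \<xi>: "\<xi> v = A' * l v + B' * m v + C' * n v" for v using assms by (simp add: \<xi>_def)
  note frame = triple_frame(1,4,5)[where \<xi> = \<xi> and l = l and m = m and n = n and u = E1 and v = E2 and w = E3]
  show "A = A'" "B = B'" "C = C'" using nz frame[OF \<xi>_def] frame[OF \<xi>] by auto
qed

text \<open>Each coefficient is isolated by wedging \<sigma> with the complementary covector. After
  multiplication by the determinant both sides are bilinear, so it suffices to compare them on pairs
  of basis vectors.\<close>

lemma coframe_expand2:
  assumes \<sigma>: "\<And>u. linear (\<sigma> u)" "\<And>u v. \<sigma> u v = - \<sigma> v u"
  shows "\<sigma> u v = mixed \<sigma> l E1 E2 E3 / triple l m n E1 E2 E3 * cwedge m n u v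
    + (- mixed \<sigma> n E1 E2 E3 / triple l m n E1 E2 E3) * cwedge m l u v
    + mixed \<sigma> m E1 E2 E3 / triple l m n E1 E2 E3 * cwedge n l u v"
proof -
  let ?T = "triple l m n E1 E2 E3"
  define \<tau> where "\<tau> u v = mixed \<sigma> l E1 E2 E3 * cwedge m n u v
    + (- mixed \<sigma> n E1 E2 E3) * cwedge m l u v + mixed \<sigma> m E1 E2 E3 * cwedge n l u v" for u v
  have lw: "linear (\<lambda>v. cwedge \<alpha> \<beta> u v)" "linear (\<lambda>u. cwedge \<alpha> \<beta> u v)"
    if "linear \<alpha>" "linear \<beta>" for \<alpha> \<beta> :: "real^3 \<Rightarrow> complex" and u v
    by (rule linearI; simp add: cwedge_def linear_add[OF that(1)] linear_add[OF that(2)]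
      linear_scale[OF that(1)] linear_scale[OF that(2)] algebra_simps)+
  have l\<tau>: "linear (\<tau> u)" "linear (\<lambda>u. \<tau> u v)" for u v
    unfolding \<tau>_def by (intro linear_compose_add linear_complex_mult lw lin)+
  have "linear (\<lambda>u. \<sigma> u v)" for v
    using linear_compose_neg[OF \<sigma>(1)[of v]] \<sigma>(2) by (metis (no_types, lifting) ext)
  then have l\<sigma>: "linear (\<lambda>v. ?T * \<sigma> u v)" "linear (\<lambda>u. ?T * \<sigma> u v)" for u v
    by (intro linear_complex_mult \<sigma>; simp)+
  have d: "\<sigma> a a = 0" for a using \<sigma>(2)[of a a] by (simp add: equation_minus_iff)
  have s: "\<sigma> E2 E1 = - \<sigma> E1 E2" "\<sigma> E3 E1 = - \<sigma> E1 E3" "\<sigma> E3 E2 = - \<sigma> E2 E3" using \<sigma>(2) by blast+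
  have basis: "?T * \<sigma> a b = \<tau> a b" if "a \<in> {E1, E2, E3}" "b \<in> {E1, E2, E3}" for a b
    using that by (auto simp: d s \<tau>_def mixed_def triple_def cwedge_def algebra_simps)
  have 1: "?T * \<sigma> a v = \<tau> a v" if "a \<in> {E1, E2, E3}" for a v
    by (rule linear_eq_real3[OF l\<sigma>(1) l\<tau>(1)]; rule basis[OF that]; simp)
  have "?T * \<sigma> u v = \<tau> u v"
    by (rule linear_eq_real3[OF l\<sigma>(2) l\<tau>(2)]; rule 1; simp)
  then show ?thesis using nz by (simp add: \<tau>_def field_simps)
qed

lemma coframe_unique2:
  assumes "\<And>u v. X * cwedge m n u v + Y * cwedge m l u v + Z * cwedge n l u v =
    X' * cwedge m n u v + Y' * cwedge m l u v + Z' * cwedge n l u v"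
  shows "X = X'" "Y = Y'" "Z = Z'"
proof -
  define \<sigma> where "\<sigma> u v = X * cwedge m n u v + Y * cwedge m l u v + Z * cwedge n l u v" for u v
  have \<sigma>: "\<sigma> u v = X' * cwedge m n u v + Y' * cwedge m l u v + Z' * cwedge n l u v" for u v
    using assms by (simp add: \<sigma>_def)
  note frame = mixed_frame[where \<sigma> = \<sigma> and l = l and m = m and n = n and u = E1 and v = E2 and w = E3]
  show "X = X'" "Y = Y'" "Z = Z'" using nz frame[OF \<sigma>_def] frame[OF \<sigma>] by auto
qed

text \<open>The real linear map v -> (Re (l v), m v) goes between spaces of real dimension three, so
  injectivity suffices. Its kernel is annihilated by the whole coframe, since l is real and n is the
  conjugate of m.\<close>

lemma coframe_surj:
  assumes "\<And>v. l v \<in> \<real>" "\<And>v. n v = cnj (m v)"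
  shows "\<exists>v. l v = complex_of_real r \<and> m v = z"
proof -
  let ?F = "\<lambda>v. (Re (l v), m v)"
  have lF: "linear ?F"
    using linear_compose[OF lin(1) bounded_linear.linear[OF bounded_linear_Re]] lin(2)
    by (intro linearI) (simp_all add: linear_add[OF lin(1)] linear_add[OF lin(2)] linear_scale[OF lin(1)] linear_scale[OF lin(2)])
  have "inj ?F"
  proof (subst linear_injective_0[OF lF], intro allI impI)
    fix v assume "?F v = 0"
    then have 0: "l v = 0" "m v = 0" "n v = 0"
      using assms complex_is_Real_iff[of "l v"] by (auto simp: complex_eq_iff zero_prod_def)
    \<comment> \<open>Every coordinate covector is a combination of l, m and n, so it vanishes on a
      vector that these annihilate.\<close>
    have "complex_of_real (v $ i) = 0" for i
    proof -
      have "linear (\<lambda>v :: real^3. complex_of_real (v $ i))" by (intro linearI) (simp_all add: scaleR_conv_of_real[where 'a = complex])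
      from coframe_expand[OF this, of v] 0 show ?thesis by simp
    qed
    then show "v = 0" by (simp add: vec_eq_iff)
  qed
  then have "surj ?F" by (intro linear_injective_imp_surjective[OF lF]) simp_all
  from surjD[OF this, of "(r, z)"] obtain v where v: "Re (l v) = r" "m v = z" by auto
  moreover have "l v = complex_of_real (Re (l v))" using assms(1)[of v] by (simp add: complex_is_Real_iff complex_eq_iff)
  ultimately show ?thesis by metis
qed

end

section \<open>The exterior derivative of a 2-form\<close>

text \<open>A formula in a single chart is enough: only the vanishing of d d at a point is drawn
  from it.\<close>

definition d_form2 :: "('m, 'e::euclidean_space) form2 \<Rightarrow> ('m, 'e) chart \<Rightarrow> 'm \<Rightarrow> 'e \<Rightarrow> 'e \<Rightarrow> 'e \<Rightarrow> complex" where
  "d_form2 \<sigma> c p u v w =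
    frechet_derivative (\<lambda>y. \<sigma> c (cinv c y) v w) (at (cmap c p)) u -
    frechet_derivative (\<lambda>y. \<sigma> c (cinv c y) u w) (at (cmap c p)) v +
    frechet_derivative (\<lambda>y. \<sigma> c (cinv c y) u v) (at (cmap c p)) w"

context
  fixes A :: "('m::{t2_space, second_countable_topology}, 'e::euclidean_space) atlas"
  assumes A: "smooth_manifold A"
begin

lemma d_form_smooth_on:
  assumes "smooth_form A \<alpha>" "c \<in> A"
  shows "smooth_on (cmap c ` cdom c) (\<lambda>y. d_form \<alpha> c (cinv c y) u v)"
proof -
  have "smooth_on (cmap c ` cdom c) (\<lambda>y. frechet_derivative (\<lambda>y. \<alpha> c (cinv c y) v) (at y) u -
    frechet_derivative (\<lambda>y. \<alpha> c (cinv c y) u) (at y) v)"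
    by (intro smooth_on_diff open_cimage[OF A assms(2)] smooth_on_frechet_derivative smooth_form_smooth_on[OF assms])
  then show ?thesis
    by (rule smooth_on_cong[OF open_cimage[OF A assms(2)], rotated]) (simp add: d_form_def cmap_cinv)
qed

text \<open>The form is linear at all nearby points, so the functions being differentiated are
  themselves additive and homogeneous in the vector. This is what \<open>coframe_expand2\<close>
  requires of a 2-form.\<close>

lemma linear_d_form:
  assumes \<alpha>: "smooth_form A \<alpha>" and c: "c \<in> A" "p \<in> cdom c"
  shows "linear (d_form \<alpha> c p u)"
proof -
  let ?x = "cmap c p"
  have op: "open (cmap c ` cdom c)" "?x \<in> cmap c ` cdom c" using open_cimage[OF A c(1)] c(2) by auto
  have D: "((\<lambda>y. \<alpha> c (cinv c y) v) has_derivative frechet_derivative (\<lambda>y. \<alpha> c (cinv c y) v) (at ?x)) (at ?x)" for v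
    by (rule form_has_derivative[OF A \<alpha> c])
  have lin: "linear (\<alpha> c (cinv c y))" if "y \<in> cmap c ` cdom c" for y
    using smooth_form_linear[OF \<alpha> c(1) cinv_in_cdom[OF that]] .
  have add: "frechet_derivative (\<lambda>y. \<alpha> c (cinv c y) (v + w)) (at ?x) u =
    frechet_derivative (\<lambda>y. \<alpha> c (cinv c y) v) (at ?x) u + frechet_derivative (\<lambda>y. \<alpha> c (cinv c y) w) (at ?x) u" for u v w
    using frechet_derivative_eqI[OF has_derivative_transform_within_open[OF has_derivative_add[OF D[of v] D[of w]] op,
        where g = "\<lambda>y. \<alpha> c (cinv c y) (v + w)"]] linear_add[OF lin] by simp
  have scale: "frechet_derivative (\<lambda>y. \<alpha> c (cinv c y) (k *\<^sub>R v)) (at ?x) u =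
    k *\<^sub>R frechet_derivative (\<lambda>y. \<alpha> c (cinv c y) v) (at ?x) u" for u v k
    using frechet_derivative_eqI[OF has_derivative_transform_within_open[OF
        bounded_linear.has_derivative[OF bounded_linear_scaleR_right[of k] D[of v]] op,
        where g = "\<lambda>y. \<alpha> c (cinv c y) (k *\<^sub>R v)"]] linear_scale[OF lin] by simp
  have l: "linear (frechet_derivative (\<lambda>y. \<alpha> c (cinv c y) u) (at ?x))" using has_derivative_linear[OF D] .
  show ?thesis
    by (rule linearI) (simp_all add: d_form_def add scale linear_add[OF l] linear_scale[OF l] algebra_simps)
qed

text \<open>Six second derivatives occur; they cancel in pairs by symmetry.\<close>

lemma d_form2_d_form:
  assumes \<alpha>: "smooth_form A \<alpha>" and c: "c \<in> A" "p \<in> cdom c"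
  shows "d_form2 (d_form \<alpha>) c p u v w = 0"
proof -
  let ?x = "cmap c p" and ?S = "cmap c ` cdom c"
  have op: "open ?S" "?x \<in> ?S" using open_cimage[OF A c(1)] c(2) by auto
  let ?D = "\<lambda>v w y. frechet_derivative (\<lambda>y. \<alpha> c (cinv c y) w) (at y) v"
  have sm: "smooth_on ?S (?D v w)" for v w
    by (rule smooth_on_frechet_derivative[OF smooth_form_smooth_on[OF \<alpha> c(1)]])
  have "frechet_derivative (\<lambda>y. d_form \<alpha> c (cinv c y) v w) (at ?x) u =
    frechet_derivative (?D v w) (at ?x) u - frechet_derivative (?D w v) (at ?x) u" for u v w
  proof -
    have "((\<lambda>y. ?D v w y - ?D w v y) has_derivative
      (\<lambda>u. frechet_derivative (?D v w) (at ?x) u - frechet_derivative (?D w v) (at ?x) u)) (at ?x)"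
      by (intro has_derivative_diff smooth_on_has_derivative[OF sm op(2)])
    then have "((\<lambda>y. d_form \<alpha> c (cinv c y) v w) has_derivative
      (\<lambda>u. frechet_derivative (?D v w) (at ?x) u - frechet_derivative (?D w v) (at ?x) u)) (at ?x)"
      by (rule has_derivative_transform_within_open[OF _ op]) (simp add: d_form_def cmap_cinv)
    from frechet_derivative_eqI[OF this] show ?thesis by simp
  qed
  moreover have "frechet_derivative (?D v w) (at ?x) u = frechet_derivative (?D u w) (at ?x) v" for u v w
    by (rule mixed_derivatives_commute[OF op smooth_form_smooth_on[OF \<alpha> c(1)]])
  ultimately show ?thesis by (simp add: d_form2_def)
qed

lemma d_form2_cong:
  assumes c: "c \<in> A" "p \<in> cdom c" and eq: "\<And>q v w. q \<in> cdom c \<Longrightarrow> \<sigma> c q v w = \<tau> c q v w"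
  shows "d_form2 \<sigma> c p u v w = d_form2 \<tau> c p u v w"
proof -
  have "frechet_derivative (\<lambda>y. \<sigma> c (cinv c y) v w) (at (cmap c p)) =
    frechet_derivative (\<lambda>y. \<tau> c (cinv c y) v w) (at (cmap c p))" for v w
    by (rule frechet_derivative_cong_open[OF open_cimage[OF A c(1)] _ eq[OF cinv_in_cdom]]) (use c(2) in auto)
  then show ?thesis by (simp add: d_form2_def)
qed

lemma wedge_has_derivative:
  assumes f: "smooth_fun A f" and \<alpha>: "smooth_form A \<alpha>" and \<beta>: "smooth_form A \<beta>" and c: "c \<in> A" "p \<in> cdom c"
  shows "((\<lambda>y. f (cinv c y) * wedge \<alpha> \<beta> c (cinv c y) v w) has_derivative
    (\<lambda>u. f p * (
        \<alpha> c p v * frechet_derivative (\<lambda>y. \<beta> c (cinv c y) w) (at (cmap c p)) u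
      + frechet_derivative (\<lambda>y. \<alpha> c (cinv c y) v) (at (cmap c p)) u * \<beta> c p w
      - (\<alpha> c p w * frechet_derivative (\<lambda>y. \<beta> c (cinv c y) v) (at (cmap c p)) u
      + frechet_derivative (\<lambda>y. \<alpha> c (cinv c y) w) (at (cmap c p)) u * \<beta> c p v))
      + d_fun f c p u * wedge \<alpha> \<beta> c p v w)) (at (cmap c p))"
  using has_derivative_mult[OF d_fun_has_derivative[OF f c]
    has_derivative_diff[OF
      has_derivative_mult[OF form_has_derivative[OF A \<alpha> c, of v] form_has_derivative[OF A \<beta> c, of w]]
      has_derivative_mult[OF form_has_derivative[OF A \<alpha> c, of w] form_has_derivative[OF A \<beta> c, of v]]]]
  by (simp add: wedge_def cinv_cmap[OF A c])

text \<open>Leibniz rule d(f \<beta> \<and> \<gamma>) = df \<and> \<beta> \<and> \<gamma> + f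
  (d\<beta> \<and> \<gamma> - d\<gamma> \<and> \<beta>), using that a 2-form commutes with a 1-form.
  The three summands have the shape of the right-hand side of a structure equation.\<close>

lemma d_form2_sum:
  assumes f: "smooth_fun A f" "smooth_fun A g" "smooth_fun A h"
    and \<alpha>: "smooth_form A \<alpha>" and \<beta>: "smooth_form A \<beta>" and \<gamma>: "smooth_form A \<gamma>" and c: "c \<in> A" "p \<in> cdom c"
  shows "d_form2 (\<lambda>c p v w. f p * wedge \<beta> \<gamma> c p v w + g p * wedge \<beta> \<alpha> c p v w + h p * wedge \<gamma> \<alpha> c p v w) c p u v w =
    triple (d_fun f c p) (\<beta> c p) (\<gamma> c p) u v w
      + f p * (mixed (d_form \<beta> c p) (\<gamma> c p) u v w - mixed (d_form \<gamma> c p) (\<beta> c p) u v w)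
    + triple (d_fun g c p) (\<beta> c p) (\<alpha> c p) u v w
      + g p * (mixed (d_form \<beta> c p) (\<alpha> c p) u v w - mixed (d_form \<alpha> c p) (\<beta> c p) u v w)
    + triple (d_fun h c p) (\<gamma> c p) (\<alpha> c p) u v w
      + h p * (mixed (d_form \<gamma> c p) (\<alpha> c p) u v w - mixed (d_form \<alpha> c p) (\<gamma> c p) u v w)"
proof -
  note D = frechet_derivative_eqI[OF has_derivative_add[OF has_derivative_add[OF
        wedge_has_derivative[OF f(1) \<beta> \<gamma> c] wedge_has_derivative[OF f(2) \<beta> \<alpha> c]] wedge_has_derivative[OF f(3) \<gamma> \<alpha> c]]]
  show ?thesis
    unfolding d_form2_def D unfolding triple_def mixed_def d_form_def wedge_def
    by (simp add: algebra_simps)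
qed

end

section \<open>Structure equations\<close>

text \<open>Splits off the term i = 0; the index shift in the remaining sum accounts for the minus
  sign. It lets the wedge products on explicit lists be evaluated one vector at a time, so that zero
  entries remove terms early.\<close>

lemma wedge_list_Cons_Cons:
  "wedge_list (\<alpha> # \<alpha>s) (v # vs) = \<alpha> v * wedge_list \<alpha>s vs -
    (\<Sum>i<length vs. (- 1) ^ i * \<alpha> (vs ! i) * wedge_list \<alpha>s (v # take i vs @ drop (Suc i) vs))"
  by (simp add: sum.lessThan_Suc_shift sum_negf del: sum.lessThan_Suc)

lemma wedge_list_3: "wedge_list [\<alpha>, \<beta>, \<gamma>] [u, v, w] = triple \<alpha> \<beta> \<gamma> u v w"
proof -
  have 1: "wedge_list [\<alpha>] [u] = \<alpha> u" for \<alpha> :: "'a \<Rightarrow> complex" and u by simp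
  have 2: "wedge_list [\<alpha>, \<beta>] [u, v] = \<alpha> u * \<beta> v - \<alpha> v * \<beta> u" for \<alpha> \<beta> :: "'a \<Rightarrow> complex" and u v
    by (subst wedge_list_Cons_Cons) (simp add: 1 del: wedge_list.simps)
  show ?thesis
    by (subst wedge_list_Cons_Cons) (simp add: 2 sum.lessThan_Suc triple_def algebra_simps del: wedge_list.simps)
qed

locale congruence_structure =
  fixes M :: "('m::{t2_space, second_countable_topology}, real^3) atlas" and lam mu
  assumes M: "smooth_manifold M" and oc: "oriented_congruence M lam mu"
begin

abbreviation "mub \<equiv> cnj_form mu"

lemma lam: "smooth_form M lam" and mu: "smooth_form M mu" and mub: "smooth_form M mub"
  and lam_real: "c \<in> M \<Longrightarrow> x \<in> cdom c \<Longrightarrow> lam c x v \<in> \<real>"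
  using oc smooth_form_cnj[OF M, of mu] unfolding oriented_congruence_def real_form_def by blast+

lemma cnj_lam: "c \<in> M \<Longrightarrow> x \<in> cdom c \<Longrightarrow> cnj (lam c x v) = lam c x v"
  using lam_real by (simp add: Reals_cnj_iff)

abbreviation (input) coframe_det :: "(real^3 \<Rightarrow> complex) \<Rightarrow> (real^3 \<Rightarrow> complex) \<Rightarrow> (real^3 \<Rightarrow> complex) \<Rightarrow> complex" where
  "coframe_det \<alpha> \<beta> \<gamma> \<equiv> triple \<alpha> \<beta> \<gamma> E1 E2 E3"

lemma coframe_nonzero:
  assumes c: "c \<in> M" "x \<in> cdom c"
  shows "coframe_det (lam c x) (mu c x) (mub c x) \<noteq> 0"
proof -
  have "wedge_nonzero M [lam, mu, mub]" using oc unfolding oriented_congruence_def by simp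
  from this[unfolded wedge_nonzero_def, rule_format, OF c]
  obtain vs where vs: "length vs = length [lam, mu, mub]" "wedge_list (map (\<lambda>\<alpha>. \<alpha> c x) [lam, mu, mub]) vs \<noteq> 0"
    by blast
  from vs(1) obtain u v w where "vs = [u, v, w]" by (auto simp: length_Suc_conv)
  with vs(2) have "wedge_list [lam c x, mu c x, mub c x] [u, v, w] \<noteq> 0" unfolding list.map by blast
  then show ?thesis
    unfolding wedge_list_3
    by (rule triple_nonzero_basis[OF smooth_form_linear[OF lam c] smooth_form_linear[OF mu c] smooth_form_linear[OF mub c]])
qed

lemmas coframe_expand' = coframe_expand[OF smooth_form_linear[OF lam] smooth_form_linear[OF mu] smooth_form_linear[OF mub] coframe_nonzero]
  and coframe_expand2' = coframe_expand2[OF smooth_form_linear[OF lam] smooth_form_linear[OF mu] smooth_form_linear[OF mub] coframe_nonzero]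
  and coframe_unique' = coframe_unique[OF smooth_form_linear[OF lam] smooth_form_linear[OF mu] smooth_form_linear[OF mub] coframe_nonzero]
  and coframe_unique2' = coframe_unique2[OF smooth_form_linear[OF lam] smooth_form_linear[OF mu] smooth_form_linear[OF mub] coframe_nonzero]
  and coframe_surj' = coframe_surj[OF smooth_form_linear[OF lam] smooth_form_linear[OF mu] smooth_form_linear[OF mub] coframe_nonzero]

lemma coframe_transform:
  assumes "c \<in> M" "d \<in> M" "x \<in> cdom c" "x \<in> cdom d"
  shows "lam c x v = lam d x (tmap id c d x v)" "mu c x v = mu d x (tmap id c d x v)"
    "mub c x v = mub d x (tmap id c d x v)"
  using smooth_form_transform[OF lam assms] smooth_form_transform[OF mu assms] smooth_form_transform[OF mub assms]
  by blast+

lemma cwedge_transform: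
  assumes "c \<in> M" "d \<in> M" "x \<in> cdom c" "x \<in> cdom d"
  shows "cwedge (mu c x) (mub c x) u v = cwedge (mu d x) (mub d x) (tmap id c d x u) (tmap id c d x v)"
    "cwedge (mu c x) (lam c x) u v = cwedge (mu d x) (lam d x) (tmap id c d x u) (tmap id c d x v)"
    "cwedge (mub c x) (lam c x) u v = cwedge (mub d x) (lam d x) (tmap id c d x u) (tmap id c d x v)"
  by (simp_all add: cwedge_def coframe_transform[OF assms])

subsection \<open>Derivatives in the coframe\<close>

text \<open>The definite description speaks of all charts around x. The transformation laws carry
  the equation from one chart to every other, and independence of the coframe gives uniqueness. The
  coefficients of d\<lambda> and d\<mu> are handled in the same way.\<close>

lemma frame_derivs_eqI:
  assumes u: "smooth_fun M u" and c: "c \<in> M" "x \<in> cdom c"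
    and eq: "\<And>v. d_fun u c x v = l * lam c x v + m * mu c x v + n * mub c x v"
  shows "frame_derivs M lam mu u x = (l, m, n)"
  unfolding frame_derivs_def
proof (rule the_equality)
  show "case (l, m, n) of (l, m, n) \<Rightarrow> \<forall>c\<in>M. x \<in> cdom c \<longrightarrow>
    (\<forall>v. d_fun u c x v = l * lam c x v + m * mu c x v + n * mub c x v)"
    unfolding prod.case
  proof (intro ballI impI allI)
    fix d v assume d: "d \<in> M" "x \<in> cdom d"
    show "d_fun u d x v = l * lam d x v + m * mu d x v + n * mub d x v"
      unfolding d_fun_transform[OF M u d(1) c(1) d(2) c(2)] coframe_transform[OF d(1) c(1) d(2) c(2)] by (rule eq)
  qed
next
  fix t :: "complex \<times> complex \<times> complex"
  obtain l' m' n' where t: "t = (l', m', n')" by (cases t)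
  assume "case t of (l, m, n) \<Rightarrow> \<forall>c\<in>M. x \<in> cdom c \<longrightarrow>
    (\<forall>v. d_fun u c x v = l * lam c x v + m * mu c x v + n * mub c x v)"
  then have "d_fun u c x v = l' * lam c x v + m' * mu c x v + n' * mub c x v" for v
    using c unfolding t by simp
  then have "l' * lam c x v + m' * mu c x v + n' * mub c x v = l * lam c x v + m * mu c x v + n * mub c x v" for v
    using eq by metis
  from coframe_unique'[OF c c c c this] show "t = (l, m, n)" by (simp add: t)
qed

abbreviation "Dl \<equiv> D_lam M lam mu"
abbreviation "Dm \<equiv> D_mu M lam mu"
abbreviation "Dn \<equiv> D_mubar M lam mu"

lemma D_eqI:
  assumes u: "smooth_fun M u" and c: "c \<in> M" "x \<in> cdom c"
    and eq: "\<And>v. d_fun u c x v = l * lam c x v + m * mu c x v + n * mub c x v"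
  shows "Dl u x = l" "Dm u x = m" "Dn u x = n"
  using frame_derivs_eqI[OF assms] by (simp_all add: D_lam_def D_mu_def D_mubar_def)

lemma D_formula:
  assumes u: "smooth_fun M u" and c: "c \<in> M" "x \<in> cdom c"
  shows "Dl u x = coframe_det (d_fun u c x) (mu c x) (mub c x) / coframe_det (lam c x) (mu c x) (mub c x)"
    "Dm u x = coframe_det (lam c x) (d_fun u c x) (mub c x) / coframe_det (lam c x) (mu c x) (mub c x)"
    "Dn u x = coframe_det (lam c x) (mu c x) (d_fun u c x) / coframe_det (lam c x) (mu c x) (mub c x)"
  using D_eqI[OF u c coframe_expand'[OF c c c c smooth_form_linear[OF smooth_form_d_fun[OF M u] c]]] by blast+

lemma d_fun_frame:
  assumes u: "smooth_fun M u" and c: "c \<in> M" "x \<in> cdom c"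
  shows "d_fun u c x v = Dl u x * lam c x v + Dm u x * mu c x v + Dn u x * mub c x v"
  unfolding D_formula[OF assms]
  by (rule coframe_expand'[OF c c c c smooth_form_linear[OF smooth_form_d_fun[OF M u] c]])

lemma smooth_on_triple:
  assumes "smooth_form M \<alpha>" "smooth_form M \<beta>" "smooth_form M \<gamma>" "c \<in> M"
  shows "smooth_on (cmap c ` cdom c) (\<lambda>y. coframe_det (\<alpha> c (cinv c y)) (\<beta> c (cinv c y)) (\<gamma> c (cinv c y)))"
  unfolding triple_def
  by (intro smooth_intros open_cimage[OF M assms(4)] smooth_form_smooth_on[OF assms(1,4)]
      smooth_form_smooth_on[OF assms(2,4)] smooth_form_smooth_on[OF assms(3,4)])

text \<open>By Cramer's rule a frame coefficient is, in every chart, a quotient of smooth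
  determinants. Numerator and denominator depend on the chart, but their quotient is the same
  function \<open>u\<close>.\<close>

lemma smooth_fun_coframeI:
  assumes "\<And>c. c \<in> M \<Longrightarrow> smooth_on (cmap c ` cdom c) (\<lambda>y. N c (cinv c y))"
    and "\<And>c x. c \<in> M \<Longrightarrow> x \<in> cdom c \<Longrightarrow> u x = N c x / coframe_det (lam c x) (mu c x) (mub c x)"
  shows "smooth_fun M u"
proof (rule smooth_funI)
  fix c assume c: "c \<in> M"
  have "smooth_on (cmap c ` cdom c) (\<lambda>y. N c (cinv c y) / coframe_det (lam c (cinv c y)) (mu c (cinv c y)) (mub c (cinv c y)))"
    by (rule smooth_on_divide[OF open_cimage[OF M c] assms(1)[OF c] smooth_on_triple[OF lam mu mub c]
          coframe_nonzero[OF c cinv_in_cdom]])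
  then show "smooth_on (cmap c ` cdom c) (\<lambda>y. u (cinv c y))"
    by (rule smooth_on_cong[OF open_cimage[OF M c], rotated]) (simp add: assms(2)[OF c cinv_in_cdom])
qed

lemma smooth_D [smooth_intros]:
  assumes u: "smooth_fun M u"
  shows "smooth_fun M (Dl u)" "smooth_fun M (Dm u)" "smooth_fun M (Dn u)"
proof -
  show "smooth_fun M (Dl u)"
    by (rule smooth_fun_coframeI[OF _ D_formula(1)[OF u]]) (rule smooth_on_triple[OF smooth_form_d_fun[OF M u] mu mub])
  show "smooth_fun M (Dm u)"
    by (rule smooth_fun_coframeI[OF _ D_formula(2)[OF u]]) (rule smooth_on_triple[OF lam smooth_form_d_fun[OF M u] mub])
  show "smooth_fun M (Dn u)"
    by (rule smooth_fun_coframeI[OF _ D_formula(3)[OF u]]) (rule smooth_on_triple[OF lam mu smooth_form_d_fun[OF M u]])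
qed

text \<open>Conjugating du exchanges the \<mu> and \<mu>' coefficients, because \<lambda> is
  real.\<close>

lemma D_cnj:
  assumes u: "smooth_fun M u" and x: "x \<in> points M"
  shows "Dl (\<lambda>x. cnj (u x)) x = cnj (Dl u x)" "Dm (\<lambda>x. cnj (u x)) x = cnj (Dn u x)"
    "Dn (\<lambda>x. cnj (u x)) x = cnj (Dm u x)"
proof -
  obtain c where c: "c \<in> M" "x \<in> cdom c" using x by (rule in_pointsE)
  have "d_fun (\<lambda>x. cnj (u x)) c x v = cnj (Dl u x) * lam c x v + cnj (Dn u x) * mu c x v + cnj (Dm u x) * mub c x v" for v
    unfolding d_fun_cnj[OF M u c] d_fun_frame[OF u c] using cnj_lam[OF c] by (simp add: cnj_form_def)
  from D_eqI[OF smooth_fun_linear(1)[OF M u] c this]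
  show "Dl (\<lambda>x. cnj (u x)) x = cnj (Dl u x)" "Dm (\<lambda>x. cnj (u x)) x = cnj (Dn u x)"
    "Dn (\<lambda>x. cnj (u x)) x = cnj (Dm u x)" by blast+
qed

lemma D_mult:
  assumes u: "smooth_fun M u" and w: "smooth_fun M w" and x: "x \<in> points M"
  shows "Dl (\<lambda>x. u x * w x) x = u x * Dl w x + Dl u x * w x"
    "Dm (\<lambda>x. u x * w x) x = u x * Dm w x + Dm u x * w x"
    "Dn (\<lambda>x. u x * w x) x = u x * Dn w x + Dn u x * w x"
proof -
  obtain c where c: "c \<in> M" "x \<in> cdom c" using x by (rule in_pointsE)
  have "d_fun (\<lambda>x. u x * w x) c x v = (u x * Dl w x + Dl u x * w x) * lam c x v
    + (u x * Dm w x + Dm u x * w x) * mu c x v + (u x * Dn w x + Dn u x * w x) * mub c x v" for v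
    unfolding d_fun_mult[OF M u w c] d_fun_frame[OF u c] d_fun_frame[OF w c] by (simp add: algebra_simps)
  from D_eqI[OF smooth_fun_mult[OF M u w] c this]
  show "Dl (\<lambda>x. u x * w x) x = u x * Dl w x + Dl u x * w x"
    "Dm (\<lambda>x. u x * w x) x = u x * Dm w x + Dm u x * w x"
    "Dn (\<lambda>x. u x * w x) x = u x * Dn w x + Dn u x * w x" by blast+
qed

lemma D_add:
  assumes u: "smooth_fun M u" and w: "smooth_fun M w" and x: "x \<in> points M"
  shows "Dl (\<lambda>x. u x + w x) x = Dl u x + Dl w x"
    "Dm (\<lambda>x. u x + w x) x = Dm u x + Dm w x"
    "Dn (\<lambda>x. u x + w x) x = Dn u x + Dn w x"
proof -
  obtain c where c: "c \<in> M" "x \<in> cdom c" using x by (rule in_pointsE)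
  have "d_fun (\<lambda>x. u x + w x) c x v = (Dl u x + Dl w x) * lam c x v
    + (Dm u x + Dm w x) * mu c x v + (Dn u x + Dn w x) * mub c x v" for v
    unfolding d_fun_add[OF M u w c] d_fun_frame[OF u c] d_fun_frame[OF w c] by (simp add: algebra_simps)
  from D_eqI[OF smooth_fun_intros(2)[OF M u w] c this]
  show "Dl (\<lambda>x. u x + w x) x = Dl u x + Dl w x"
    "Dm (\<lambda>x. u x + w x) x = Dm u x + Dm w x"
    "Dn (\<lambda>x. u x + w x) x = Dn u x + Dn w x" by blast+
qed

lemma D_cong:
  assumes u: "smooth_fun M u" and eq: "\<And>y. y \<in> points M \<Longrightarrow> u y = w y" and x: "x \<in> points M"
  shows "Dl u x = Dl w x" "Dm u x = Dm w x" "Dn u x = Dn w x"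
proof -
  obtain c where c: "c \<in> M" "x \<in> cdom c" using x by (rule in_pointsE)
  have "d_fun u c x v = Dl w x * lam c x v + Dm w x * mu c x v + Dn w x * mub c x v" for v
    using d_fun_frame[OF smooth_fun_cong[OF M u eq] c] d_fun_cong[OF M c eq] by simp
  from D_eqI[OF u c this] show "Dl u x = Dl w x" "Dm u x = Dm w x" "Dn u x = Dn w x" by blast+
qed

lemma D_scale:
  assumes u: "smooth_fun M u" and x: "x \<in> points M"
  shows "Dl (\<lambda>x. k * u x) x = k * Dl u x" "Dm (\<lambda>x. k * u x) x = k * Dm u x" "Dn (\<lambda>x. k * u x) x = k * Dn u x"
proof -
  obtain c where c: "c \<in> M" "x \<in> cdom c" using x by (rule in_pointsE)
  have "d_fun (\<lambda>x. k) c x v = 0 * lam c x v + 0 * mu c x v + 0 * mub c x v" for v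
    by (simp add: d_fun_def comp_def)
  from D_eqI[OF smooth_fun_intros(1)[OF M] c this] D_mult[OF smooth_fun_intros(1)[OF M] u x]
  show "Dl (\<lambda>x. k * u x) x = k * Dl u x" "Dm (\<lambda>x. k * u x) x = k * Dm u x" "Dn (\<lambda>x. k * u x) x = k * Dn u x"
    by simp_all
qed

lemma D_minus:
  assumes "smooth_fun M u" "x \<in> points M"
  shows "Dl (\<lambda>x. - u x) x = - Dl u x" "Dm (\<lambda>x. - u x) x = - Dm u x" "Dn (\<lambda>x. - u x) x = - Dn u x"
  using D_scale[OF assms, of "- 1"] by simp_all

lemma D_diff:
  assumes "smooth_fun M u" "smooth_fun M w" "x \<in> points M"
  shows "Dl (\<lambda>x. u x - w x) x = Dl u x - Dl w x"
    "Dm (\<lambda>x. u x - w x) x = Dm u x - Dm w x"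
    "Dn (\<lambda>x. u x - w x) x = Dn u x - Dn w x"
  using D_add[OF assms(1) smooth_fun_intros(4)[OF M assms(2)] assms(3)] D_minus[OF assms(2,3)] by simp_all

subsection \<open>The coefficients of the structure equations\<close>

abbreviation "tw \<equiv> twist M lam mu"
abbreviation "a \<equiv> \<lambda>x. complex_of_real (tw x)"
abbreviation "b \<equiv> coeff_b M lam mu"
abbreviation "p \<equiv> coeff_p M lam mu"
abbreviation "q \<equiv> coeff_q M lam mu"
abbreviation "s \<equiv> shear M lam mu"

abbreviation cmn where "cmn c x \<equiv> cwedge (mu c x) (mub c x)"
abbreviation cml where "cml c x \<equiv> cwedge (mu c x) (lam c x)"
abbreviation cnl where "cnl c x \<equiv> cwedge (mub c x) (lam c x)"

lemma cnj_coframe_wedges: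
  assumes c: "c \<in> M" "x \<in> cdom c"
  shows "cnj (cmn c x u v) = - cmn c x u v" "cnj (cml c x u v) = cnl c x u v" "cnj (cnl c x u v) = cml c x u v"
  using cnj_lam[OF c] by (simp_all add: cwedge_def cnj_form_def)

lemma d_form_expand:
  assumes \<alpha>: "smooth_form M \<alpha>" and c: "c \<in> M" "x \<in> cdom c"
  shows "d_form \<alpha> c x u v =
    mixed (d_form \<alpha> c x) (lam c x) E1 E2 E3 / coframe_det (lam c x) (mu c x) (mub c x) * cmn c x u v
    + (- mixed (d_form \<alpha> c x) (mub c x) E1 E2 E3 / coframe_det (lam c x) (mu c x) (mub c x)) * cml c x u v
    + mixed (d_form \<alpha> c x) (mu c x) E1 E2 E3 / coframe_det (lam c x) (mu c x) (mub c x) * cnl c x u v"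
  by (rule coframe_expand2'[OF c c c c linear_d_form[OF M \<alpha> c]]) (simp add: d_form_def)

lemma dmu_coeffs_eqI:
  assumes c: "c \<in> M" "x \<in> cdom c"
    and eq: "\<And>u v. d_form mu c x u v = p' * cmn c x u v + q' * cml c x u v + s' * cnl c x u v"
  shows "dmu_coeffs M lam mu x = (p', q', s')"
  unfolding dmu_coeffs_def wedge_cwedge
proof (rule the_equality)
  show "case (p', q', s') of (p1, q1, s1) \<Rightarrow> \<forall>c\<in>M. x \<in> cdom c \<longrightarrow>
    (\<forall>u v. d_form mu c x u v = p1 * cmn c x u v + q1 * cml c x u v + s1 * cnl c x u v)"
    unfolding prod.case
  proof (intro ballI impI allI)
    fix d u v assume d: "d \<in> M" "x \<in> cdom d"
    show "d_form mu d x u v = p' * cmn d x u v + q' * cml d x u v + s' * cnl d x u v"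
      unfolding d_form_transform[OF M mu d(1) c(1) d(2) c(2)] cwedge_transform[OF d(1) c(1) d(2) c(2)] by (rule eq)
  qed
next
  fix t :: "complex \<times> complex \<times> complex"
  obtain p'' q'' s'' where t: "t = (p'', q'', s'')" by (cases t)
  assume "case t of (p1, q1, s1) \<Rightarrow> \<forall>c\<in>M. x \<in> cdom c \<longrightarrow>
    (\<forall>u v. d_form mu c x u v = p1 * cmn c x u v + q1 * cml c x u v + s1 * cnl c x u v)"
  then have "d_form mu c x u v = p'' * cmn c x u v + q'' * cml c x u v + s'' * cnl c x u v" for u v
    using c unfolding t by simp
  then have "p'' * cmn c x u v + q'' * cml c x u v + s'' * cnl c x u v =
    p' * cmn c x u v + q' * cml c x u v + s' * cnl c x u v" for u v
    using eq by metis
  from coframe_unique2'[OF c c c c this] show "t = (p', q', s')" by (simp add: t)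
qed

lemma dmu_formula:
  assumes c: "c \<in> M" "x \<in> cdom c"
  shows "p x = mixed (d_form mu c x) (lam c x) E1 E2 E3 / coframe_det (lam c x) (mu c x) (mub c x)"
    "q x = - mixed (d_form mu c x) (mub c x) E1 E2 E3 / coframe_det (lam c x) (mu c x) (mub c x)"
    "s x = mixed (d_form mu c x) (mu c x) E1 E2 E3 / coframe_det (lam c x) (mu c x) (mub c x)"
  using dmu_coeffs_eqI[OF c d_form_expand[OF mu c]] by (simp_all add: coeff_p_def coeff_q_def shear_def)

lemma dmu:
  assumes c: "c \<in> M" "x \<in> cdom c"
  shows "d_form mu c x u v = p x * cmn c x u v + q x * cml c x u v + s x * cnl c x u v"
  unfolding dmu_formula[OF c] by (rule d_form_expand[OF mu c])

lemma dmub: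
  assumes c: "c \<in> M" "x \<in> cdom c"
  shows "d_form mub c x u v = - cnj (p x) * cmn c x u v + cnj (s x) * cml c x u v + cnj (q x) * cnl c x u v"
  unfolding d_form_cnj[OF M mu c] dmu[OF c] by (simp add: cnj_coframe_wedges[OF c])

lemma dlam_coeffs_eqI:
  assumes c: "c \<in> M" "x \<in> cdom c"
    and eq: "\<And>u v. d_form lam c x u v = \<i> * complex_of_real a' * cmn c x u v + b' * cml c x u v + cnj b' * cnl c x u v"
  shows "dlam_coeffs M lam mu x = (a', b')"
  unfolding dlam_coeffs_def wedge_cwedge
proof (rule the_equality)
  show "case (a', b') of (a1, b1) \<Rightarrow> \<forall>c\<in>M. x \<in> cdom c \<longrightarrow>
    (\<forall>u v. d_form lam c x u v = \<i> * complex_of_real a1 * cmn c x u v + b1 * cml c x u v + cnj b1 * cnl c x u v)"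
    unfolding prod.case
  proof (intro ballI impI allI)
    fix d u v assume d: "d \<in> M" "x \<in> cdom d"
    show "d_form lam d x u v = \<i> * complex_of_real a' * cmn d x u v + b' * cml d x u v + cnj b' * cnl d x u v"
      unfolding d_form_transform[OF M lam d(1) c(1) d(2) c(2)] cwedge_transform[OF d(1) c(1) d(2) c(2)] by (rule eq)
  qed
next
  fix t :: "real \<times> complex"
  obtain a'' b'' where t: "t = (a'', b'')" by (cases t)
  assume "case t of (a1, b1) \<Rightarrow> \<forall>c\<in>M. x \<in> cdom c \<longrightarrow>
    (\<forall>u v. d_form lam c x u v = \<i> * complex_of_real a1 * cmn c x u v + b1 * cml c x u v + cnj b1 * cnl c x u v)"
  then have "d_form lam c x u v = \<i> * complex_of_real a'' * cmn c x u v + b'' * cml c x u v + cnj b'' * cnl c x u v" for u v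
    using c unfolding t by simp
  then have "\<i> * complex_of_real a'' * cmn c x u v + b'' * cml c x u v + cnj b'' * cnl c x u v =
    \<i> * complex_of_real a' * cmn c x u v + b' * cml c x u v + cnj b' * cnl c x u v" for u v
    using eq by metis
  from coframe_unique2'[OF c c c c this] show "t = (a', b')" by (simp add: t)
qed

lemma cnj_dlam:
  assumes c: "c \<in> M" "x \<in> cdom c"
  shows "cnj (d_form lam c x u v) = d_form lam c x u v"
proof -
  have "form_eq M (cnj_form lam) lam" unfolding form_eq_def cnj_form_def using cnj_lam by simp
  from d_form_cong[OF M c this] show ?thesis using d_form_cnj[OF M lam c] by simp
qed

text \<open>Reality of \<lambda> is what gives d\<lambda> the prescribed shape. Conjugation changes
  the sign of \<mu> \<and> \<mu>' and exchanges \<mu> \<and> \<lambda> with \<mu>' \<and> \<lambda>,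
  so the first coefficient is purely imaginary and the other two are conjugate.\<close>

lemma dlam_formula:
  assumes c: "c \<in> M" "x \<in> cdom c"
  shows "\<i> * a x = mixed (d_form lam c x) (lam c x) E1 E2 E3 / coframe_det (lam c x) (mu c x) (mub c x)" (is "_ = ?X")
    "b x = - mixed (d_form lam c x) (mub c x) E1 E2 E3 / coframe_det (lam c x) (mu c x) (mub c x)" (is "_ = ?Y")
    "cnj (b x) = mixed (d_form lam c x) (mu c x) E1 E2 E3 / coframe_det (lam c x) (mu c x) (mub c x)" (is "_ = ?Z")
proof -
  have e: "d_form lam c x u v = ?X * cmn c x u v + ?Y * cml c x u v + ?Z * cnl c x u v" for u v
    by (rule d_form_expand[OF lam c])
  obtain X Y Z where XYZ: "X = ?X" "Y = ?Y" "Z = ?Z" by blast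
  note e = e[folded XYZ]
  have "cnj (d_form lam c x u v) = - cnj X * cmn c x u v + cnj Z * cml c x u v + cnj Y * cnl c x u v" for u v
    unfolding e by (simp add: cnj_coframe_wedges[OF c])
  then have "X * cmn c x u v + Y * cml c x u v + Z * cnl c x u v =
    - cnj X * cmn c x u v + cnj Z * cml c x u v + cnj Y * cnl c x u v" for u v
    using cnj_dlam[OF c, of u v] e by metis
  from coframe_unique2'[OF c c c c this] have "X = - cnj X" and Z: "Z = cnj Y" by simp_all
  then have X: "X = \<i> * complex_of_real (Im X)" by (auto simp: complex_eq_iff)
  from dlam_coeffs_eqI[OF c, of "Im X" Y] e have "dlam_coeffs M lam mu x = (Im X, Y)"
    using X Z by metis
  then have "tw x = Im X" "b x = Y" by (simp_all add: twist_def coeff_b_def)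
  then show "\<i> * a x = ?X" "b x = ?Y" "cnj (b x) = ?Z" unfolding XYZ[symmetric] using X Z by simp_all
qed

lemma dlam:
  assumes c: "c \<in> M" "x \<in> cdom c"
  shows "d_form lam c x u v = \<i> * a x * cmn c x u v + b x * cml c x u v + cnj (b x) * cnl c x u v"
  using d_form_expand[OF lam c, of u v] unfolding dlam_formula[OF c, symmetric] .

lemma smooth_on_mixed:
  assumes "smooth_form M \<alpha>" "smooth_form M \<beta>" "c \<in> M"
  shows "smooth_on (cmap c ` cdom c) (\<lambda>y. mixed (d_form \<alpha> c (cinv c y)) (\<beta> c (cinv c y)) E1 E2 E3)"
    "smooth_on (cmap c ` cdom c) (\<lambda>y. - mixed (d_form \<alpha> c (cinv c y)) (\<beta> c (cinv c y)) E1 E2 E3)"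
  unfolding mixed_def
  by (intro smooth_intros open_cimage[OF M assms(3)] d_form_smooth_on[OF M assms(1,3)]
      smooth_form_smooth_on[OF assms(2,3)])+

lemma smooth_coeffs [smooth_intros]:
  shows "smooth_fun M p" "smooth_fun M q" "smooth_fun M b" "smooth_fun M tw" "smooth_fun M a"
proof -
  show "smooth_fun M p" by (rule smooth_fun_coframeI[OF smooth_on_mixed(1)[OF mu lam] dmu_formula(1)])
  show "smooth_fun M q" by (rule smooth_fun_coframeI[OF smooth_on_mixed(2)[OF mu mub] dmu_formula(2)])
  show "smooth_fun M b" by (rule smooth_fun_coframeI[OF smooth_on_mixed(2)[OF lam mub] dlam_formula(2)])
  \<comment> \<open>Cramer's rule delivers \<open>\<i> * a x\<close>; multiplying by
    \<open>- \<i>\<close> and taking the real part recovers the real function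
    \<open>tw\<close>.\<close>
  have "smooth_fun M (\<lambda>x. \<i> * a x)" by (rule smooth_fun_coframeI[OF smooth_on_mixed(1)[OF lam lam] dlam_formula(1)])
  from smooth_fun_linear(2)[OF M smooth_fun_mult[OF M smooth_fun_intros(1)[OF M, of "- \<i>"] this]]
  show tw: "smooth_fun M tw" by simp
  show "smooth_fun M a" by (rule smooth_fun_linear(3)[OF M tw])
qed

section \<open>Forms given by coframe coefficients and the integrability conditions\<close>

definition frame_form :: "('m \<Rightarrow> complex) \<Rightarrow> ('m \<Rightarrow> complex) \<Rightarrow> ('m \<Rightarrow> complex) \<Rightarrow> ('m, real^3) form1" where
  "frame_form f g h = add_form (scale_form f lam) (add_form (scale_form g mu) (scale_form h mub))"

lemma smooth_frame_form:
  "smooth_fun M f \<Longrightarrow> smooth_fun M g \<Longrightarrow> smooth_fun M h \<Longrightarrow> smooth_form M (frame_form f g h)"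
  unfolding frame_form_def by (intro smooth_form_add[OF M] smooth_form_scale[OF M] lam mu mub)

lemma d_frame_form:
  assumes f: "smooth_fun M f" and g: "smooth_fun M g" and h: "smooth_fun M h" and c: "c \<in> M" "x \<in> cdom c"
  shows "d_form (frame_form f g h) c x u v =
    (f x * (\<i> * a x) + g x * p x - h x * cnj (p x) + Dm h x - Dn g x) * cmn c x u v
    + (f x * b x + g x * q x + h x * cnj (s x) + Dm f x - Dl g x) * cml c x u v
    + (f x * cnj (b x) + g x * s x + h x * cnj (q x) + Dn f x - Dl h x) * cnl c x u v"
proof -
  have "d_form (frame_form f g h) c x u v =
    wedge (d_fun f) lam c x u v + f x * d_form lam c x u v
    + (wedge (d_fun g) mu c x u v + g x * d_form mu c x u v + (wedge (d_fun h) mub c x u v + h x * d_form mub c x u v))"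
    unfolding frame_form_def
    by (simp add: d_form_add[OF M _ _ c] d_form_scale[OF M _ _ c] smooth_form_add[OF M] smooth_form_scale[OF M] f g h lam mu mub)
  then show ?thesis
    unfolding dlam[OF c] dmu[OF c] dmub[OF c] wedge_def d_fun_frame[OF f c] d_fun_frame[OF g c] d_fun_frame[OF h c] cwedge_def
    by (simp add: algebra_simps)
qed

text \<open>The \<mu> \<and> \<mu>' component of d(du) = 0, where du is written as a frame form
  whose coefficients are the frame derivatives of \<open>u\<close>.\<close>

lemma commutator:
  assumes u: "smooth_fun M u" and x: "x \<in> points M"
  shows "\<i> * a x * Dl u x + p x * Dm u x - cnj (p x) * Dn u x + Dm (Dn u) x - Dn (Dm u) x = 0"
proof -
  obtain c where c: "c \<in> M" "x \<in> cdom c" using x by (rule in_pointsE)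
  have "form_eq M (frame_form (Dl u) (Dm u) (Dn u)) (d_fun u)"
    unfolding form_eq_def frame_form_def add_form_def scale_form_def using d_fun_frame[OF u] by simp
  from d_form_cong[OF M c this] d_form_d_fun[OF M u c]
  have "d_form (frame_form (Dl u) (Dm u) (Dn u)) c x v w = 0 * cmn c x v w + 0 * cml c x v w + 0 * cnl c x v w" for v w
    by simp
  note eq = this[unfolded d_frame_form[OF smooth_D[OF u] c]]
  from coframe_unique2'(1)[OF c c c c eq] show ?thesis by (simp add: algebra_simps)
qed

text \<open>In dimension three the 3-form d(d\<alpha>) has a single component. It is read off on the
  standard basis, where \<open>triple_frame\<close> and \<open>mixed_frame\<close> turn each term of
  the Leibniz rule into a multiple of the coframe determinant, which is then cancelled.\<close>

lemma d_d_frame: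
  assumes \<alpha>: "smooth_form M \<alpha>" and f: "smooth_fun M f" and g: "smooth_fun M g" and h: "smooth_fun M h"
    and c: "c \<in> M" "x \<in> cdom c"
    and eq: "\<And>y u v. y \<in> cdom c \<Longrightarrow> d_form \<alpha> c y u v = f y * cmn c y u v + g y * cml c y u v + h y * cnl c y u v"
  shows "Dl f x - f x * (q x + cnj (q x)) - Dn g x + g x * (p x - cnj (b x))
    + Dm h x + h x * (b x - cnj (p x)) = 0"
proof -
  let ?T = "coframe_det (lam c x) (mu c x) (mub c x)"
  let ?\<sigma> = "\<lambda>c p v w. f p * wedge mu mub c p v w + g p * wedge mu lam c p v w + h p * wedge mub lam c p v w"
  have "d_form2 ?\<sigma> c x E1 E2 E3 = 0"
  proof -
    have "d_form2 (d_form \<alpha>) c x E1 E2 E3 = d_form2 ?\<sigma> c x E1 E2 E3"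
      by (rule d_form2_cong[OF M c]) (simp add: wedge_cwedge eq)
    then show ?thesis using d_form2_d_form[OF M \<alpha> c] by simp
  qed
  note d = this[unfolded d_form2_sum[OF M f g h lam mu mub c]]
  note fr = triple_frame[where l = "lam c x" and m = "mu c x" and n = "mub c x" and u = E1 and v = E2 and w = E3]
  note mx = mixed_frame[where l = "lam c x" and m = "mu c x" and n = "mub c x" and u = E1 and v = E2 and w = E3]
  have "?T * (Dl f x - f x * (q x + cnj (q x)) - Dn g x + g x * (p x - cnj (b x))
    + Dm h x + h x * (b x - cnj (p x))) = 0"
    using d
    unfolding fr(1)[OF d_fun_frame[OF f c]] fr(2)[OF d_fun_frame[OF g c]] fr(3)[OF d_fun_frame[OF h c]]
      mx(3)[OF dmu[OF c]] mx(2)[OF dmub[OF c]] mx(1)[OF dmu[OF c]] mx(2)[OF dlam[OF c]] mx(1)[OF dmub[OF c]] mx(3)[OF dlam[OF c]]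
    by (simp add: algebra_simps)
  then show ?thesis using coframe_nonzero[OF c] by simp
qed

lemma d_d_lam:
  assumes x: "x \<in> points M"
  shows "\<i> * Dl a x - \<i> * a x * (q x + cnj (q x)) - Dn b x + b x * p x + cnj (Dn b x) - cnj (b x * p x) = 0"
proof -
  obtain c where c: "c \<in> M" "x \<in> cdom c" using x by (rule in_pointsE)
  have 1: "smooth_fun M (\<lambda>x. \<i> * a x)" "smooth_fun M (\<lambda>x. cnj (b x))"
    by (intro smooth_fun_mult[OF M] smooth_fun_intros(1)[OF M] smooth_fun_linear(1)[OF M] smooth_coeffs)+
  from d_d_frame[OF lam 1(1) smooth_coeffs(3) 1(2) c dlam[OF c(1)]] show ?thesis
    unfolding D_scale(1)[OF smooth_coeffs(5) x] D_cnj(2)[OF smooth_coeffs(3) x] by (simp add: algebra_simps)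
qed

lemma d_d_mu:
  assumes s0: "\<And>x. x \<in> points M \<Longrightarrow> s x = 0" and x: "x \<in> points M"
  shows "Dl p x - p x * cnj (q x) - Dn q x - q x * cnj (b x) = 0"
proof -
  obtain c where c: "c \<in> M" "x \<in> cdom c" using x by (rule in_pointsE)
  \<comment> \<open>The shear vanishes on the entire chart domain, so the third coefficient is the
    constant function 0 and contributes no derivative either.\<close>
  have "d_form mu c y u v = p y * cmn c y u v + q y * cml c y u v + 0 * cnl c y u v" if "y \<in> cdom c" for y u v
    using dmu[OF c(1) that] s0[OF in_pointsI[OF that c(1)]] by simp
  from d_d_frame[OF mu smooth_coeffs(1,2) smooth_fun_intros(1)[OF M] c this]
    D_scale(2)[OF smooth_coeffs(1) x, of 0]
  show ?thesis by (simp add: algebra_simps)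
qed

end

section \<open>The base part of the connection form and its exterior derivative\<close>

locale twisted_shearfree = congruence_structure +
  assumes twist_nonzero: "\<And>x. x \<in> points M \<Longrightarrow> tw x \<noteq> 0" and shearfree: "\<And>x. x \<in> points M \<Longrightarrow> s x = 0"
begin

abbreviation "loga \<equiv> \<lambda>x. complex_of_real (ln \<bar>tw x\<bar>)"

definition "A0 x = b x + cnj (p x) - Dm loga x"

lemma smooth_loga: "smooth_fun M loga"
  by (rule smooth_fun_linear(3)[OF M smooth_fun_ln_abs[OF M smooth_coeffs(4) twist_nonzero]])

lemma D_loga:
  assumes x: "x \<in> points M"
  shows "Dl loga x = Dl a x / a x" "Dm loga x = Dm a x / a x" "Dn loga x = cnj (Dm loga x)"
proof -
  obtain c where c: "c \<in> M" "x \<in> cdom c" using x by (rule in_pointsE)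
  have "d_fun loga c x v = Dl a x / a x * lam c x v + Dm a x / a x * mu c x v + Dn a x / a x * mub c x v" for v
    unfolding d_fun_ln_abs[OF M smooth_coeffs(4) twist_nonzero[OF x] c] d_fun_frame[OF smooth_coeffs(5) c]
    by (simp add: add_divide_distrib)
  from D_eqI[OF smooth_loga c this] show "Dl loga x = Dl a x / a x" "Dm loga x = Dm a x / a x" by blast+
  show "Dn loga x = cnj (Dm loga x)" using D_cnj(2)[OF smooth_loga x] by simp
qed

lemma smooth_A0: "smooth_fun M A0"
  unfolding A0_def
  by (intro smooth_fun_intros[OF M] smooth_coeffs smooth_fun_linear(1)[OF M] smooth_D smooth_loga)

definition "theta = frame_form (\<lambda>x. - q x) A0 (\<lambda>x. - p x)"

lemma smooth_theta: "smooth_form M theta"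
  unfolding theta_def by (intro smooth_frame_form smooth_fun_intros(4)[OF M] smooth_coeffs smooth_A0)

text \<open>
  The relations \<open>r1\<close>, \<open>r2\<close> and \<open>r3\<close> below are components of \<open>d\<^sup>2 log |a| = 0\<close>, \<open>d\<^sup>2\<lambda> = 0\<close> and \<open>d\<^sup>2\<mu> = 0\<close>.
  The first two make \<open>k\<^sub>1\<close> real; the third one kills the \<open>\<mu>' \<and> \<lambda>\<close> component.
\<close>

lemma d_theta:
  assumes c: "c \<in> M" "x \<in> cdom c"
  shows "d_form theta c x u v = complex_of_real (k1 M lam mu x) * cmn c x u v + k2 M lam mu x / a x * cml c x u v"
proof -
  have x: "x \<in> points M" by (rule in_pointsI[OF c(2,1)])
  have a0: "a x \<noteq> 0" using twist_nonzero[OF x] by simp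
  have ca: "cnj (a x) = a x" by simp
  define L where "L = Dm loga x"
  define LL where "LL = Dn (Dm loga) x"
  define LLl where "LLl = Dl (Dm loga) x"
  have smc: "smooth_fun M (\<lambda>x. cnj (p x))" "smooth_fun M (\<lambda>x. cnj (q x))" "smooth_fun M (\<lambda>x. cnj (b x))"
    by (intro smooth_fun_linear(1)[OF M] smooth_coeffs)+
  have smL: "smooth_fun M (Dm loga)" by (rule smooth_D(2)[OF smooth_loga])
  have sbp: "smooth_fun M (\<lambda>x. b x + cnj (p x))" by (rule smooth_fun_intros(2)[OF M smooth_coeffs(3) smc(1)])
  have A0': "A0 = (\<lambda>x. (b x + cnj (p x)) - Dm loga x)" by (simp add: A0_def fun_eq_iff)
  have DnA0: "Dn A0 x = Dn b x + cnj (Dm p x) - LL"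
    unfolding A0' D_diff(3)[OF sbp smL x] D_add(3)[OF smooth_coeffs(3) smc(1) x] D_cnj(3)[OF smooth_coeffs(1) x] LL_def ..
  have DlA0: "Dl A0 x = Dl b x + cnj (Dl p x) - LLl"
    unfolding A0' D_diff(1)[OF sbp smL x] D_add(1)[OF smooth_coeffs(3) smc(1) x] D_cnj(1)[OF smooth_coeffs(1) x] LLl_def ..
  have DmDn: "Dm (Dn loga) x = cnj LL"
    using D_cong(2)[OF smooth_D(3)[OF smooth_loga] D_loga(3) x] D_cnj(2)[OF smL x] by (simp add: LL_def)
  have aL: "Dl a x = a x * Dl loga x" "Dm a x = a x * L" using D_loga[OF x] a0 by (simp_all add: L_def)
  have DlDm: "Dl (Dm a) x = a x * LLl + Dl a x * L"
  proof -
    have "Dl (Dm a) x = Dl (\<lambda>x. a x * Dm loga x) x"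
      by (rule D_cong(1)[OF smooth_D(2)[OF smooth_coeffs(5)] _ x]) (use D_loga(2) twist_nonzero in simp)
    then show ?thesis using D_mult(1)[OF smooth_coeffs(5) smL x] by (simp add: LLl_def L_def)
  qed
  have Dmaq: "Dm (\<lambda>y. a y * cnj (q y)) x = a x * cnj (Dn q x) + a x * L * cnj (q x)"
    using D_mult(2)[OF smooth_coeffs(5) smc(2) x] D_cnj(2)[OF smooth_coeffs(2) x] aL by simp
  have r1: "\<i> * Dl a x = LL - L * p x - cnj (LL - L * p x)"
    using commutator[OF smooth_loga x] aL unfolding DmDn D_loga(3)[OF x] L_def[symmetric] LL_def[symmetric]
    by (simp add: algebra_simps)
  have r2: "\<i> * Dl a x - \<i> * a x * (q x + cnj (q x)) = Dn b x - b x * p x - cnj (Dn b x - b x * p x)"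
    using d_d_lam[OF x] by (simp add: algebra_simps)
  have r3: "Dl p x = p x * cnj (q x) + Dn q x + q x * cnj (b x)"
    using d_d_mu[OF shearfree x] by (simp add: algebra_simps)
  define X where "X = - q x * (\<i> * a x) + A0 x * p x + p x * cnj (p x) - Dm p x - Dn A0 x"
  define Y where "Y = - q x * b x + A0 x * q x - Dm q x - Dl A0 x"
  have dth: "d_form theta c x u v = X * cmn c x u v + Y * cml c x u v"
  proof -
    have "- q x * cnj (b x) + - p x * cnj (q x) + - Dn q x - - Dl p x = 0" using r3 by simp
    then show ?thesis
      unfolding theta_def d_frame_form[OF smooth_fun_intros(4)[OF M smooth_coeffs(2)] smooth_A0 smooth_fun_intros(4)[OF M smooth_coeffs(1)] c]
        D_minus[OF smooth_coeffs(2) x] D_minus[OF smooth_coeffs(1) x] shearfree[OF x] X_def Y_def by simp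
  qed
  have k1: "k1 M lam mu x = Re (LL - L * p x - \<i> * q x * a x - Dn b x + b x * p x - 2 * cnj (Dm p x) + 2 * (p x * cnj (p x)))"
    unfolding k1_def Let_def D_cnj(3)[OF smooth_coeffs(1) x] L_def LL_def complex_norm_square ..
  have X: "X = LL - L * p x - \<i> * q x * a x - Dn b x + b x * p x + 2 * (p x * cnj (p x)) - cnj (Dm p x) - Dm p x"
    unfolding X_def DnA0 A0_def L_def[symmetric] by (simp add: algebra_simps)
  \<comment> \<open>Both \<open>r1\<close> and \<open>r2\<close> evaluate the \<lambda>-derivative
    of a; eliminating it between them gives exactly the equality of \<open>X\<close> and its
    conjugate.\<close>
  have "X - cnj X = 0"
  proof -
    have "X - cnj X = (LL - L * p x - cnj (LL - L * p x)) - (Dn b x - b x * p x - cnj (Dn b x - b x * p x))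
      - \<i> * a x * (q x + cnj (q x))" unfolding X by (simp add: algebra_simps)
    then show ?thesis unfolding r1[symmetric] r2[symmetric] by simp
  qed
  then have "complex_of_real (Re X) = X" by (simp add: complex_eq_iff)
  \<comment> \<open>\<open>X\<close> contains the sum of \<open>Dm p x\<close> and its conjugate
    where \<open>k1\<close> has twice the conjugate; the real parts agree.\<close>
  moreover have "Re X = k1 M lam mu x" unfolding k1 X by simp
  ultimately have X': "complex_of_real (k1 M lam mu x) = X" by simp
  have "k2 M lam mu x = Dl (Dm a) x - a x * Dl b x
      + \<i> * L * (Dn b x - cnj (Dn b x) - b x * p x + cnj (b x) * cnj (p x))
      - 2 * Dm a x * q x - a x * Dm q x - Dm (\<lambda>y. a y * cnj (q y)) x - a x * b x * cnj (q x)"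
    unfolding k2_def Let_def D_cnj(2)[OF smooth_coeffs(3) x] L_def ..
  \<comment> \<open>The bracket in \<open>k2\<close> is the right-hand side of \<open>r2\<close>.
    Replacing it by the \<lambda>-derivative of a and by q cancels the product of first derivatives
    of a coming from \<open>DlDm\<close> and leaves a multiple of a.\<close>
  also have "\<i> * L * (Dn b x - cnj (Dn b x) - b x * p x + cnj (b x) * cnj (p x)) =
      L * (\<i> * (Dn b x - b x * p x - cnj (Dn b x - b x * p x)))" by (simp add: algebra_simps)
  also have "\<dots> = L * (- Dl a x + a x * (q x + cnj (q x)))"
    unfolding r2[symmetric] by (simp add: algebra_simps)
  finally have "k2 M lam mu x = a x * Y"
    unfolding DlDm Dmaq Y_def DlA0 r3 A0_def aL(2) L_def[symmetric] by (simp add: algebra_simps)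
  then have "k2 M lam mu x / a x = Y" using a0 by simp
  then show ?thesis using dth X' by simp
qed

lemma smooth_k1: "smooth_fun M (k1 M lam mu)"
proof -
  have "smooth_fun M (\<lambda>x. Re (Dn (Dm loga) x - Dm loga x * p x - \<i> * q x * a x - Dn b x + b x * p x
    - 2 * Dn (\<lambda>y. cnj (p y)) x + 2 * (p x * cnj (p x))))"
    by (intro smooth_fun_linear(2)[OF M] smooth_fun_intros[OF M] smooth_fun_mult[OF M] smooth_D
        smooth_fun_linear(1)[OF M] smooth_coeffs smooth_loga)
  then show ?thesis
    by (rule smooth_fun_cong[OF M]) (simp only: k1_def Let_def complex_norm_square)
qed

lemma smooth_k2: "smooth_fun M (k2 M lam mu)"
proof -
  have "smooth_fun M (\<lambda>x. Dl (Dm a) x - a x * Dl b x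
        + \<i> * Dm loga x * (Dn b x - Dm (\<lambda>y. cnj (b y)) x - b x * p x + cnj (b x) * cnj (p x))
        - 2 * Dm a x * q x - a x * Dm q x - Dm (\<lambda>y. a y * cnj (q y)) x
        - a x * b x * cnj (q x))"
    by (intro smooth_fun_intros[OF M] smooth_fun_mult[OF M] smooth_D smooth_fun_linear(1)[OF M] smooth_coeffs smooth_loga)
  then show ?thesis
    by (rule smooth_fun_cong[OF M]) (simp only: k2_def Let_def)
qed

end

section \<open>The bundle\<close>

lemma tmap_cong:
  assumes A: "smooth_manifold A" and c: "c \<in> A" "p \<in> cdom c" and eq: "\<And>q. q \<in> points A \<Longrightarrow> \<phi> q = \<psi> q"
  shows "tmap \<phi> c d p v = tmap \<psi> c d p v"
proof -
  have "frechet_derivative (cmap d \<circ> \<phi> \<circ> cinv c) (at (cmap c p)) = frechet_derivative (cmap d \<circ> \<psi> \<circ> cinv c) (at (cmap c p))"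
    by (rule frechet_derivative_cong_open[OF open_cimage[OF A c(1)]])
      (simp_all add: c(2) eq in_pointsI[OF cinv_in_cdom c(1)])
  then show ?thesis by (simp add: tmap_def)
qed

section \<open>Vectors and forms on the total space\<close>

locale cstar_fibration = congruence_structure M lam mu
  for M :: "('m::{t2_space, second_countable_topology}, real^3) atlas" and lam mu +
  fixes P :: "('p::{t2_space, second_countable_topology}, 'f::euclidean_space) atlas" and pr :: "'p \<Rightarrow> 'm" and h
  assumes P: "smooth_manifold P" and F: "diffeo P (prod_manifold M cstar) (\<lambda>y. (pr y, h y))"
begin

lemma MC: "smooth_manifold (prod_manifold M cstar)"
  by (rule smooth_manifold_prod[OF M smooth_manifold_cstar])

lemma pr_map: "smooth_map P M pr" and h_map: "smooth_map P cstar h"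
proof -
  have sF: "smooth_map P (prod_manifold M cstar) (\<lambda>y. (pr y, h y))" using F unfolding diffeo_def by blast
  show "smooth_map P M pr"
    using smooth_map_compose[OF P MC M sF smooth_map_fst[OF M smooth_manifold_cstar]] by simp
  show "smooth_map P cstar h"
    using smooth_map_compose[OF P MC smooth_manifold_cstar sF smooth_map_snd[OF M smooth_manifold_cstar]] by simp
qed

lemma h_fun: "smooth_fun P h" and h_nonzero: "y \<in> points P \<Longrightarrow> h y \<noteq> 0"
  using h_map smooth_map_cstar[OF P] by blast+

lemma pr_points: "y \<in> points P \<Longrightarrow> pr y \<in> points M"
  by (rule smooth_map_in_points[OF pr_map])

text \<open>The tangent map of the inverse trivialisation \<open>G\<close> sends the pair
  (\<open>w\<close>, \<open>z\<close>) to the required vector: \<open>pr\<close> after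
  \<open>G\<close> is the first projection, and \<open>h\<close> after \<open>G\<close> is the
  second.\<close>

lemma lift_vector:
  assumes c: "c \<in> P" "y \<in> cdom c" and d: "d \<in> M" "pr y \<in> cdom d"
  obtains u where "tmap pr c d y u = w" "d_fun h c y u = z"
proof -
  let ?e = "cprod d (- {0}, id :: complex \<Rightarrow> complex)"
  have y: "y \<in> points P" by (rule in_pointsI[OF c(2,1)])
  have C: "(- {0}, id :: complex \<Rightarrow> complex) \<in> cstar" by (simp add: cstar_def)
  have e: "?e \<in> prod_manifold M cstar" by (rule in_prod_manifold[OF d(1) C])
  have ye: "(pr y, h y) \<in> cdom ?e" using d(2) h_nonzero[OF y] by simp
  obtain G where "smooth_map P (prod_manifold M cstar) (\<lambda>y. (pr y, h y))" and
    G: "smooth_map (prod_manifold M cstar) P G" "\<And>y. y \<in> points P \<Longrightarrow> G (pr y, h y) = y"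
    and FG: "\<And>q. q \<in> points (prod_manifold M cstar) \<Longrightarrow> (pr (G q), h (G q)) = q"
    by (rule diffeoE[OF F]) (rule that; assumption)
  have Gc: "G (pr y, h y) \<in> cdom c" using G(2)[OF y] c(2) by simp
  have d': "pr (G (pr y, h y)) \<in> cdom d" using G(2)[OF y] d(2) by simp
  let ?u = "tmap G ?e c (pr y, h y) (w, z)"
  have op: "open (cmap ?e ` cdom ?e)" "cmap ?e (pr y, h y) \<in> cmap ?e ` cdom ?e"
    using open_cimage[OF MC e] ye by blast+
  have ci: "cinv ?e v = (cinv d (fst v), snd v)" if "v \<in> cmap ?e ` cdom ?e" for v
  proof -
    have v: "v \<in> cmap d ` cdom d \<times> - {0}" using that by (simp add: map_prod_image)
    then show ?thesis
      using cinv_cprod[OF M smooth_manifold_cstar d(1) C, of v] cinv_cstar[of "snd v"] by (auto simp: mem_Times_iff)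
  qed
  have "tmap pr c d y ?u = tmap (\<lambda>q. pr (G q)) ?e d (pr y, h y) (w, z)"
    using tmap_compose[OF MC P M G(1) pr_map e c(1) d(1) ye Gc d'] G(2)[OF y] by simp
  also have "\<dots> = tmap fst ?e d (pr y, h y) (w, z)"
    by (rule tmap_cong[OF MC e ye]) (use FG in \<open>metis fst_conv\<close>)
  also have "\<dots> = w"
  proof -
    have "((cmap d \<circ> fst \<circ> cinv ?e) has_derivative fst) (at (cmap ?e (pr y, h y)))"
    proof (rule has_derivative_transform_within_open[OF _ op])
      show "(fst has_derivative fst) (at (cmap ?e (pr y, h y)))"
        by (rule bounded_linear_imp_has_derivative[OF bounded_linear_fst])
      fix v assume v: "v \<in> cmap ?e ` cdom ?e"
      then have "fst v \<in> cmap d ` cdom d" by (auto simp: map_prod_image)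
      then show "fst v = (cmap d \<circ> fst \<circ> cinv ?e) v" using ci[OF v] by (simp add: cmap_cinv)
    qed
    then show ?thesis by (simp add: tmap_def frechet_derivative_eqI)
  qed
  finally have 1: "tmap pr c d y ?u = w" .
  have "d_fun h c y ?u = d_fun (\<lambda>q. h (G q)) ?e (pr y, h y) (w, z)"
    using d_fun_compose[OF MC P G(1) h_fun e c(1) ye Gc] G(2)[OF y] by simp
  also have "\<dots> = d_fun snd ?e (pr y, h y) (w, z)"
    by (rule d_fun_cong[OF MC e ye]) (use FG in \<open>metis snd_conv\<close>)
  also have "\<dots> = z"
  proof -
    have "((\<lambda>v. snd (cinv ?e v)) has_derivative snd) (at (cmap ?e (pr y, h y)))"
      by (rule has_derivative_transform_within_open[OF bounded_linear_imp_has_derivative[OF bounded_linear_snd] op])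
        (subst ci; simp)
    from d_fun_eqI[OF this] show ?thesis by simp
  qed
  finally show ?thesis using that 1 by blast
qed

text \<open>The prescribed value of dh may depend on the projected vector, so that it can compensate
  for the part of \<Omega> that comes from the base.\<close>

lemma lift_coframe:
  assumes c: "c \<in> P" "y \<in> cdom c" and d: "d \<in> M" "pr y \<in> cdom d"
  obtains u where "lam d (pr y) (tmap pr c d y u) = complex_of_real r" "mu d (pr y) (tmap pr c d y u) = z"
    "d_fun h c y u = w (tmap pr c d y u)"
proof -
  obtain v where v: "lam d (pr y) v = complex_of_real r" "mu d (pr y) v = z"
    using coframe_surj'[OF d d d d, of r z] lam_real[OF d] by (auto simp: cnj_form_def)
  obtain u where "tmap pr c d y u = v" "d_fun h c y u = w v" by (rule lift_vector[OF c d])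
  then show ?thesis using that v by metis
qed

text \<open>Lifts of the basis dual to \<lambda>, Re \<mu>, Im \<mu>. Two of them are annihilated by
  \<lambda>, with \<mu> equal to 1 and to the imaginary unit; together they separate a multiple of
  \<mu> from its conjugate.\<close>

lemma adapted_vectors:
  assumes c: "c \<in> P" "y \<in> cdom c" and d: "d \<in> M" "pr y \<in> cdom d"
  obtains u v w where "lam d (pr y) (tmap pr c d y u) = 1" "mu d (pr y) (tmap pr c d y u) = 0"
    "lam d (pr y) (tmap pr c d y v) = 0" "mu d (pr y) (tmap pr c d y v) = 1"
    "lam d (pr y) (tmap pr c d y w) = 0" "mu d (pr y) (tmap pr c d y w) = \<i>"
proof -
  have *: "\<exists>u. lam d (pr y) (tmap pr c d y u) = complex_of_real r \<and> mu d (pr y) (tmap pr c d y u) = z" for r z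
    by (rule lift_coframe[OF c d, of r z "\<lambda>_. 0"]) blast
  from *[of 1 0] *[of 0 1] *[of 0 \<i>] show ?thesis using that by auto
qed

lemma base_chart:
  assumes "c \<in> P" "y \<in> cdom c"
  obtains d where "d \<in> M" "pr y \<in> cdom d"
  using pr_points[OF in_pointsI[OF assms(2,1)]] by (rule in_pointsE)

lemma pullback_coframe:
  assumes c: "c \<in> P" "y \<in> cdom c" and d: "d \<in> M" "pr y \<in> cdom d"
  shows "pullback M pr lam c y u = lam d (pr y) (tmap pr c d y u)"
    "pullback M pr mu c y u = mu d (pr y) (tmap pr c d y u)"
  using pullback_eq[OF P M pr_map lam c(1) d(1) c(2) d(2)] pullback_eq[OF P M pr_map mu c(1) d(1) c(2) d(2)] by blast+

lemma smooth_pullbacks: "smooth_form P (pullback M pr lam)" "smooth_form P (pullback M pr mu)"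
  by (rule smooth_form_pullback[OF P M pr_map lam] smooth_form_pullback[OF P M pr_map mu])+

lemma d_form_scaled_lam:
  assumes c: "c \<in> P" "y \<in> cdom c" and d: "d \<in> M" "pr y \<in> cdom d" and f: "smooth_fun P f"
  shows "d_form (scale_form f (pullback M pr lam)) c y u v =
    cwedge (d_fun f c y) (\<lambda>u. lam d (pr y) (tmap pr c d y u)) u v
    + f y * (\<i> * a (pr y) * cmn d (pr y) (tmap pr c d y u) (tmap pr c d y v)
      + b (pr y) * cml d (pr y) (tmap pr c d y u) (tmap pr c d y v)
      + cnj (b (pr y)) * cnl d (pr y) (tmap pr c d y u) (tmap pr c d y v))"
  unfolding d_form_scale[OF P f smooth_pullbacks(1) c] d_form_pullback[OF P M pr_map lam c(1) d(1) c(2) d(2)] dlam[OF d]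
  by (simp add: wedge_def cwedge_def pullback_coframe[OF c d])

lemma d_form_scaled_mu:
  assumes c: "c \<in> P" "y \<in> cdom c" and d: "d \<in> M" "pr y \<in> cdom d" and f: "smooth_fun P f"
  shows "d_form (scale_form f (pullback M pr mu)) c y u v =
    cwedge (d_fun f c y) (\<lambda>u. mu d (pr y) (tmap pr c d y u)) u v
    + f y * (p (pr y) * cmn d (pr y) (tmap pr c d y u) (tmap pr c d y v)
      + q (pr y) * cml d (pr y) (tmap pr c d y u) (tmap pr c d y v)
      + s (pr y) * cnl d (pr y) (tmap pr c d y u) (tmap pr c d y v))"
  unfolding d_form_scale[OF P f smooth_pullbacks(2) c] d_form_pullback[OF P M pr_map mu c(1) d(1) c(2) d(2)] dmu[OF d]
  by (simp add: wedge_def cwedge_def pullback_coframe[OF c d])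

text \<open>Rewrites the system at one point in terms of the base coframe on projected vectors.
  Evaluated on adapted vectors, the equations between forms then become scalar equations.\<close>

lemma invariant_systemD:
  assumes sys: "invariant_system M lam mu P pr h f \<omega> \<omega>\<^sub>1 \<Omega> K\<^sub>1 K\<^sub>2"
    and c: "c \<in> P" "y \<in> cdom c" and d: "d \<in> M" "pr y \<in> cdom d"
  shows "\<omega> c y u = complex_of_real (f y) * lam d (pr y) (tmap pr c d y u)"
    "\<omega>\<^sub>1 c y u = h y * mu d (pr y) (tmap pr c d y u)"
    "cwedge (d_fun h c y) (\<lambda>u. mu d (pr y) (tmap pr c d y u)) u v
      + h y * (p (pr y) * cmn d (pr y) (tmap pr c d y u) (tmap pr c d y v)
      + q (pr y) * cml d (pr y) (tmap pr c d y u) (tmap pr c d y v)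
      + s (pr y) * cnl d (pr y) (tmap pr c d y u) (tmap pr c d y v)) =
      h y * cwedge (\<Omega> c y) (\<lambda>u. mu d (pr y) (tmap pr c d y u)) u v"
    "cwedge (d_fun (\<lambda>y. complex_of_real (f y)) c y) (\<lambda>u. lam d (pr y) (tmap pr c d y u)) u v
      + f y * (\<i> * a (pr y) * cmn d (pr y) (tmap pr c d y u) (tmap pr c d y v)
      + b (pr y) * cml d (pr y) (tmap pr c d y u) (tmap pr c d y v)
      + cnj (b (pr y)) * cnl d (pr y) (tmap pr c d y u) (tmap pr c d y v)) =
      \<i> * (h y * cnj (h y)) * cmn d (pr y) (tmap pr c d y u) (tmap pr c d y v)
      + f y * cwedge (\<lambda>u. \<Omega> c y u + cnj (\<Omega> c y u)) (\<lambda>u. lam d (pr y) (tmap pr c d y u)) u v"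
    "d_form \<Omega> c y u v = K\<^sub>1 y * (h y * cnj (h y)) * cmn d (pr y) (tmap pr c d y u) (tmap pr c d y v)
      + K\<^sub>2 y * (h y * f y) * cml d (pr y) (tmap pr c d y u) (tmap pr c d y v)"
proof -
  note S = sys[unfolded invariant_system_def]
  have eqs: "form_eq P \<omega> (scale_form (\<lambda>y. complex_of_real (f y)) (pullback M pr lam))"
    "form_eq P \<omega>\<^sub>1 (scale_form h (pullback M pr mu))" using S by blast+
  have fs: "smooth_fun P (\<lambda>y. complex_of_real (f y))" using S smooth_fun_linear(3)[OF P] by blast
  have dd: "d_form \<omega> c y u v = \<i> * wedge \<omega>\<^sub>1 (cnj_form \<omega>\<^sub>1) c y u v + wedge (add_form \<Omega> (cnj_form \<Omega>)) \<omega> c y u v"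
    "d_form \<omega>\<^sub>1 c y u v = wedge \<Omega> \<omega>\<^sub>1 c y u v"
    "d_form \<Omega> c y u v = complex_of_real (K\<^sub>1 y) * wedge \<omega>\<^sub>1 (cnj_form \<omega>\<^sub>1) c y u v + K\<^sub>2 y * wedge \<omega>\<^sub>1 \<omega> c y u v" for u v
    using S c by blast+
  show 1: "\<omega> c y u = complex_of_real (f y) * lam d (pr y) (tmap pr c d y u)" for u
    using form_eqD[OF eqs(1) c] pullback_coframe[OF c d] by (simp add: scale_form_def)
  show 2: "\<omega>\<^sub>1 c y u = h y * mu d (pr y) (tmap pr c d y u)" for u
    using form_eqD[OF eqs(2) c] pullback_coframe[OF c d] by (simp add: scale_form_def)
  note vals = wedge_def cwedge_def cnj_form_def add_form_def 1 2
  show "cwedge (d_fun h c y) (\<lambda>u. mu d (pr y) (tmap pr c d y u)) u v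
      + h y * (p (pr y) * cmn d (pr y) (tmap pr c d y u) (tmap pr c d y v)
      + q (pr y) * cml d (pr y) (tmap pr c d y u) (tmap pr c d y v)
      + s (pr y) * cnl d (pr y) (tmap pr c d y u) (tmap pr c d y v)) =
      h y * cwedge (\<Omega> c y) (\<lambda>u. mu d (pr y) (tmap pr c d y u)) u v"
    unfolding d_form_scaled_mu[OF c d h_fun, symmetric] d_form_cong[OF P c eqs(2), symmetric] dd(2)
    by (simp add: vals algebra_simps)
  show "cwedge (d_fun (\<lambda>y. complex_of_real (f y)) c y) (\<lambda>u. lam d (pr y) (tmap pr c d y u)) u v
      + f y * (\<i> * a (pr y) * cmn d (pr y) (tmap pr c d y u) (tmap pr c d y v)
      + b (pr y) * cml d (pr y) (tmap pr c d y u) (tmap pr c d y v)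
      + cnj (b (pr y)) * cnl d (pr y) (tmap pr c d y u) (tmap pr c d y v)) =
      \<i> * (h y * cnj (h y)) * cmn d (pr y) (tmap pr c d y u) (tmap pr c d y v)
      + f y * cwedge (\<lambda>u. \<Omega> c y u + cnj (\<Omega> c y u)) (\<lambda>u. lam d (pr y) (tmap pr c d y u)) u v"
    unfolding d_form_scaled_lam[OF c d fs, symmetric] d_form_cong[OF P c eqs(1), symmetric] dd(1)
    by (simp add: vals algebra_simps)
  show "d_form \<Omega> c y u v = K\<^sub>1 y * (h y * cnj (h y)) * cmn d (pr y) (tmap pr c d y u) (tmap pr c d y v)
      + K\<^sub>2 y * (h y * f y) * cml d (pr y) (tmap pr c d y u) (tmap pr c d y v)"
    unfolding dd(3) by (simp add: vals algebra_simps)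
qed

text \<open>On two vectors annihilated by \<lambda> every term of the equation for d\<omega>
  containing \<lambda> drops out, and only the \<mu> \<and> \<mu>' coefficients remain. The locale
  makes no assumption on the twist, since this identity later shows that the twist of another
  representative is nonzero.\<close>

lemma system_scale:
  assumes sys: "invariant_system M lam mu P pr h f \<omega> \<omega>\<^sub>1 \<Omega> K\<^sub>1 K\<^sub>2" and y: "y \<in> points P"
  shows "f y * tw (pr y) = (cmod (h y))\<^sup>2"
proof -
  obtain c where c: "c \<in> P" "y \<in> cdom c" using y by (rule in_pointsE)
  obtain d where d: "d \<in> M" "pr y \<in> cdom d" by (rule base_chart[OF c])
  obtain w u v where u: "lam d (pr y) (tmap pr c d y u) = 0" "mu d (pr y) (tmap pr c d y u) = 1"
    and v: "lam d (pr y) (tmap pr c d y v) = 0" "mu d (pr y) (tmap pr c d y v) = \<i>"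
    by (rule adapted_vectors[OF c d])
  have "complex_of_real (f y) * a (pr y) = h y * cnj (h y)"
    using invariant_systemD(4)[OF sys c d, of u v] by (simp add: cwedge_def u v cnj_form_def)
  then have "complex_of_real (f y * tw (pr y)) = complex_of_real ((cmod (h y))\<^sup>2)"
    by (simp only: complex_norm_square of_real_mult)
  then show ?thesis unfolding of_real_eq_iff .
qed

text \<open>The equation for \<open>d\<omega>\<^sub>1\<close> is tested on a vector with \<mu> = 0
  against those with \<mu> = 1 and \<mu> = i. Passing from 1 to i multiplies the q and \<Omega>
  terms by i but the shear term by -i, so comparing the two isolates the shear.\<close>

lemma system_shearfree:
  assumes sys: "invariant_system M lam mu P pr h f \<omega> \<omega>\<^sub>1 \<Omega> K\<^sub>1 K\<^sub>2" and y: "y \<in> points P"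
  shows "s (pr y) = 0"
proof -
  obtain c where c: "c \<in> P" "y \<in> cdom c" using y by (rule in_pointsE)
  obtain d where d: "d \<in> M" "pr y \<in> cdom d" by (rule base_chart[OF c])
  obtain u v w where u: "lam d (pr y) (tmap pr c d y u) = 1" "mu d (pr y) (tmap pr c d y u) = 0"
    and v: "lam d (pr y) (tmap pr c d y v) = 0" "mu d (pr y) (tmap pr c d y v) = 1"
    and w: "lam d (pr y) (tmap pr c d y w) = 0" "mu d (pr y) (tmap pr c d y w) = \<i>"
    by (rule adapted_vectors[OF c d])
  have 1: "d_fun h c y u + h y * (- q (pr y) - s (pr y)) = h y * \<Omega> c y u"
    using invariant_systemD(3)[OF sys c d, of u v] by (simp add: cwedge_def u v cnj_form_def)
  have "d_fun h c y u * \<i> + h y * (- q (pr y) * \<i> + s (pr y) * \<i>) = h y * \<Omega> c y u * \<i>"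
    using invariant_systemD(3)[OF sys c d, of u w] by (simp add: cwedge_def u w cnj_form_def algebra_simps)
  then have "h y * s (pr y) * 2 = 0" unfolding 1[symmetric] by (simp add: algebra_simps)
  then show ?thesis using h_nonzero[OF y] by simp
qed

end

lemma cis_minus_Arg: "cis (- Arg z) = cnj z / cmod z" if "z \<noteq> 0"
proof -
  have "cnj (cis (Arg z)) = cnj (sgn z)" using cis_Arg[OF that] by simp
  then show ?thesis by (simp add: cis_cnj sgn_eq)
qed

section \<open>The standard solution and its uniqueness\<close>

locale twisted_fibration = cstar_fibration M lam mu P pr h + twisted_shearfree M lam mu
  for M :: "('m::{t2_space, second_countable_topology}, real^3) atlas" and lam mu
    and P :: "('p::{t2_space, second_countable_topology}, 'f::euclidean_space) atlas" and pr h
begin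

definition "f0 y = (cmod (h y))\<^sup>2 / tw (pr y)"
definition "omega0 = scale_form (\<lambda>y. complex_of_real (f0 y)) (pullback M pr lam)"
definition "omega1 = scale_form h (pullback M pr mu)"
definition "Omega0 = add_form (scale_form (\<lambda>y. 1 / h y) (d_fun h)) (pullback M pr theta)"
definition "K10 y = k1 M lam mu (pr y) / (cmod (h y))\<^sup>2"
definition "K20 y = complex_of_real (1 / (cmod (h y)) ^ 3) * cis (- Arg (h y)) * k2 M lam mu (pr y)"

lemma of_real_f0: "complex_of_real (f0 y) = h y * cnj (h y) / a (pr y)"
  unfolding f0_def of_real_divide complex_norm_square ..

lemma tw_pr: "y \<in> points P \<Longrightarrow> tw (pr y) \<noteq> 0"
  using twist_nonzero pr_points by blast

lemma f0_nonzero: "y \<in> points P \<Longrightarrow> f0 y \<noteq> 0"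
  using tw_pr h_nonzero by (simp add: f0_def)

lemma smooth_cmod_h: "smooth_fun P (\<lambda>y. (cmod (h y))\<^sup>2)"
proof -
  have "smooth_fun P (\<lambda>y. Re (h y * cnj (h y)))"
    by (intro smooth_fun_linear[OF P] smooth_fun_mult[OF P] h_fun)
  then show ?thesis by (rule smooth_fun_cong[OF P]) (simp add: complex_mult_cnj cmod_power2)
qed

lemma smooth_f0: "smooth_fun P f0"
proof -
  have "smooth_fun P (\<lambda>y. (cmod (h y))\<^sup>2 / tw (pr y))"
    using tw_pr by (intro smooth_fun_divide[OF P] smooth_cmod_h smooth_fun_compose[OF P M pr_map smooth_coeffs(4)])
  then show ?thesis by (simp add: f0_def[abs_def])
qed

lemma smooth_K10: "smooth_fun P K10"
proof -
  have "smooth_fun P (\<lambda>y. k1 M lam mu (pr y) / (cmod (h y))\<^sup>2)"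
    using h_nonzero by (intro smooth_fun_divide[OF P] smooth_cmod_h smooth_fun_compose[OF P M pr_map smooth_k1]) simp
  then show ?thesis by (simp add: K10_def[abs_def])
qed

text \<open>\<open>Arg\<close> jumps across the negative real axis, so the smoothness of the polar
  expression is seen from this rational form in \<open>h\<close> and its conjugate.\<close>

lemma K20_eq:
  assumes "y \<in> points P"
  shows "K20 y = k2 M lam mu (pr y) / (h y * (h y * cnj (h y)))"
proof -
  have "complex_of_real (1 / (cmod (h y)) ^ 3) * cis (- Arg (h y)) = cnj (h y) / (complex_of_real ((cmod (h y))\<^sup>2))\<^sup>2"
    using cis_minus_Arg[OF h_nonzero[OF assms]] by (simp add: power2_eq_square power3_eq_cube)
  also have "\<dots> = 1 / (h y * (h y * cnj (h y)))"
    unfolding complex_norm_square using h_nonzero[OF assms] by (simp add: power2_eq_square field_simps)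
  finally show ?thesis unfolding K20_def by simp
qed

lemma smooth_K20: "smooth_fun P K20"
proof -
  have "smooth_fun P (\<lambda>y. k2 M lam mu (pr y) / (h y * (h y * cnj (h y))))"
    using h_nonzero by (intro smooth_fun_divide[OF P] smooth_fun_mult[OF P] smooth_fun_linear[OF P] h_fun
        smooth_fun_compose[OF P M pr_map smooth_k2]) simp
  then show ?thesis by (rule smooth_fun_cong[OF P]) (simp add: K20_eq)
qed

lemma smooth_inverse_h: "smooth_fun P (\<lambda>y. 1 / h y)"
  using h_nonzero by (intro smooth_fun_divide[OF P] smooth_fun_intros(1)[OF P] h_fun)

lemma smooth_forms0: "smooth_form P omega0" "smooth_form P omega1" "smooth_form P Omega0"
  unfolding omega0_def omega1_def Omega0_def
  by (intro smooth_form_scale[OF P] smooth_form_add[OF P] smooth_fun_linear(3)[OF P] smooth_f0 h_fun smooth_pullbacks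
      smooth_inverse_h smooth_form_d_fun[OF P] smooth_form_pullback[OF P M pr_map smooth_theta])+

text \<open>dh/h is closed although log h has no global branch: differentiating
  \<open>h y * (1 / h y) = 1\<close> shows that d(1/h) is a multiple of dh, and dh \<and> dh =
  0.\<close>

lemma d_dlog_h:
  assumes c: "c \<in> P" "y \<in> cdom c"
  shows "d_form (scale_form (\<lambda>y. 1 / h y) (d_fun h)) c y u v = 0"
proof -
  have y: "y \<in> points P" by (rule in_pointsI[OF c(2,1)])
  have "d_fun (\<lambda>y. h y * (1 / h y)) c y u = d_fun (\<lambda>y. 1) c y u" for u
    by (rule d_fun_cong[OF P c]) (simp add: h_nonzero)
  then have "h y * d_fun (\<lambda>y. 1 / h y) c y u + d_fun h c y u * (1 / h y) = 0" for u
    unfolding d_fun_mult[OF P h_fun smooth_inverse_h c] by (simp add: d_fun_def comp_def)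
  then have "d_fun (\<lambda>y. 1 / h y) c y u = - d_fun h c y u / (h y * h y)" for u
    using h_nonzero[OF y] by (simp add: field_simps add_eq_0_iff)
  then show ?thesis
    unfolding d_form_scale[OF P smooth_inverse_h smooth_form_d_fun[OF P h_fun] c] d_form_d_fun[OF P h_fun c]
    by (simp add: wedge_def)
qed

context
  fixes c y d
  assumes c: "c \<in> P" "y \<in> cdom c" and d: "d \<in> M" "pr y \<in> cdom d"
begin

lemma pullback_theta:
  "pullback M pr theta c y u = - q (pr y) * lam d (pr y) (tmap pr c d y u)
    + A0 (pr y) * mu d (pr y) (tmap pr c d y u) - p (pr y) * cnj (mu d (pr y) (tmap pr c d y u))"
  by (subst pullback_eq[OF P M pr_map smooth_theta c(1) d(1) c(2) d(2)])
    (simp add: theta_def frame_form_def add_form_def scale_form_def cnj_form_def)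

lemma Omega0_eq:
  "Omega0 c y u = d_fun h c y u / h y - q (pr y) * lam d (pr y) (tmap pr c d y u)
    + A0 (pr y) * mu d (pr y) (tmap pr c d y u) - p (pr y) * cnj (mu d (pr y) (tmap pr c d y u))"
  unfolding Omega0_def by (simp add: add_form_def scale_form_def pullback_theta)

lemma omega0_eq: "omega0 c y u = complex_of_real (f0 y) * lam d (pr y) (tmap pr c d y u)"
  and omega1_eq: "omega1 c y u = h y * mu d (pr y) (tmap pr c d y u)"
  unfolding omega0_def omega1_def by (simp_all add: scale_form_def pullback_coframe[OF c d])

lemma cnj_lam_pr: "cnj (lam d (pr y) v) = lam d (pr y) v"
  by (rule cnj_lam[OF d])

lemma point_y: "y \<in> points P"
  by (rule in_pointsI[OF c(2,1)])

lemma d_Omega0: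
  "d_form Omega0 c y u v = complex_of_real (k1 M lam mu (pr y)) * cmn d (pr y) (tmap pr c d y u) (tmap pr c d y v)
    + k2 M lam mu (pr y) / a (pr y) * cml d (pr y) (tmap pr c d y u) (tmap pr c d y v)"
  unfolding Omega0_def d_form_add[OF P smooth_form_scale[OF P smooth_inverse_h smooth_form_d_fun[OF P h_fun]]
      smooth_form_pullback[OF P M pr_map smooth_theta] c] d_dlog_h[OF c]
    d_form_pullback[OF P M pr_map smooth_theta c(1) d(1) c(2) d(2)] d_theta[OF d] by simp

text \<open>Obtained by differentiating the product relation a f = |h|^2, which avoids a quotient
  rule; a is cancelled only where the formula is used.\<close>

lemma d_f0:
  "a (pr y) * d_fun (\<lambda>y. complex_of_real (f0 y)) c y u =
    d_fun h c y u * cnj (h y) + h y * cnj (d_fun h c y u)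
    - complex_of_real (f0 y) * (Dl a (pr y) * lam d (pr y) (tmap pr c d y u)
      + Dm a (pr y) * mu d (pr y) (tmap pr c d y u) + cnj (Dm a (pr y) * mu d (pr y) (tmap pr c d y u)))"
proof -
  have sf: "smooth_fun P (\<lambda>y. complex_of_real (f0 y))" by (rule smooth_fun_linear(3)[OF P smooth_f0])
  have sa: "smooth_fun P (\<lambda>y. a (pr y))" by (rule smooth_fun_compose[OF P M pr_map smooth_coeffs(5)])
  have "d_fun (\<lambda>y. a (pr y) * complex_of_real (f0 y)) c y u = d_fun (\<lambda>y. h y * cnj (h y)) c y u"
    by (rule d_fun_cong[OF P c]) (simp add: of_real_f0 tw_pr)
  note e = this[unfolded d_fun_mult[OF P sa sf c] d_fun_mult[OF P h_fun smooth_fun_linear(1)[OF P h_fun] c] d_fun_cnj[OF P h_fun c]]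
  have "Dn a (pr y) = cnj (Dm a (pr y))"
    using D_cnj(2)[OF smooth_coeffs(5) pr_points[OF point_y]] by simp
  then show ?thesis
    using e unfolding d_fun_compose[OF P M pr_map smooth_coeffs(5) c(1) d(1) c(2) d(2)] d_fun_frame[OF smooth_coeffs(5) d]
    by (simp add: cnj_form_def algebra_simps)
qed

lemma system_equations0:
  "d_form omega0 c y u v =
      \<i> * wedge omega1 (cnj_form omega1) c y u v + wedge (add_form Omega0 (cnj_form Omega0)) omega0 c y u v"
  "d_form omega1 c y u v = wedge Omega0 omega1 c y u v"
  "d_form Omega0 c y u v = complex_of_real (K10 y) * wedge omega1 (cnj_form omega1) c y u v
      + K20 y * wedge omega1 omega0 c y u v"
proof -
  have sf: "smooth_fun P (\<lambda>y. complex_of_real (f0 y))" by (rule smooth_fun_linear(3)[OF P smooth_f0])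
  have h0: "h y \<noteq> 0" by (rule h_nonzero[OF point_y])
  have a0: "a (pr y) \<noteq> 0" using tw_pr[OF point_y] by simp
  define \<eta> where "\<eta> u = d_fun h c y u / h y" for u
  have dh: "d_fun h c y u = h y * \<eta> u" for u using h0 by (simp add: \<eta>_def)
  note Omega0 = Omega0_eq[folded \<eta>_def]
  show "d_form omega1 c y u v = wedge Omega0 omega1 c y u v"
    unfolding omega1_def d_form_scaled_mu[OF c d h_fun] unfolding omega1_def[symmetric] shearfree[OF pr_points[OF point_y]]
    by (simp add: wedge_def cwedge_def omega1_eq Omega0 dh cnj_form_def algebra_simps)
  show "d_form Omega0 c y u v = complex_of_real (K10 y) * wedge omega1 (cnj_form omega1) c y u v
      + K20 y * wedge omega1 omega0 c y u v"
  proof -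
    have K1: "complex_of_real (k1 M lam mu (pr y)) = complex_of_real (K10 y) * (h y * cnj (h y))"
      unfolding K10_def of_real_divide complex_norm_square using h0 by simp
    have K2: "k2 M lam mu (pr y) / a (pr y) = K20 y * (h y * complex_of_real (f0 y))"
      unfolding K20_eq[OF point_y] of_real_f0 using h0 by (simp add: field_simps)
    show ?thesis
      unfolding d_Omega0 K1 K2 by (simp add: wedge_def cwedge_def omega0_eq omega1_eq cnj_form_def algebra_simps)
  qed
  \<comment> \<open>\<open>\<kappa>\<close> collects the \<lambda>-coefficient in the formula for
    d\<open>f0\<close>. It disappears from d\<omega>, where d\<open>f0\<close> is wedged with
    \<lambda>.\<close>
  define \<kappa> where "\<kappa> = f0 y * (q (pr y) + cnj (q (pr y)) - Dl a (pr y) / a (pr y))"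
  have df: "d_fun (\<lambda>y. complex_of_real (f0 y)) c y u = f0 y * (Omega0 c y u + cnj (Omega0 c y u))
     - f0 y * (b (pr y) * mu d (pr y) (tmap pr c d y u) + cnj (b (pr y) * mu d (pr y) (tmap pr c d y u)))
     + \<kappa> * lam d (pr y) (tmap pr c d y u)" for u
  proof -
    have "a (pr y) * d_fun (\<lambda>y. complex_of_real (f0 y)) c y u =
      a (pr y) * (f0 y * (d_fun h c y u / h y + cnj (d_fun h c y u / h y))
      - f0 y * (Dl a (pr y) / a (pr y) * lam d (pr y) (tmap pr c d y u)
      + Dm a (pr y) / a (pr y) * mu d (pr y) (tmap pr c d y u) + cnj (Dm a (pr y) / a (pr y) * mu d (pr y) (tmap pr c d y u))))"
      unfolding d_f0 unfolding of_real_f0 using h0 a0 by (simp add: field_simps)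
    then have "d_fun (\<lambda>y. complex_of_real (f0 y)) c y u =
      f0 y * (d_fun h c y u / h y + cnj (d_fun h c y u / h y))
      - f0 y * (Dl a (pr y) / a (pr y) * lam d (pr y) (tmap pr c d y u)
      + Dm a (pr y) / a (pr y) * mu d (pr y) (tmap pr c d y u) + cnj (Dm a (pr y) / a (pr y) * mu d (pr y) (tmap pr c d y u)))"
      using a0 by simp
    then show ?thesis
      unfolding Omega0_eq \<kappa>_def A0_def D_loga(2)[OF pr_points[OF point_y]]
      by (simp add: cnj_lam_pr algebra_simps)
  qed
  have "f0 y * (\<i> * a (pr y)) = \<i> * (h y * cnj (h y))" unfolding of_real_f0 using a0 by simp
  then have ia: "f0 y * (\<i> * a (pr y) * z) = \<i> * (h y * cnj (h y)) * z" for z by (metis mult.assoc)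
  show "d_form omega0 c y u v =
      \<i> * wedge omega1 (cnj_form omega1) c y u v + wedge (add_form Omega0 (cnj_form Omega0)) omega0 c y u v"
    unfolding omega0_def d_form_scaled_lam[OF c d sf] unfolding omega0_def[symmetric] distrib_left ia
    unfolding wedge_def cwedge_def omega0_eq omega1_eq add_form_def cnj_form_def df
    by (simp add: algebra_simps)
qed

lemma dual_vector:
  obtains u where "omega0 c y u = complex_of_real r" "omega1 c y u = z" "Omega0 c y u = w"
proof -
  have h0: "h y \<noteq> 0" and f0: "f0 y \<noteq> 0" using h_nonzero f0_nonzero point_y by blast+
  \<comment> \<open>This is the value of dh that solves \<open>Omega0 c y u = w\<close> once the
    \<lambda> and \<mu> values of the projected vector are fixed.\<close>
  let ?w = "\<lambda>v. h y * (w - (- q (pr y) * lam d (pr y) v + A0 (pr y) * mu d (pr y) v - p (pr y) * cnj (mu d (pr y) v)))"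
  obtain u where u: "lam d (pr y) (tmap pr c d y u) = complex_of_real (r / f0 y)"
    "mu d (pr y) (tmap pr c d y u) = z / h y" "d_fun h c y u = ?w (tmap pr c d y u)"
    by (rule lift_coframe[OF c d])
  show ?thesis
    by (rule that[of u]) (simp_all add: omega0_eq omega1_eq Omega0_eq u h0 f0)
qed

end

lemma wedge_nonzero0: "wedge_nonzero P [omega0, omega1, cnj_form omega1, Omega0, cnj_form Omega0]"
  unfolding wedge_nonzero_def
proof (intro ballI)
  fix c y assume c: "c \<in> P" "y \<in> cdom c"
  obtain d where d: "d \<in> M" "pr y \<in> cdom d" by (rule base_chart[OF c])
  obtain v0 where v0: "omega0 c y v0 = complex_of_real 1" "omega1 c y v0 = 0" "Omega0 c y v0 = 0"
    by (rule dual_vector[OF c d])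
  obtain v1 where v1: "omega0 c y v1 = complex_of_real 0" "omega1 c y v1 = 1" "Omega0 c y v1 = 0"
    by (rule dual_vector[OF c d])
  obtain v2 where v2: "omega0 c y v2 = complex_of_real 0" "omega1 c y v2 = \<i>" "Omega0 c y v2 = 0"
    by (rule dual_vector[OF c d])
  obtain v3 where v3: "omega0 c y v3 = complex_of_real 0" "omega1 c y v3 = 0" "Omega0 c y v3 = 1"
    by (rule dual_vector[OF c d])
  obtain v4 where v4: "omega0 c y v4 = complex_of_real 0" "omega1 c y v4 = 0" "Omega0 c y v4 = \<i>"
    by (rule dual_vector[OF c d])
  note vs = v0 v1 v2 v3 v4
  \<comment> \<open>The vectors are dual to the real form and to the real and imaginary parts of the
    two complex ones. Each conjugate pair contributes 1 * (-i) - i * 1 = -2i, and the product of the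
    two contributions is -4.\<close>
  have "wedge_list [omega1 c y, cnj_form omega1 c y, Omega0 c y, cnj_form Omega0 c y] [v1, v2, v3, v4] = - 4"
    by (subst wedge_list_Cons_Cons)
      (simp add: wedge_list_3 triple_def sum.lessThan_Suc vs cnj_form_def del: wedge_list.simps)
  then have "wedge_list [omega0 c y, omega1 c y, cnj_form omega1 c y, Omega0 c y, cnj_form Omega0 c y] [v0, v1, v2, v3, v4] = - 4"
    by (subst wedge_list_Cons_Cons) (simp add: sum.lessThan_Suc vs del: wedge_list.simps)
  then show "\<exists>vs. length vs = length [omega0, omega1, cnj_form omega1, Omega0, cnj_form Omega0] \<and>
      wedge_list (map (\<lambda>\<alpha>. \<alpha> c y) [omega0, omega1, cnj_form omega1, Omega0, cnj_form Omega0]) vs \<noteq> 0"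
    by (intro exI[of _ "[v0, v1, v2, v3, v4]"]) (simp del: wedge_list.simps)
qed

lemma real_omega0: "real_form P omega0"
  unfolding real_form_def
proof (intro ballI allI)
  fix c y v assume c: "c \<in> P" "y \<in> cdom c"
  obtain d where d: "d \<in> M" "pr y \<in> cdom d" by (rule base_chart[OF c])
  show "omega0 c y v \<in> \<real>" unfolding omega0_eq[OF c d] by (intro Reals_mult Reals_of_real lam_real d)
qed

lemma standard_system: "invariant_system M lam mu P pr h f0 omega0 omega1 Omega0 K10 K20"
  unfolding invariant_system_def
proof (intro conjI ballI allI)
  show "form_eq P omega0 (scale_form (\<lambda>y. complex_of_real (f0 y)) (pullback M pr lam))"
    "form_eq P omega1 (scale_form h (pullback M pr mu))"
    unfolding omega0_def omega1_def form_eq_def by simp_all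
  fix c y u v assume c: "c \<in> P" "y \<in> cdom c"
  obtain d where d: "d \<in> M" "pr y \<in> cdom d" by (rule base_chart[OF c])
  note eqs = system_equations0[OF c d]
  show "d_form omega0 c y u v =
      \<i> * wedge omega1 (cnj_form omega1) c y u v + wedge (add_form Omega0 (cnj_form Omega0)) omega0 c y u v"
    "d_form omega1 c y u v = wedge Omega0 omega1 c y u v"
    "d_form Omega0 c y u v = complex_of_real (K10 y) * wedge omega1 (cnj_form omega1) c y u v
      + K20 y * wedge omega1 omega0 c y u v" by (rule eqs)+
  show "d_form (cnj_form omega1) c y u v = wedge (cnj_form Omega0) (cnj_form omega1) c y u v"
    unfolding d_form_cnj[OF P smooth_forms0(2) c] eqs(2) by (simp add: wedge_def cnj_form_def)
  have "cnj (omega0 c y w) = omega0 c y w" for w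
    using real_omega0 c unfolding real_form_def by (simp add: Reals_cnj_iff)
  then show "d_form (cnj_form Omega0) c y u v = - complex_of_real (K10 y) * wedge omega1 (cnj_form omega1) c y u v
      + cnj (K20 y) * wedge (cnj_form omega1) omega0 c y u v"
    unfolding d_form_cnj[OF P smooth_forms0(3) c] eqs(3) by (simp add: wedge_def cnj_form_def algebra_simps)
qed (use smooth_f0 f0_nonzero smooth_forms0 real_omega0 smooth_K10 smooth_K20 wedge_nonzero0 in blast)+

text \<open>\<open>f\<close> is fixed by \<open>system_scale\<close>. For \<Omega> the given
  solution is compared with the standard one: the coefficients from d\<lambda> and d\<mu> are common
  to both, so the difference satisfies homogeneous equations. The functions K_1 and K_2 then follow
  from the equality of the exterior derivatives.\<close>

lemma system_unique:
  assumes sys: "invariant_system M lam mu P pr h f \<omega> \<omega>\<^sub>1 \<Omega> K\<^sub>1 K\<^sub>2"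
  shows "form_eq P \<omega> omega0" "form_eq P \<omega>\<^sub>1 omega1" "form_eq P \<Omega> Omega0"
    "\<And>y. y \<in> points P \<Longrightarrow> f y = f0 y" "\<And>y. y \<in> points P \<Longrightarrow> K\<^sub>1 y = K10 y" "\<And>y. y \<in> points P \<Longrightarrow> K\<^sub>2 y = K20 y"
proof -
  show f: "f y = f0 y" if "y \<in> points P" for y
    using system_scale[OF sys that] tw_pr[OF that] by (simp add: f0_def field_simps)
  have df: "d_fun (\<lambda>y. complex_of_real (f y)) c y = d_fun (\<lambda>y. complex_of_real (f0 y)) c y"
    if "c \<in> P" "y \<in> cdom c" for c y
    by (rule ext, rule d_fun_cong[OF P that]) (simp add: f)
  show "form_eq P \<omega> omega0" unfolding form_eq_def
  proof (intro ballI allI)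
    fix c y v assume c: "c \<in> P" "y \<in> cdom c"
    obtain d where d: "d \<in> M" "pr y \<in> cdom d" by (rule base_chart[OF c])
    show "\<omega> c y v = omega0 c y v"
      unfolding invariant_systemD(1)[OF sys c d] omega0_eq[OF c d] f[OF in_pointsI[OF c(2,1)]] ..
  qed
  show "form_eq P \<omega>\<^sub>1 omega1" unfolding form_eq_def
  proof (intro ballI allI)
    fix c y v assume c: "c \<in> P" "y \<in> cdom c"
    obtain d where d: "d \<in> M" "pr y \<in> cdom d" by (rule base_chart[OF c])
    show "\<omega>\<^sub>1 c y v = omega1 c y v"
      unfolding invariant_systemD(2)[OF sys c d] omega1_eq[OF c d] ..
  qed
  show \<Omega>: "form_eq P \<Omega> Omega0" unfolding form_eq_def
  proof (intro ballI allI)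
    fix c y t assume c: "c \<in> P" "y \<in> cdom c"
    obtain d where d: "d \<in> M" "pr y \<in> cdom d" by (rule base_chart[OF c])
    have y: "y \<in> points P" by (rule in_pointsI[OF c(2,1)])
    have h0: "h y \<noteq> 0" and fy: "f0 y \<noteq> 0" and a0: "a (pr y) \<noteq> 0"
      using h_nonzero[OF y] f0_nonzero[OF y] tw_pr[OF y] by simp_all
    obtain u v w where u: "lam d (pr y) (tmap pr c d y u) = 1" "mu d (pr y) (tmap pr c d y u) = 0"
      and v: "lam d (pr y) (tmap pr c d y v) = 0" "mu d (pr y) (tmap pr c d y v) = 1"
      and w: "lam d (pr y) (tmap pr c d y w) = 0" "mu d (pr y) (tmap pr c d y w) = \<i>"
      by (rule adapted_vectors[OF c d])
    define X where "X t = \<Omega> c y t - Omega0 c y t" for t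
    have "h y * cwedge X (\<lambda>u. mu d (pr y) (tmap pr c d y u)) t t' = 0" for t t'
    proof -
      have "h y * cwedge (\<Omega> c y) (\<lambda>u. mu d (pr y) (tmap pr c d y u)) t t' =
        h y * cwedge (Omega0 c y) (\<lambda>u. mu d (pr y) (tmap pr c d y u)) t t'"
        using invariant_systemD(3)[OF sys c d, of t t'] invariant_systemD(3)[OF standard_system c d, of t t'] by metis
      then show ?thesis by (simp add: X_def cwedge_def algebra_simps)
    qed
    then have X0: "cwedge X (\<lambda>u. mu d (pr y) (tmap pr c d y u)) t v = 0" for t using h0 by (metis mult_eq_0_iff)
    \<comment> \<open>The vector \<open>v\<close> has \<mu>-value 1, so the vanishing of X \<and>
      \<mu> on the pair \<open>t\<close>, \<open>v\<close> exhibits \<open>X\<close> as a multiple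
      of \<mu>.\<close>
    have X: "X t = X v * mu d (pr y) (tmap pr c d y t)" for t
      using X0[of t] unfolding cwedge_def v(2) by simp
    have real: "X t + cnj (X t) = 0" if t: "lam d (pr y) (tmap pr c d y t) = 0" for t
    proof -
      \<comment> \<open>The two equations for d\<omega> share their left-hand sides and the \<mu>
        \<and> \<mu>' terms, because \<open>f\<close> and its differential are already determined;
        only the terms with \<Omega> remain to be compared.\<close>
      have "f0 y * cwedge (\<lambda>u. \<Omega> c y u + cnj (\<Omega> c y u)) (\<lambda>u. lam d (pr y) (tmap pr c d y u)) t u =
        f0 y * cwedge (\<lambda>u. Omega0 c y u + cnj (Omega0 c y u)) (\<lambda>u. lam d (pr y) (tmap pr c d y u)) t u"
        by (rule add_left_imp_eq[OF trans[OF sym[OF invariant_systemD(4)[OF sys c d, of t u, unfolded df[OF c] f[OF y]]]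
              invariant_systemD(4)[OF standard_system c d, of t u]]])
      then have "cwedge (\<lambda>u. \<Omega> c y u + cnj (\<Omega> c y u)) (\<lambda>u. lam d (pr y) (tmap pr c d y u)) t u =
        cwedge (\<lambda>u. Omega0 c y u + cnj (Omega0 c y u)) (\<lambda>u. lam d (pr y) (tmap pr c d y u)) t u"
        using fy by simp
      then show ?thesis unfolding cwedge_def u t X_def by (simp add: algebra_simps)
    qed
    \<comment> \<open>Both the coefficient of \<mu> in \<open>X\<close> and its product with i have
      vanishing real part, so the coefficient is zero.\<close>
    have "X v + cnj (X v) = 0" "X v * \<i> + cnj (X v * \<i>) = 0"
      using real[of v] real[of w] X[of w] v(1) w by simp_all
    then have "X v = 0" by (simp add: complex_eq_iff)
    then show "\<Omega> c y t = Omega0 c y t" using X[of t] by (simp add: X_def)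
  qed
  have K: "K\<^sub>1 y = K10 y \<and> K\<^sub>2 y = K20 y" if y: "y \<in> points P" for y
  proof -
    obtain c where c: "c \<in> P" "y \<in> cdom c" using y by (rule in_pointsE)
    obtain d where d: "d \<in> M" "pr y \<in> cdom d" by (rule base_chart[OF c])
    obtain u v w where u: "lam d (pr y) (tmap pr c d y u) = 1" "mu d (pr y) (tmap pr c d y u) = 0"
      and v: "lam d (pr y) (tmap pr c d y v) = 0" "mu d (pr y) (tmap pr c d y v) = 1"
      and w: "lam d (pr y) (tmap pr c d y w) = 0" "mu d (pr y) (tmap pr c d y w) = \<i>"
      by (rule adapted_vectors[OF c d])
    have e: "K\<^sub>1 y * (h y * cnj (h y)) * cmn d (pr y) (tmap pr c d y u) (tmap pr c d y v)
        + K\<^sub>2 y * (h y * f0 y) * cml d (pr y) (tmap pr c d y u) (tmap pr c d y v) =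
      K10 y * (h y * cnj (h y)) * cmn d (pr y) (tmap pr c d y u) (tmap pr c d y v)
        + K20 y * (h y * f0 y) * cml d (pr y) (tmap pr c d y u) (tmap pr c d y v)" for u v
      using invariant_systemD(5)[OF sys c d, of u v] invariant_systemD(5)[OF standard_system c d, of u v]
        d_form_cong[OF P c \<Omega>, of u v] f[OF y] by metis
    \<comment> \<open>On the pair \<open>v\<close>, \<open>w\<close> only \<mu> \<and> \<mu>'
      survives, which gives K_1; on the pair \<open>v\<close>, \<open>u\<close> only \<mu> \<and>
      \<lambda> survives, which gives K_2.\<close>
    show ?thesis
      using e[of v w] e[of v u] h_nonzero[OF y] f0_nonzero[OF y] by (simp add: cwedge_def u v w cnj_form_def)
  qed
  show "\<And>y. y \<in> points P \<Longrightarrow> K\<^sub>1 y = K10 y" "\<And>y. y \<in> points P \<Longrightarrow> K\<^sub>2 y = K20 y" using K by blast+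
qed

end

section \<open>Existence, change of representative, and isomorphisms\<close>

lemma diffeo_id: "smooth_manifold A \<Longrightarrow> diffeo A A (\<lambda>p. p)"
  by (rule diffeoI[OF smooth_map_id smooth_map_id]) simp_all

lemma cstar_bundle_prod:
  fixes M :: "('m::{t2_space, second_countable_topology}, real^3) atlas"
  assumes M: "smooth_manifold M"
  shows "cstar_bundle M (prod_manifold M cstar) fst snd"
proof -
  let ?P = "prod_manifold M cstar"
  have P: "smooth_manifold ?P" by (rule smooth_manifold_prod[OF M smooth_manifold_cstar])
  \<comment> \<open>The whole base serves as a single trivialising open set, and restriction to it
    leaves both atlases unchanged.\<close>
  have "restr ?P (fst -` points M) = ?P" by (rule restr_superset) (auto simp: points_prod_manifold)
  moreover have "restr M (points M) = M" by (rule restr_superset) simp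
  ultimately have "diffeo (restr ?P (fst -` points M)) (prod_manifold (restr M (points M)) cstar) (\<lambda>y. (fst y, snd y))"
    using diffeo_id[OF P] by simp
  then have "\<forall>x\<in>points M. \<exists>U. open U \<and> x \<in> U \<and> U \<subseteq> points M \<and>
      diffeo (restr ?P (fst -` U)) (prod_manifold (restr M U) cstar) (\<lambda>y. (fst y, snd y))"
    using open_points[OF M] by blast
  then show ?thesis
    unfolding cstar_bundle_def
    using P smooth_map_fst[OF M smooth_manifold_cstar] smooth_map_snd[OF M smooth_manifold_cstar] by simp
qed

section \<open>Change of representative\<close>

lemma gauge_diffeo:
  fixes M :: "('m::{t2_space, second_countable_topology}, real^3) atlas"
    and P :: "('p::{t2_space, second_countable_topology}, 'f::euclidean_space) atlas"
  assumes M: "smooth_manifold M" and P: "smooth_manifold P"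
    and F: "diffeo P (prod_manifold M cstar) (\<lambda>y. (pr y, h y))"
    and g: "smooth_fun M g" "\<And>x. x \<in> points M \<Longrightarrow> g x \<noteq> 0"
  shows "diffeo P (prod_manifold M cstar) (\<lambda>y. (pr y, h y * g (pr y)))"
proof -
  let ?MC = "prod_manifold M cstar"
  note C = smooth_manifold_cstar
  have MC: "smooth_manifold ?MC" by (rule smooth_manifold_prod[OF M C])
  have snd: "smooth_fun ?MC snd" using smooth_map_snd[OF M C] smooth_map_cstar[OF MC] by blast
  have gf: "smooth_fun ?MC (\<lambda>q. g (fst q))" by (rule smooth_fun_compose[OF MC M smooth_map_fst[OF M C] g(1)])
  have g0: "g (fst q) \<noteq> 0" "snd q \<noteq> 0" if "q \<in> points ?MC" for q
    using that g(2) by (auto simp: points_prod_manifold points_cstar)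
  have 1: "smooth_map ?MC ?MC (\<lambda>q. (fst q, snd q * g (fst q)))"
    by (intro smooth_map_Pair[OF M C MC smooth_map_fst[OF M C]] smooth_map_cstar[OF MC, THEN iffD2] conjI
        smooth_fun_mult[OF MC] snd gf) (simp add: g0)
  have 2: "smooth_map ?MC ?MC (\<lambda>q. (fst q, snd q / g (fst q)))"
    by (intro smooth_map_Pair[OF M C MC smooth_map_fst[OF M C]] smooth_map_cstar[OF MC, THEN iffD2] conjI
        smooth_fun_divide[OF MC] snd gf) (simp_all add: g0)
  have T: "diffeo ?MC ?MC (\<lambda>q. (fst q, snd q * g (fst q)))"
    by (rule diffeoI[OF 1 2 _ _ MC MC]) (simp_all add: g0)
  from diffeo_compose[OF P MC MC F T] show ?thesis by simp
qed

lemma same_congruence_sym: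
  assumes M: "smooth_manifold M" and same: "same_congruence M lam mu lam' mu'"
  shows "same_congruence M lam' mu' lam mu"
proof -
  obtain f :: "'a \<Rightarrow> real" and h :: "'a \<Rightarrow> complex" where fh: "smooth_fun M f" "smooth_fun M h"
    "\<And>x. x \<in> points M \<Longrightarrow> f x \<noteq> 0" "\<And>x. x \<in> points M \<Longrightarrow> h x \<noteq> 0"
    and eq: "form_eq M lam' (scale_form (\<lambda>x. complex_of_real (f x)) lam)" "form_eq M mu' (scale_form h mu)"
    using same unfolding same_congruence_def by blast
  have 1: "smooth_fun M (\<lambda>x. 1 / f x)" "smooth_fun M (\<lambda>x. 1 / h x)"
    by (rule smooth_fun_divide[OF M smooth_fun_intros(1)[OF M] fh(1) fh(3)]; assumption)
      (rule smooth_fun_divide[OF M smooth_fun_intros(1)[OF M] fh(2) fh(4)]; assumption)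
  have 2: "form_eq M lam (scale_form (\<lambda>x. complex_of_real (1 / f x)) lam')"
    unfolding form_eq_def
  proof (intro ballI allI)
    fix c x v assume c: "c \<in> M" "x \<in> cdom c"
    show "lam c x v = scale_form (\<lambda>x. complex_of_real (1 / f x)) lam' c x v"
      using form_eqD[OF eq(1) c, of v] fh(3)[OF in_pointsI[OF c(2,1)]] by (simp add: scale_form_def)
  qed
  have 3: "form_eq M mu (scale_form (\<lambda>x. 1 / h x) mu')"
    unfolding form_eq_def
  proof (intro ballI allI)
    fix c x v assume c: "c \<in> M" "x \<in> cdom c"
    show "mu c x v = scale_form (\<lambda>x. 1 / h x) mu' c x v"
      using form_eqD[OF eq(2) c, of v] fh(4)[OF in_pointsI[OF c(2,1)]] by (simp add: scale_form_def)
  qed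
  show ?thesis
    unfolding same_congruence_def using 1 2 3 fh(3,4)
    by (intro exI[of _ "\<lambda>x. 1 / f x"] exI[of _ "\<lambda>x. 1 / h x"]) simp
qed

text \<open>
  Only \<open>f\<close> and the fibre coordinate change, not the forms: this reduces every statement about two
  representatives to one about a single representative.
\<close>

lemma gauge_system:
  fixes M :: "('m::{t2_space, second_countable_topology}, real^3) atlas"
    and P :: "('p::{t2_space, second_countable_topology}, 'f::euclidean_space) atlas"
  assumes M: "smooth_manifold M" and oc: "oriented_congruence M lam mu" and oc': "oriented_congruence M lam' mu'"
    and same: "same_congruence M lam mu lam' mu'"
    and P: "smooth_manifold P" and F: "diffeo P (prod_manifold M cstar) (\<lambda>y. (pr y, h y))"
    and sys: "invariant_system M lam' mu' P pr h f \<omega> \<omega>\<^sub>1 \<Omega> K\<^sub>1 K\<^sub>2"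
  obtains g f' where "smooth_fun M g" "\<And>x. x \<in> points M \<Longrightarrow> g x \<noteq> 0"
    "invariant_system M lam mu P pr (\<lambda>y. h y * g (pr y)) f' \<omega> \<omega>\<^sub>1 \<Omega> K\<^sub>1 K\<^sub>2"
proof -
  interpret B: congruence_structure M lam mu using M oc by unfold_locales
  interpret B': cstar_fibration M lam' mu' P pr h using M oc' P F by unfold_locales
  obtain k :: "'m \<Rightarrow> real" and g :: "'m \<Rightarrow> complex" where kg: "smooth_fun M k" "smooth_fun M g"
    "\<And>x. x \<in> points M \<Longrightarrow> k x \<noteq> 0" "\<And>x. x \<in> points M \<Longrightarrow> g x \<noteq> 0"
    and eq: "form_eq M lam' (scale_form (\<lambda>x. complex_of_real (k x)) lam)" "form_eq M mu' (scale_form g mu)"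
    using same unfolding same_congruence_def by blast
  note S = sys[unfolded invariant_system_def]
  have eqs: "form_eq P \<omega> (scale_form (\<lambda>y. complex_of_real (f y)) (pullback M pr lam'))"
    "form_eq P \<omega>\<^sub>1 (scale_form h (pullback M pr mu'))" using S by blast+
  have "form_eq P \<omega> (scale_form (\<lambda>y. complex_of_real (f y * k (pr y))) (pullback M pr lam))"
    unfolding form_eq_def
  proof (intro ballI allI)
    fix c y v assume c: "c \<in> P" "y \<in> cdom c"
    obtain d where d: "d \<in> M" "pr y \<in> cdom d" by (rule B'.base_chart[OF c])
    show "\<omega> c y v = scale_form (\<lambda>y. complex_of_real (f y * k (pr y))) (pullback M pr lam) c y v"
      using form_eqD[OF eqs(1) c, of v] form_eqD[OF eq(1) d] B'.pullback_coframe(1)[OF c d]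
        pullback_eq[OF P M B'.pr_map B.lam c(1) d(1) c(2) d(2)]
      by (simp add: scale_form_def)
  qed
  moreover have "form_eq P \<omega>\<^sub>1 (scale_form (\<lambda>y. h y * g (pr y)) (pullback M pr mu))"
    unfolding form_eq_def
  proof (intro ballI allI)
    fix c y v assume c: "c \<in> P" "y \<in> cdom c"
    obtain d where d: "d \<in> M" "pr y \<in> cdom d" by (rule B'.base_chart[OF c])
    show "\<omega>\<^sub>1 c y v = scale_form (\<lambda>y. h y * g (pr y)) (pullback M pr mu) c y v"
      using form_eqD[OF eqs(2) c, of v] form_eqD[OF eq(2) d] B'.pullback_coframe(2)[OF c d]
        pullback_eq[OF P M B'.pr_map B.mu c(1) d(1) c(2) d(2)]
      by (simp add: scale_form_def)
  qed
  moreover have "smooth_fun P (\<lambda>y. f y * k (pr y))"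
    using S by (intro smooth_fun_mult[OF P] smooth_fun_compose[OF P M B'.pr_map kg(1)]) blast
  moreover have "f y * k (pr y) \<noteq> 0" if "y \<in> points P" for y
    using S that kg(3)[OF B'.pr_points[OF that]] by simp
  ultimately have "invariant_system M lam mu P pr (\<lambda>y. h y * g (pr y)) (\<lambda>y. f y * k (pr y)) \<omega> \<omega>\<^sub>1 \<Omega> K\<^sub>1 K\<^sub>2"
    unfolding invariant_system_def using S by blast
  with that kg(2,4) show ?thesis by blast
qed

text \<open>The standard solution for \<open>lam\<close>, \<open>mu\<close> on the product is also a
  solution for \<open>lam'\<close>, \<open>mu'\<close> with a rescaled fibre coordinate. Its
  equations force the twist of the new representative to be nonzero and its shear to vanish; after
  that, uniqueness expresses the same K_1 and K_2 through either pair of invariants.\<close>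

lemma twisted_shearfree_gauge:
  fixes M :: "('m::{t2_space, second_countable_topology}, real^3) atlas"
  assumes "twisted_shearfree M lam mu" and oc': "oriented_congruence M lam' mu'"
    and same: "same_congruence M lam mu lam' mu'"
  shows "twisted_shearfree M lam' mu'"
    and "x \<in> points M \<Longrightarrow> \<exists>r z. r > 0 \<and> z \<noteq> 0 \<and> k1 M lam' mu' x = r * k1 M lam mu x \<and> k2 M lam' mu' x = z * k2 M lam mu x"
proof -
  interpret twisted_shearfree M lam mu by fact
  let ?P = "prod_manifold M cstar"
  have P: "smooth_manifold ?P" by (rule smooth_manifold_prod[OF M smooth_manifold_cstar])
  have F: "diffeo ?P ?P (\<lambda>y. (fst y, snd y))" using diffeo_id[OF P] by simp
  interpret T: twisted_fibration M lam mu ?P fst snd using P F by unfold_locales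
  \<comment> \<open>The relation is used backwards, \<open>mu\<close> being \<open>g\<close> times
    \<open>mu'\<close>; hence the fibre coordinate for \<open>mu'\<close> is \<open>snd\<close>
    multiplied by \<open>g\<close>.\<close>
  obtain g f' where g: "smooth_fun M g" "\<And>x. x \<in> points M \<Longrightarrow> g x \<noteq> 0"
    and sys: "invariant_system M lam' mu' ?P fst (\<lambda>y. snd y * g (fst y)) f' T.omega0 T.omega1 T.Omega0 T.K10 T.K20"
    by (rule gauge_system[OF M oc' oc same_congruence_sym[OF M same] P F T.standard_system]) (rule that; assumption)
  have F': "diffeo ?P ?P (\<lambda>y. (fst y, snd y * g (fst y)))"
    by (rule gauge_diffeo[OF M P F g])
  interpret S: cstar_fibration M lam' mu' ?P fst "\<lambda>y. snd y * g (fst y)"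
    using M oc' P F' by unfold_locales
  have y: "(x, 1) \<in> points ?P" if "x \<in> points M" for x
    using that by (simp add: points_prod_manifold points_cstar)
  show tw': "twisted_shearfree M lam' mu'"
  proof unfold_locales
    fix x assume x: "x \<in> points M"
    show "twist M lam' mu' x \<noteq> 0" using S.system_scale[OF sys y[OF x]] g(2)[OF x] by auto
    show "shear M lam' mu' x = 0" using S.system_shearfree[OF sys y[OF x]] by simp
  qed
  interpret S: twisted_fibration M lam' mu' ?P fst "\<lambda>y. snd y * g (fst y)"
    using S.cstar_fibration_axioms tw' by (simp add: twisted_fibration_def)
  assume x: "x \<in> points M"
  note g0 = g(2)[OF x]
  \<comment> \<open>At the point with fibre coordinate 1 the unprimed weights are trivial, while the
    primed coordinate equals \<open>g x\<close>. The resulting factor |g|^2 of k_1 is positive, that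
    of k_2 is only nonzero.\<close>
  have "k1 M lam' mu' x / (cmod (g x))\<^sup>2 = k1 M lam mu x"
    using S.system_unique(5)[OF sys y[OF x]] by (simp add: S.K10_def T.K10_def)
  moreover have "k2 M lam' mu' x / (g x * (g x * cnj (g x))) = k2 M lam mu x"
    using S.system_unique(6)[OF sys y[OF x]] by (simp add: S.K20_eq[OF y[OF x]] T.K20_eq[OF y[OF x]])
  ultimately have "k1 M lam' mu' x = (cmod (g x))\<^sup>2 * k1 M lam mu x"
    "k2 M lam' mu' x = g x * (g x * cnj (g x)) * k2 M lam mu x"
    using g0 by (auto simp: field_simps)
  then show "\<exists>r z. r > 0 \<and> z \<noteq> 0 \<and> k1 M lam' mu' x = r * k1 M lam mu x \<and> k2 M lam' mu' x = z * k2 M lam mu x"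
    using g0 by (intro exI[of _ "(cmod (g x))\<^sup>2"] exI[of _ "g x * (g x * cnj (g x))"]) simp
qed

text \<open>The isomorphism matches points with equal base point and equal fibre coordinate, and the
  standard forms are built from these data alone. Conversely, an isomorphism over the base that
  preserves \<open>\<omega>\<^sub>1\<close>, which is h \<mu>, must preserve the fibre coordinate,
  hence is this one.\<close>

lemma twisted_fibration_iso:
  fixes M :: "('m::{t2_space, second_countable_topology}, real^3) atlas"
    and P :: "('p::{t2_space, second_countable_topology}, 'f::euclidean_space) atlas"
    and P' :: "('q::{t2_space, second_countable_topology}, 'g::euclidean_space) atlas"
  assumes A: "twisted_fibration M lam mu P pr h" and B: "twisted_fibration M lam mu P' pr' h'"
    and sys: "invariant_system M lam mu P pr h f \<omega> \<omega>\<^sub>1 \<Omega> K\<^sub>1 K\<^sub>2"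
    and sys': "invariant_system M lam mu P' pr' h' f' \<omega>' \<omega>\<^sub>1' \<Omega>' K\<^sub>1' K\<^sub>2'"
  shows "\<exists>\<Phi>. bundle_iso P pr \<omega> \<omega>\<^sub>1 \<Omega> K\<^sub>1 K\<^sub>2 P' pr' \<omega>' \<omega>\<^sub>1' \<Omega>' K\<^sub>1' K\<^sub>2' \<Phi> \<and>
    (\<forall>\<Psi>. bundle_iso P pr \<omega> \<omega>\<^sub>1 \<Omega> K\<^sub>1 K\<^sub>2 P' pr' \<omega>' \<omega>\<^sub>1' \<Omega>' K\<^sub>1' K\<^sub>2' \<Psi> \<longrightarrow> (\<forall>y\<in>points P. \<Psi> y = \<Phi> y))"
proof -
  interpret A: twisted_fibration M lam mu P pr h by fact
  interpret B: twisted_fibration M lam mu P' pr' h' by fact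
  note M = A.M
  note U = A.system_unique[OF sys] and U' = B.system_unique[OF sys']
  obtain G where dG: "diffeo (prod_manifold M cstar) P' G"
    and G1: "\<And>y. y \<in> points P' \<Longrightarrow> G (pr' y, h' y) = y"
    and G2: "\<And>q. q \<in> points (prod_manifold M cstar) \<Longrightarrow> (pr' (G q), h' (G q)) = q"
    by (rule diffeo_inverse[OF B.P A.MC B.F]) (rule that; assumption)
  define \<Phi> where "\<Phi> y = G (pr y, h y)" for y
  have d\<Phi>: "diffeo P P' \<Phi>"
    using diffeo_compose[OF A.P A.MC B.P A.F dG] by (simp add: \<Phi>_def[abs_def])
  have prod: "(pr y, h y) \<in> points (prod_manifold M cstar)" if "y \<in> points P" for y
    using A.pr_points[OF that] A.h_nonzero[OF that] by (simp add: points_prod_manifold points_cstar)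
  have pr\<Phi>: "pr' (\<Phi> y) = pr y" and h\<Phi>: "h' (\<Phi> y) = h y" if "y \<in> points P" for y
    using G2[OF prod[OF that]] by (simp_all add: \<Phi>_def)
  have s\<Phi>: "smooth_map P P' \<Phi>" using d\<Phi> unfolding diffeo_def by blast
  have forms': "smooth_form P' \<omega>'" "smooth_form P' \<omega>\<^sub>1'" "smooth_form P' \<Omega>'"
    using sys' unfolding invariant_system_def by blast+
  have charts: "\<exists>c' d. c' \<in> P' \<and> \<psi> y \<in> cdom c' \<and> d \<in> M \<and> pr y \<in> cdom d"
    if c: "c \<in> P" "y \<in> cdom c" and \<psi>: "smooth_map P P' \<psi>" for c y \<psi>
  proof -
    have y: "y \<in> points P" by (rule in_pointsI[OF c(2,1)])
    obtain c' where "c' \<in> P'" "\<psi> y \<in> cdom c'" using smooth_map_in_points[OF \<psi> y] by (rule in_pointsE)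
    moreover obtain d where "d \<in> M" "pr y \<in> cdom d" using A.pr_points[OF y] by (rule in_pointsE)
    ultimately show ?thesis by blast
  qed
  have tm: "tmap pr' c' d (\<psi> y) (tmap \<psi> c c' y v) = tmap pr c d y v"
    if "c \<in> P" "y \<in> cdom c" "c' \<in> P'" "\<psi> y \<in> cdom c'" "d \<in> M" "pr y \<in> cdom d" "smooth_map P P' \<psi>"
      and eq: "\<And>y. y \<in> points P \<Longrightarrow> pr' (\<psi> y) = pr y" for c y c' d \<psi> v
  proof -
    have "pr' (\<psi> y) \<in> cdom d" using eq[OF in_pointsI[OF that(2,1)]] that(6) by simp
    from tmap_compose[OF A.P B.P M that(7) B.pr_map that(1,3,5,2,4) this, of v]
      tmap_cong[OF A.P that(1,2) eq, where d = d and v = v]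
    show ?thesis by simp
  qed
  have "bundle_iso P pr \<omega> \<omega>\<^sub>1 \<Omega> K\<^sub>1 K\<^sub>2 P' pr' \<omega>' \<omega>\<^sub>1' \<Omega>' K\<^sub>1' K\<^sub>2' \<Phi>"
    unfolding bundle_iso_def
  proof (intro conjI ballI d\<Phi>)
    fix y assume y: "y \<in> points P"
    have y': "\<Phi> y \<in> points P'" by (rule smooth_map_in_points[OF s\<Phi> y])
    show "pr' (\<Phi> y) = pr y" by (rule pr\<Phi>[OF y])
    show "K\<^sub>1' (\<Phi> y) = K\<^sub>1 y"
      unfolding U(5)[OF y] U'(5)[OF y'] A.K10_def B.K10_def pr\<Phi>[OF y] h\<Phi>[OF y] ..
    show "K\<^sub>2' (\<Phi> y) = K\<^sub>2 y"
      unfolding U(6)[OF y] U'(6)[OF y'] A.K20_def B.K20_def pr\<Phi>[OF y] h\<Phi>[OF y] ..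
  next
    show "form_eq P (pullback P' \<Phi> \<omega>') \<omega>" "form_eq P (pullback P' \<Phi> \<omega>\<^sub>1') \<omega>\<^sub>1" "form_eq P (pullback P' \<Phi> \<Omega>') \<Omega>"
      unfolding atomize_conj form_eq_def
    proof (intro conjI ballI allI)
      fix c y v assume c: "c \<in> P" "y \<in> cdom c"
      obtain c' d where c': "c' \<in> P'" "\<Phi> y \<in> cdom c'" and d: "d \<in> M" "pr y \<in> cdom d"
        using charts[OF c s\<Phi>] by metis
      have y: "y \<in> points P" by (rule in_pointsI[OF c(2,1)])
      have d': "pr' (\<Phi> y) \<in> cdom d" using pr\<Phi>[OF y] d(2) by simp
      have t: "tmap pr' c' d (\<Phi> y) (tmap \<Phi> c c' y v) = tmap pr c d y v"
        by (rule tm[OF c c' d s\<Phi>]) (rule pr\<Phi>)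
      have dh: "d_fun h' c' (\<Phi> y) (tmap \<Phi> c c' y v) = d_fun h c y v"
        using d_fun_compose[OF A.P B.P s\<Phi> B.h_fun c(1) c'(1) c(2) c'(2), of v] d_fun_cong[OF A.P c h\<Phi>, where w = v] by simp
      note pull = pullback_eq[OF A.P B.P s\<Phi> _ c(1) c'(1) c(2) c'(2)]
      show "pullback P' \<Phi> \<omega>' c y v = \<omega> c y v"
        unfolding pull[OF forms'(1)] form_eqD[OF U'(1) c'] form_eqD[OF U(1) c]
          A.omega0_eq[OF c d] B.omega0_eq[OF c' d(1) d'] t A.f0_def B.f0_def h\<Phi>[OF y]
        unfolding pr\<Phi>[OF y] ..
      show "pullback P' \<Phi> \<omega>\<^sub>1' c y v = \<omega>\<^sub>1 c y v"
        unfolding pull[OF forms'(2)] form_eqD[OF U'(2) c'] form_eqD[OF U(2) c]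
          A.omega1_eq[OF c d] B.omega1_eq[OF c' d(1) d'] t h\<Phi>[OF y]
        unfolding pr\<Phi>[OF y] ..
      show "pullback P' \<Phi> \<Omega>' c y v = \<Omega> c y v"
        unfolding pull[OF forms'(3)] form_eqD[OF U'(3) c'] form_eqD[OF U(3) c]
          A.Omega0_eq[OF c d] B.Omega0_eq[OF c' d(1) d'] t h\<Phi>[OF y] dh
        unfolding pr\<Phi>[OF y] ..
    qed
  qed
  moreover have "\<Psi> y = \<Phi> y"
    if iso: "bundle_iso P pr \<omega> \<omega>\<^sub>1 \<Omega> K\<^sub>1 K\<^sub>2 P' pr' \<omega>' \<omega>\<^sub>1' \<Omega>' K\<^sub>1' K\<^sub>2' \<Psi>" and y: "y \<in> points P" for \<Psi> y
  proof -
    have s\<Psi>: "smooth_map P P' \<Psi>" and pr\<Psi>: "\<And>y. y \<in> points P \<Longrightarrow> pr' (\<Psi> y) = pr y"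
      and eq: "form_eq P (pullback P' \<Psi> \<omega>\<^sub>1') \<omega>\<^sub>1"
      using iso unfolding bundle_iso_def diffeo_def by blast+
    obtain c where c: "c \<in> P" "y \<in> cdom c" using y by (rule in_pointsE)
    obtain c' d where c': "c' \<in> P'" "\<Psi> y \<in> cdom c'" and d: "d \<in> M" "pr y \<in> cdom d"
      using charts[OF c s\<Psi>] by metis
    have d': "pr' (\<Psi> y) \<in> cdom d" using pr\<Psi>[OF y] d(2) by simp
    \<comment> \<open>On a vector with \<mu>-value 1 the form \<open>\<omega>\<^sub>1\<close>
      returns the fibre coordinate itself.\<close>
    obtain w u v where u: "mu d (pr y) (tmap pr c d y u) = 1" by (rule A.adapted_vectors[OF c d])
    have t: "tmap pr' c' d (\<Psi> y) (tmap \<Psi> c c' y u) = tmap pr c d y u"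
      by (rule tm[OF c c' d s\<Psi>]) (rule pr\<Psi>)
    have "h' (\<Psi> y) = h y"
      using form_eqD[OF eq c, of u] u
      unfolding pullback_eq[OF A.P B.P s\<Psi> forms'(2) c(1) c'(1) c(2) c'(2)] form_eqD[OF U'(2) c'] form_eqD[OF U(2) c]
        A.omega1_eq[OF c d] B.omega1_eq[OF c' d(1) d'] t
      unfolding pr\<Psi>[OF y] by simp
    then show "\<Psi> y = \<Phi> y"
      using G1[OF smooth_map_in_points[OF s\<Psi> y]] pr\<Psi>[OF y] by (simp add: \<Phi>_def)
  qed
  ultimately show ?thesis by blast
qed

lemma cstar_bundle_fibration:
  assumes "twisted_shearfree M lam mu" "cstar_bundle M P pr h"
  shows "twisted_fibration M lam mu P pr h"
proof -
  interpret twisted_shearfree M lam mu by fact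
  have "smooth_manifold P" using assms(2) unfolding cstar_bundle_def by blast
  then show ?thesis using cstar_bundle_diffeo[OF M assms(2)] by unfold_locales
qed

lemma form_eq_trans_sym: "form_eq A \<alpha> \<gamma> \<Longrightarrow> form_eq A \<beta> \<gamma> \<Longrightarrow> form_eq A \<alpha> \<beta>"
  unfolding form_eq_def by simp

text \<open>\<open>bundle_iso\<close> does not mention the fibre coordinate. The primed bundle may
  therefore be read as a solution for \<open>lam\<close>, \<open>mu\<close> with coordinate
  \<open>h' y * g (pr' y)\<close>, which leaves two solutions for one representative.\<close>

lemma invariant_bundle_iso:
  assumes tw: "twisted_shearfree M lam mu" and oc': "oriented_congruence M lam' mu'"
    and same: "same_congruence M lam mu lam' mu'"
    and bun: "invariant_bundle M lam mu P pr h f \<omega> \<omega>\<^sub>1 \<Omega> K\<^sub>1 K\<^sub>2"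
    and bun': "invariant_bundle M lam' mu' P' pr' h' f' \<omega>' \<omega>\<^sub>1' \<Omega>' K\<^sub>1' K\<^sub>2'"
  shows "\<exists>\<Phi>. bundle_iso P pr \<omega> \<omega>\<^sub>1 \<Omega> K\<^sub>1 K\<^sub>2 P' pr' \<omega>' \<omega>\<^sub>1' \<Omega>' K\<^sub>1' K\<^sub>2' \<Phi> \<and>
    (\<forall>\<Psi>. bundle_iso P pr \<omega> \<omega>\<^sub>1 \<Omega> K\<^sub>1 K\<^sub>2 P' pr' \<omega>' \<omega>\<^sub>1' \<Omega>' K\<^sub>1' K\<^sub>2' \<Psi> \<longrightarrow> (\<forall>y\<in>points P. \<Psi> y = \<Phi> y))"
proof -
  interpret twisted_shearfree M lam mu by fact
  have sys: "invariant_system M lam mu P pr h f \<omega> \<omega>\<^sub>1 \<Omega> K\<^sub>1 K\<^sub>2" and b: "cstar_bundle M P pr h"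
    and sys': "invariant_system M lam' mu' P' pr' h' f' \<omega>' \<omega>\<^sub>1' \<Omega>' K\<^sub>1' K\<^sub>2'" and b': "cstar_bundle M P' pr' h'"
    using bun bun' unfolding invariant_bundle_def by blast+
  have P': "smooth_manifold P'" using b' unfolding cstar_bundle_def by blast
  note F' = cstar_bundle_diffeo[OF M b']
  obtain g k where g: "smooth_fun M g" "\<And>x. x \<in> points M \<Longrightarrow> g x \<noteq> 0"
    and sys'': "invariant_system M lam mu P' pr' (\<lambda>y. h' y * g (pr' y)) k \<omega>' \<omega>\<^sub>1' \<Omega>' K\<^sub>1' K\<^sub>2'"
    by (rule gauge_system[OF M oc oc' same P' F' sys']) (rule that; assumption)
  have "twisted_fibration M lam mu P' pr' (\<lambda>y. h' y * g (pr' y))"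
    using P' gauge_diffeo[OF M P' F' g] by unfold_locales
  from twisted_fibration_iso[OF cstar_bundle_fibration[OF tw b] this sys sys''] show ?thesis .
qed

theorem theorem7p2:
  fixes M :: "('m::{t2_space, second_countable_topology}, real^3) atlas"
    and lam mu :: "('m, real^3) form1"
  assumes "smooth_manifold M"
    and "oriented_congruence M lam mu"
    and "\<forall>x\<in>points M. twist M lam mu x \<noteq> 0"
    and "\<forall>x\<in>points M. shear M lam mu x = 0"
  shows
    "(\<exists>(P :: ('m \<times> complex, (real^3) \<times> complex) atlas) pr h f \<omega> \<omega>\<^sub>1 \<Omega> K\<^sub>1 K\<^sub>2.
        invariant_bundle M lam mu P pr h f \<omega> \<omega>\<^sub>1 \<Omega> K\<^sub>1 K\<^sub>2) \<and>
     (\<forall>(P :: ('p::{t2_space, second_countable_topology}, 'f::euclidean_space) atlas) pr h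
        f \<omega> \<omega>\<^sub>1 \<Omega> K\<^sub>1 K\<^sub>2 f' \<omega>' \<omega>\<^sub>1' \<Omega>' K\<^sub>1' K\<^sub>2'.
        cstar_bundle M P pr h \<and>
        invariant_system M lam mu P pr h f \<omega> \<omega>\<^sub>1 \<Omega> K\<^sub>1 K\<^sub>2 \<and>
        invariant_system M lam mu P pr h f' \<omega>' \<omega>\<^sub>1' \<Omega>' K\<^sub>1' K\<^sub>2' \<longrightarrow>
        form_eq P \<omega> \<omega>' \<and> form_eq P \<omega>\<^sub>1 \<omega>\<^sub>1' \<and> form_eq P \<Omega> \<Omega>' \<and>
        (\<forall>y\<in>points P. f y = f' y \<and> K\<^sub>1 y = K\<^sub>1' y \<and> K\<^sub>2 y = K\<^sub>2' y)) \<and>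
     (\<forall>lam' mu'
        (P :: ('p::{t2_space, second_countable_topology}, 'f::euclidean_space) atlas) pr h
        f \<omega> \<omega>\<^sub>1 \<Omega> K\<^sub>1 K\<^sub>2
        (P' :: ('q::{t2_space, second_countable_topology}, 'g::euclidean_space) atlas) pr' h'
        f' \<omega>' \<omega>\<^sub>1' \<Omega>' K\<^sub>1' K\<^sub>2'.
        oriented_congruence M lam' mu' \<and> same_congruence M lam mu lam' mu' \<and>
        invariant_bundle M lam mu P pr h f \<omega> \<omega>\<^sub>1 \<Omega> K\<^sub>1 K\<^sub>2 \<and>
        invariant_bundle M lam' mu' P' pr' h' f' \<omega>' \<omega>\<^sub>1' \<Omega>' K\<^sub>1' K\<^sub>2' \<longrightarrow>
        (\<exists>\<Phi>. bundle_iso P pr \<omega> \<omega>\<^sub>1 \<Omega> K\<^sub>1 K\<^sub>2 P' pr' \<omega>' \<omega>\<^sub>1' \<Omega>' K\<^sub>1' K\<^sub>2' \<Phi> \<and>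
           (\<forall>\<Psi>. bundle_iso P pr \<omega> \<omega>\<^sub>1 \<Omega> K\<^sub>1 K\<^sub>2 P' pr' \<omega>' \<omega>\<^sub>1' \<Omega>' K\<^sub>1' K\<^sub>2' \<Psi> \<longrightarrow>
              (\<forall>y\<in>points P. \<Psi> y = \<Phi> y)))) \<and>
     smooth_fun M (k1 M lam mu) \<and> smooth_fun M (k2 M lam mu) \<and>
     (\<forall>(P :: ('p::{t2_space, second_countable_topology}, 'f::euclidean_space) atlas) pr h
        f \<omega> \<omega>\<^sub>1 \<Omega> K\<^sub>1 K\<^sub>2.
        invariant_bundle M lam mu P pr h f \<omega> \<omega>\<^sub>1 \<Omega> K\<^sub>1 K\<^sub>2 \<longrightarrow>
        (\<forall>y\<in>points P.
           K\<^sub>1 y = k1 M lam mu (pr y) / (cmod (h y))\<^sup>2 \<and>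
           K\<^sub>2 y = complex_of_real (1 / (cmod (h y)) ^ 3) * cis (- Arg (h y)) * k2 M lam mu (pr y))) \<and>
     (\<forall>lam' mu'. oriented_congruence M lam' mu' \<and> same_congruence M lam mu lam' mu' \<longrightarrow>
        ((\<forall>x\<in>points M. k1 M lam mu x = 0) \<longleftrightarrow> (\<forall>x\<in>points M. k1 M lam' mu' x = 0)) \<and>
        ((\<forall>x\<in>points M. k2 M lam mu x = 0) \<longleftrightarrow> (\<forall>x\<in>points M. k2 M lam' mu' x = 0)) \<and>
        (\<forall>x\<in>points M. k1 M lam mu x \<noteq> 0 \<longrightarrow> sgn (k1 M lam' mu' x) = sgn (k1 M lam mu x)))"
proof -
  interpret twisted_shearfree M lam mu using assms by unfold_locales blast+
  note tw = twisted_shearfree_axioms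
  show ?thesis
  proof (intro conjI allI impI)
    interpret T: twisted_fibration M lam mu "prod_manifold M cstar" fst snd
      by (rule cstar_bundle_fibration[OF tw cstar_bundle_prod[OF M]])
    show "\<exists>(P :: ('m \<times> complex, (real^3) \<times> complex) atlas) pr h f \<omega> \<omega>\<^sub>1 \<Omega> K\<^sub>1 K\<^sub>2.
        invariant_bundle M lam mu P pr h f \<omega> \<omega>\<^sub>1 \<Omega> K\<^sub>1 K\<^sub>2"
      using cstar_bundle_prod[OF M] T.standard_system unfolding invariant_bundle_def by blast
  next
    fix P :: "('p, 'f) atlas" and pr h f \<omega> \<omega>\<^sub>1 \<Omega> K\<^sub>1 K\<^sub>2 f' \<omega>' \<omega>\<^sub>1' \<Omega>' K\<^sub>1' K\<^sub>2'
    assume "cstar_bundle M P pr h \<and>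
      invariant_system M lam mu P pr h f \<omega> \<omega>\<^sub>1 \<Omega> K\<^sub>1 K\<^sub>2 \<and>
      invariant_system M lam mu P pr h f' \<omega>' \<omega>\<^sub>1' \<Omega>' K\<^sub>1' K\<^sub>2'"
    then have b: "cstar_bundle M P pr h" and sys: "invariant_system M lam mu P pr h f \<omega> \<omega>\<^sub>1 \<Omega> K\<^sub>1 K\<^sub>2"
      and sys': "invariant_system M lam mu P pr h f' \<omega>' \<omega>\<^sub>1' \<Omega>' K\<^sub>1' K\<^sub>2'" by blast+
    interpret T: twisted_fibration M lam mu P pr h by (rule cstar_bundle_fibration[OF tw b])
    note U = T.system_unique[OF sys] and U' = T.system_unique[OF sys']
    show "form_eq P \<omega> \<omega>'" "form_eq P \<omega>\<^sub>1 \<omega>\<^sub>1'" "form_eq P \<Omega> \<Omega>'"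
      by (rule form_eq_trans_sym[OF U(1) U'(1)] form_eq_trans_sym[OF U(2) U'(2)] form_eq_trans_sym[OF U(3) U'(3)])+
    show "\<forall>y\<in>points P. f y = f' y \<and> K\<^sub>1 y = K\<^sub>1' y \<and> K\<^sub>2 y = K\<^sub>2' y"
      using U(4-6) U'(4-6) by simp
  next
    fix lam' mu' and P :: "('p, 'f) atlas" and pr h f \<omega> \<omega>\<^sub>1 \<Omega> K\<^sub>1 K\<^sub>2 and P' :: "('q, 'g) atlas"
      and pr' h' f' \<omega>' \<omega>\<^sub>1' \<Omega>' K\<^sub>1' K\<^sub>2'
    assume "oriented_congruence M lam' mu' \<and> same_congruence M lam mu lam' mu' \<and>
        invariant_bundle M lam mu P pr h f \<omega> \<omega>\<^sub>1 \<Omega> K\<^sub>1 K\<^sub>2 \<and>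
        invariant_bundle M lam' mu' P' pr' h' f' \<omega>' \<omega>\<^sub>1' \<Omega>' K\<^sub>1' K\<^sub>2'"
    then show "\<exists>\<Phi>. bundle_iso P pr \<omega> \<omega>\<^sub>1 \<Omega> K\<^sub>1 K\<^sub>2 P' pr' \<omega>' \<omega>\<^sub>1' \<Omega>' K\<^sub>1' K\<^sub>2' \<Phi> \<and>
           (\<forall>\<Psi>. bundle_iso P pr \<omega> \<omega>\<^sub>1 \<Omega> K\<^sub>1 K\<^sub>2 P' pr' \<omega>' \<omega>\<^sub>1' \<Omega>' K\<^sub>1' K\<^sub>2' \<Psi> \<longrightarrow>
              (\<forall>y\<in>points P. \<Psi> y = \<Phi> y))"
      by (elim conjE) (rule invariant_bundle_iso[OF tw])
  next
    show "smooth_fun M (k1 M lam mu)" by (rule smooth_k1)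
    show "smooth_fun M (k2 M lam mu)" by (rule smooth_k2)
  next
    fix P :: "('p, 'f) atlas" and pr h f \<omega> \<omega>\<^sub>1 \<Omega> K\<^sub>1 K\<^sub>2
    assume "invariant_bundle M lam mu P pr h f \<omega> \<omega>\<^sub>1 \<Omega> K\<^sub>1 K\<^sub>2"
    then have b: "cstar_bundle M P pr h" and sys: "invariant_system M lam mu P pr h f \<omega> \<omega>\<^sub>1 \<Omega> K\<^sub>1 K\<^sub>2"
      unfolding invariant_bundle_def by blast+
    interpret T: twisted_fibration M lam mu P pr h by (rule cstar_bundle_fibration[OF tw b])
    show "\<forall>y\<in>points P. K\<^sub>1 y = k1 M lam mu (pr y) / (cmod (h y))\<^sup>2 \<and>
      K\<^sub>2 y = complex_of_real (1 / (cmod (h y)) ^ 3) * cis (- Arg (h y)) * k2 M lam mu (pr y)"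
      using T.system_unique(5,6)[OF sys] unfolding T.K10_def T.K20_def by simp
  next
    fix lam' mu'
    assume "oriented_congruence M lam' mu' \<and> same_congruence M lam mu lam' mu'"
    then have g: "\<exists>r z. r > 0 \<and> z \<noteq> 0 \<and> k1 M lam' mu' x = r * k1 M lam mu x \<and> k2 M lam' mu' x = z * k2 M lam mu x"
      if "x \<in> points M" for x
      using twisted_shearfree_gauge(2)[OF tw _ _ that] by blast
    show "(\<forall>x\<in>points M. k1 M lam mu x = 0) = (\<forall>x\<in>points M. k1 M lam' mu' x = 0)"
      using g by (metis less_irrefl mult_eq_0_iff)
    show "(\<forall>x\<in>points M. k2 M lam mu x = 0) = (\<forall>x\<in>points M. k2 M lam' mu' x = 0)"
      using g by (metis mult_eq_0_iff)
    show "\<forall>x\<in>points M. k1 M lam mu x \<noteq> 0 \<longrightarrow> sgn (k1 M lam' mu' x) = sgn (k1 M lam mu x)"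
    proof (intro ballI impI)
      fix x assume "x \<in> points M"
      \<comment> \<open>The sign survives because the gauge factor of k_1 is positive.\<close>
      from g[OF this] obtain r where "r > 0" "k1 M lam' mu' x = r * k1 M lam mu x" by blast
      then show "sgn (k1 M lam' mu' x) = sgn (k1 M lam mu x)" by (simp add: sgn_mult)
    qed
  qed
qed

end
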